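(* Let $n\ge 2$ be an integer, $0<p<\infty$, and $0<q\le\infty$. A complex-linear isometric embedding $\ell_q^2(\mathbb C)\to\mathcal S_p^n$ exists if and only if $q=p$ or $q=2$. Consequently, if $m\ge 2$ is an integer, $p\ne q$, and $q\ne 2$, there is no complex-linear isometric embedding $\mathcal S_q^m\to\mathcal S_p^n$.
   Context: For $0<p<\infty$, $\mathcal S_p^n$ is $M_n(\mathbb C)$ with the (quasi-)norm $\|A\|_p=(\sum_j s_j(A)^p)^{1/p}=(\operatorname{Tr}|A|^p)^{1/p}$, where $s_j(A)$ are the singular values of $A$; $\mathcal S_\infty^n$ is $M_n(\mathbb C)$ with the operator norm. $\ell_q^2(\mathbb C)$ is $\mathbb C^2$ with $\|(a,b)\|_q=(|a|^q+|b|^q)^{1/q}$ for $q<\infty$ and $\|(a,b)\|_\infty=\max(|a|,|b|)$. A complex-linear isometric embedding is a complex-linear map $T$ with $\|Tx\|=\|x\|$ for all $x$ (with respect to the given (quasi-)norms). *)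

theory Defs
  imports
    "Jordan_Normal_Form.Schur_Decomposition"
    "HOL-Library.Extended_Real"
    "HOL-Computational_Algebra.Fundamental_Theorem_Algebra"
begin

definition ell_norm :: "ereal \<Rightarrow> complex vec \<Rightarrow> real" where
  \<comment> \<open>the (quasi-)norm of \<open>\<ell>\<^sub>q\<^sup>2(\<complex>)\<close>; intended for vectors of dimension 2 and \<open>0 < q\<close>\<close>
  "ell_norm q v =
     (if q = \<infinity> then max (cmod (v $ 0)) (cmod (v $ 1))
      else (cmod (v $ 0) powr real_of_ereal q + cmod (v $ 1) powr real_of_ereal q)
             powr (1 / real_of_ereal q))"

definition euclidean_norm :: "complex vec \<Rightarrow> real" where
  "euclidean_norm v = sqrt (\<Sum>i<dim_vec v. (cmod (v $ i))\<^sup>2)"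

definition operator_norm :: "complex mat \<Rightarrow> real" where
  "operator_norm A =
     (SUP v \<in> {v \<in> carrier_vec (dim_col A). euclidean_norm v \<le> 1}. euclidean_norm (A *\<^sub>v v))"

definition singular_values :: "complex mat \<Rightarrow> real multiset" where
  \<comment> \<open>square roots of the eigenvalues of \<open>A\<^sup>*A\<close>, with algebraic multiplicity; these eigenvalues
      are real and nonnegative, so \<open>Re\<close> only changes the type\<close>
  "singular_values A =
     image_mset (\<lambda>x. sqrt (Re x)) (proots (char_poly (mat_adjoint A * A)))"

definition schatten_norm :: "ereal \<Rightarrow> complex mat \<Rightarrow> real" where
  \<comment> \<open>intended for \<open>0 < p\<close>; since \<open>0 powr p = 0\<close>, zero singular values do not contribute\<close>
  "schatten_norm p A =
     (if p = \<infinity> then operator_norm A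
      else (\<Sum>s \<in># singular_values A. s powr real_of_ereal p) powr (1 / real_of_ereal p))"

definition isometric_embedding ::
  "(complex, 'a) module \<Rightarrow> ('a \<Rightarrow> real) \<Rightarrow> (complex, 'b) module \<Rightarrow> ('b \<Rightarrow> real) \<Rightarrow>
   ('a \<Rightarrow> 'b) \<Rightarrow> bool" where
  "isometric_embedding V normV W normW T \<longleftrightarrow>
     linear_map class_ring V W T \<and> (\<forall>x \<in> carrier V. normW (T x) = normV x)"

end

theory Submission
  imports
    "HOL-Analysis.Equivalence_Lebesgue_Henstock_Integration"
    "HOL-Real_Asymp.Real_Asymp"
    Defs
begin

text \<open>
  An isometric pair \<open>A, B\<close> satisfies \<open>Tr |A + z B|^p = F |z|\<close> with \<open>F r = (1 + r^q)^(p/q)\<close>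
  (\<open>F r = max 1 r ^ p\<close> for \<open>q = \<infinity>\<close>), and the behaviour of both sides as \<open>z \<rightarrow> 0\<close> is compared.
  By a singular value decomposition \<open>A\<close> may be taken diagonal.

  For \<open>p \<ge> 2\<close>, Jensen's inequality for the column norms yields \<open>F r \<ge> 1 + c r^2\<close> with \<open>c > 0\<close> unless the
  row and column spaces of \<open>A\<close> and \<open>B\<close> are orthogonal, in which case \<open>F 1 = 2\<close>; a quadratic upper bound
  for \<open>x^p\<close> yields \<open>F r \<le> 1 + K r^2\<close>. Together they leave only \<open>q = 2\<close> and \<open>q = p\<close>.

  For \<open>p < 2\<close>, the formula \<open>x^p = C \<integral> ln (1 + t x^2) t^(-p/2-1) dt\<close> expresses the trace by
  \<open>ln det (1 + t M* M)\<close> with \<open>M = A + z B\<close>, and by Cauchy--Binet this determinant is a sum of terms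
  \<open>t^j |P z|^2\<close> with polynomials \<open>P\<close>. Averaged over \<open>z, iz, -z, -iz\<close>, its logarithm lies between
  \<open>1 - O(r^4)\<close> and \<open>1 + O(r^2)\<close> times the logarithm of the sum of the leading terms. If \<open>q > 2\<close>, this forces
  \<open>B = 0\<close>. If \<open>q < 2\<close>, the terms with \<open>j > rank A\<close> contribute a function \<open>g r\<close> asymptotic to a multiple of
  \<open>r^q\<close>; for \<open>p < q\<close> a scaling argument shows that \<open>g r / r^q\<close> is nondecreasing up to \<open>O(r^(2q/p - q))\<close>, while
  the second order term of \<open>F\<close>, of size \<open>r^(2q)\<close>, is negative.
\<close>

no_notation Finite_Cartesian_Product.vec.vec_nth (infixl "$" 90)
hide_const (open) Finite_Cartesian_Product.mat Finite_Cartesian_Product.vec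
hide_type (open) Finite_Cartesian_Product.vec

section \<open>Unitary matrices and singular value decomposition\<close>

text \<open>The two error bounds differ for a reason. The upper estimate only has to identify the
  limit of \<open>g r / r^q\<close>, so a relative error O(r^2) is harmless for q < 2. The lower
  estimate competes with the term of size r^(2q) in \<open>F\<close>; averaging over the fourth
  roots of unity removes the orders 1 to 3 and leaves O(r^4), which suffices because 2q < 4. For p,
  q < 2 the exponents are tied to orders of vanishing. A minor using i more rows than the rank of
  \<open>A\<close> vanishes at 0 to some order e >= i; this makes g = O(r^p), so p <= q. If p < q,
  each single minor bounds \<open>g\<close> below by a multiple of r^(pe/i), so e >= (q/p) i > i.
  Hence no bordered minor has order one, \<open>B\<close> vanishes outside the support of
  \<open>A\<close>, and the orders double: e >= 2i, which gives 2p <= q and thus p < 1. Only then is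
  the growth error r^(2q/p) smaller than r^(2q), so that the negative coefficient of r^(2q) in
  \<open>F\<close> is contradictory.\<close>

lemma index_mat_mult_sum:
  assumes "A \<in> carrier_mat n m" "B \<in> carrier_mat m l" "i < n" "j < l"
  shows "(A * B) $$ (i,j) = (\<Sum>k<m. A $$ (i,k) * B $$ (k,j))"
  using assms by (simp add: scalar_prod_def atLeast0LessThan)

lemma dim_mat_adjoint [simp]:
  "dim_row (mat_adjoint A) = dim_col A" "dim_col (mat_adjoint A) = dim_row A"
  by (simp_all add: mat_adjoint_def mat_of_rows_def)

lemma mat_adjoint_carrier [simp]: "A \<in> carrier_mat n m \<Longrightarrow> mat_adjoint A \<in> carrier_mat m n"
  by (rule carrier_matI) auto

lemma index_mat_adjoint [simp]:
  "i < dim_col A \<Longrightarrow> j < dim_row A \<Longrightarrow> mat_adjoint A $$ (i,j) = cnj (A $$ (j,i))" for A :: "complex mat"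
  by (simp add: mat_adjoint_def mat_of_rows_def)

lemma mat_adjoint_adjoint [simp]: "mat_adjoint (mat_adjoint A) = A" for A :: "complex mat"
  by (rule eq_matI) auto

lemma mat_adjoint_mult:
  fixes A B :: "complex mat"
  assumes A: "A \<in> carrier_mat n m" and B: "B \<in> carrier_mat m l"
  shows "mat_adjoint (A * B) = mat_adjoint B * mat_adjoint A"
proof (rule eq_matI)
  fix i j assume ij: "i < dim_row (mat_adjoint B * mat_adjoint A)" "j < dim_col (mat_adjoint B * mat_adjoint A)"
  then have i: "i < l" and j: "j < n" using A B by auto
  have AB: "A * B \<in> carrier_mat n l" using A B by simp
  have 1: "mat_adjoint (A * B) $$ (i,j) = cnj ((A * B) $$ (j,i))"
    by (rule index_mat_adjoint) (use A B i j in auto)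
  have 2: "(mat_adjoint B * mat_adjoint A) $$ (i,j) = (\<Sum>k<m. mat_adjoint B $$ (i,k) * mat_adjoint A $$ (k,j))"
    by (rule index_mat_mult_sum) (use A B i j in auto)
  show "mat_adjoint (A * B) $$ (i,j) = (mat_adjoint B * mat_adjoint A) $$ (i,j)"
    unfolding 1 2 index_mat_mult_sum[OF A B j i] cnj_sum
    by (rule sum.cong) (use A B i j in auto)
qed (use A B in auto)

definition unitary :: "nat \<Rightarrow> complex mat \<Rightarrow> bool" where
  "unitary n U \<longleftrightarrow> U \<in> carrier_mat n n \<and> mat_adjoint U * U = 1\<^sub>m n"

lemma unitary_carrier [simp]: "unitary n U \<Longrightarrow> U \<in> carrier_mat n n"
  by (simp add: unitary_def)

lemma unitary_right: "unitary n U \<Longrightarrow> U * mat_adjoint U = 1\<^sub>m n"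
  unfolding unitary_def by (metis mat_adjoint_carrier mat_mult_left_right_inverse)

lemma unitary_adjoint: "unitary n U \<Longrightarrow> unitary n (mat_adjoint U)"
  using unitary_right[of n U] by (simp add: unitary_def)

lemma unitary_mult:
  assumes U: "unitary n U" and V: "unitary n V"
  shows "unitary n (U * V)"
proof -
  have c [simp]: "U \<in> carrier_mat n n" "V \<in> carrier_mat n n"
    "mat_adjoint U \<in> carrier_mat n n" "mat_adjoint V \<in> carrier_mat n n" using U V by auto
  have c' [simp]: "U * V \<in> carrier_mat n n" by (rule mult_carrier_mat[of _ n n]) simp_all
  have "mat_adjoint (U * V) * (U * V) = mat_adjoint V * mat_adjoint U * (U * V)"
    by (subst mat_adjoint_mult[of _ n n _ n]) simp_all
  also have "\<dots> = mat_adjoint V * (mat_adjoint U * (U * V))"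
    by (rule assoc_mult_mat[of _ n n _ n _ n]) simp_all
  also have "mat_adjoint U * (U * V) = (mat_adjoint U * U) * V"
    by (rule assoc_mult_mat[of _ n n _ n _ n, symmetric]) simp_all
  also have "\<dots> = V" using U by (simp add: unitary_def left_mult_one_mat[of V n n])
  also have "mat_adjoint V * V = 1\<^sub>m n" using V by (simp add: unitary_def)
  finally show ?thesis by (simp add: unitary_def)
qed

lemma unitary_cols:
  assumes "unitary n U" "i < n" "j < n"
  shows "(\<Sum>k<n. cnj (U $$ (k,i)) * U $$ (k,j)) = (if i = j then 1 else 0)"
proof -
  have "(mat_adjoint U * U) $$ (i,j) = (if i = j then 1 else 0)"
    using assms by (simp add: unitary_def)
  moreover have "(mat_adjoint U * U) $$ (i,j) = (\<Sum>k<n. mat_adjoint U $$ (i,k) * U $$ (k,j))"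
    by (rule index_mat_mult_sum) (use assms in auto)
  ultimately show ?thesis using assms unitary_carrier[OF assms(1)] by simp
qed

lemma unitary_rows:
  assumes "unitary n U" "i < n" "j < n"
  shows "(\<Sum>k<n. U $$ (i,k) * cnj (U $$ (j,k))) = (if i = j then 1 else 0)"
proof -
  have c: "U \<in> carrier_mat n n" using assms by simp
  have "(\<Sum>k<n. cnj (mat_adjoint U $$ (k,i)) * mat_adjoint U $$ (k,j)) = (if i = j then 1 else 0)"
    by (rule unitary_cols[OF unitary_adjoint]) (use assms in auto)
  then show ?thesis using c assms by simp
qed

lemma unitary_col_sq:
  assumes "unitary n U" "i < n"
  shows "(\<Sum>k<n. (cmod (U $$ (k,i)))\<^sup>2) = 1"
proof -
  have "complex_of_real (\<Sum>k<n. (cmod (U $$ (k,i)))\<^sup>2) = 1"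
    using unitary_cols[OF assms assms(2)] by (simp add: complex_norm_square mult.commute del: of_real_power)
  then show ?thesis using of_real_eq_1_iff by blast
qed

lemma unitary_row_sq:
  assumes "unitary n U" "i < n"
  shows "(\<Sum>k<n. (cmod (U $$ (i,k)))\<^sup>2) = 1"
proof -
  have "complex_of_real (\<Sum>k<n. (cmod (U $$ (i,k)))\<^sup>2) = 1"
    using unitary_rows[OF assms assms(2)] by (simp add: complex_norm_square del: of_real_power)
  then show ?thesis using of_real_eq_1_iff by blast
qed

text \<open>Complete \<open>v\<close> to a basis and apply Gram-Schmidt, which keeps the first
  vector but yields only orthogonal vectors; dividing by the norms \<open>sqrt (c j)\<close> makes
  them orthonormal and leaves the unit vector \<open>v\<close> unchanged.\<close>

lemma unitary_with_first_col:
  fixes v :: "complex Matrix.vec"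
  assumes v: "v \<in> carrier_vec n" and nv: "(\<Sum>i<n. (cmod (v $ i))\<^sup>2) = 1"
  obtains W where "unitary n W" "\<And>i. i < n \<Longrightarrow> W $$ (i,0) = v $ i"
proof -
  interpret cof_vec_space n "TYPE(complex)" .
  have v0: "v \<noteq> 0\<^sub>v n" using nv by auto
  define b where "b = basis_completion v"
  define ws where "ws = gram_schmidt n b"
  from basis_completion[OF v v0, folded b_def]
  have dist_b: "distinct b" 
    and indep: "\<not> lin_dep (set b)" and b: "set b \<subseteq> carrier_vec n" and hdb: "hd b = v" 
    and len_b: "length b = n" by auto
  have n: "n > 0" using nv by (cases n) auto
  from hdb len_b n obtain vs where bv: "b = v # vs" by (cases b) auto
  from gram_schmidt_result[OF b dist_b indep refl, folded ws_def]
  have ws: "set ws \<subseteq> carrier_vec n" "corthogonal ws" "length ws = n" 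
    by (auto simp: len_b)
  from gram_schmidt_hd[OF v, of vs, folded bv] have hdws: "hd ws = v" unfolding ws_def .
  define c where "c j = (\<Sum>k<n. (cmod ((ws ! j) $ k))\<^sup>2)" for j
  have cc: "ws ! j \<bullet>c ws ! j = complex_of_real (c j)" if "j < n" for j
  proof -
    have "ws ! j \<in> carrier_vec n" using ws that by auto
    then show ?thesis
      by (simp add: scalar_prod_def c_def atLeast0LessThan complex_norm_square del: of_real_power)
  qed
  have cpos: "c j > 0" if "j < n" for j
  proof -
    have "ws ! j \<bullet>c ws ! j \<noteq> 0" using corthogonalD[OF ws(2), of j j] that ws(3) by auto
    then have "c j \<noteq> 0" using cc[OF that] by auto
    moreover have "c j \<ge> 0" by (simp add: c_def sum_nonneg)
    ultimately show ?thesis by linarith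
  qed
  define W where "W = mat n n (\<lambda>(i,j). (ws ! j) $ i / complex_of_real (sqrt (c j)))"
  have Wc: "W \<in> carrier_mat n n" by (simp add: W_def)
  have "mat_adjoint W * W = 1\<^sub>m n"
  proof (rule eq_matI)
    fix i j assume "i < dim_row (1\<^sub>m n)" "j < dim_col (1\<^sub>m n)"
    then have ij: "i < n" "j < n" by auto
    have cj: "ws ! i \<in> carrier_vec n" "ws ! j \<in> carrier_vec n" using ws ij by auto
    have "(mat_adjoint W * W) $$ (i,j) = (\<Sum>k<n. mat_adjoint W $$ (i,k) * W $$ (k,j))"
      by (rule index_mat_mult_sum) (use Wc ij in auto)
    also have "\<dots> = (\<Sum>k<n. (ws ! j) $ k * cnj ((ws ! i) $ k)) / complex_of_real (sqrt (c i) * sqrt (c j))"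
      unfolding sum_divide_distrib using Wc ij by (intro sum.cong) (auto simp: W_def mult_ac)
    also have "(\<Sum>k<n. (ws ! j) $ k * cnj ((ws ! i) $ k)) = ws ! j \<bullet>c ws ! i"
      using cj by (simp add: scalar_prod_def atLeast0LessThan)
    finally have *: "(mat_adjoint W * W) $$ (i,j) = ws ! j \<bullet>c ws ! i / complex_of_real (sqrt (c i) * sqrt (c j))" .
    show "(mat_adjoint W * W) $$ (i,j) = 1\<^sub>m n $$ (i,j)"
    proof (cases "i = j")
      case True
      have "complex_of_real (sqrt (c j) * sqrt (c j)) = complex_of_real (c j)"
        using cpos[OF ij(2)] by simp
      then show ?thesis using * True cc[OF ij(2)] cpos[OF ij(2)] ij
        by (simp del: of_real_mult real_sqrt_mult_self)
    next
      case False
      then have "ws ! j \<bullet>c ws ! i = 0" using corthogonalD[OF ws(2), of j i] ws(3) ij by auto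
      then show ?thesis using * False ij by simp
    qed
  qed (use Wc in auto)
  then have "unitary n W" using Wc by (simp add: unitary_def)
  moreover have "W $$ (i,0) = v $ i" if "i < n" for i
  proof -
    have w0: "ws ! 0 = v" using hdws ws(3) n by (cases ws) auto
    have "c 0 = 1" using nv unfolding c_def w0 by simp
    then show ?thesis using that n w0 by (simp add: W_def)
  qed
  ultimately show thesis by (rule that)
qed

text \<open>\<open>v\<close> is a unit eigenvector of the Gram matrix \<open>H\<close>, obtained
  from a root of its characteristic polynomial, and \<open>u\<close> is the normalised image of
  \<open>v\<close> under \<open>A\<close>. Such a pair is what one deflation step of the singular
  value decomposition needs.\<close>

lemma singular_pair_exists:
  fixes A :: "complex mat"
  assumes A: "A \<in> carrier_mat n n" and n: "n > 0"
  obtains u v s where "u \<in> carrier_vec n" "v \<in> carrier_vec n" "s \<ge> (0::real)"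
    "(\<Sum>i<n. (cmod (u $ i))\<^sup>2) = 1" "(\<Sum>i<n. (cmod (v $ i))\<^sup>2) = 1"
    "\<And>i. i < n \<Longrightarrow> (\<Sum>k<n. A $$ (i,k) * v $ k) = s * u $ i"
    "\<And>i. i < n \<Longrightarrow> (\<Sum>k<n. cnj (A $$ (k,i)) * u $ k) = s * v $ i"
proof -
  have normalize: "\<exists>c>0. (\<Sum>i<n. (cmod (complex_of_real c * w $ i))\<^sup>2) = 1"
    if w: "w \<in> carrier_vec n" "w \<noteq> 0\<^sub>v n" for w :: "complex Matrix.vec"
  proof -
    obtain i where i: "i < n" "w $ i \<noteq> 0" using w by (metis carrier_vecD eq_vecI index_zero_vec(1) index_zero_vec(2))
    define N where "N = (\<Sum>i<n. (cmod (w $ i))\<^sup>2)"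
    have "(cmod (w $ i))\<^sup>2 \<le> N" unfolding N_def using i by (intro member_le_sum) auto
    then have N: "N > 0" using i by (smt (verit) zero_less_norm_iff zero_less_power)
    have "(\<Sum>i<n. (cmod (complex_of_real (1 / sqrt N) * w $ i))\<^sup>2) = (\<Sum>i<n. (1/N) * (cmod (w $ i))\<^sup>2)"
      using N by (intro sum.cong) (auto simp: norm_mult norm_divide power_mult_distrib power_divide)
    also have "\<dots> = 1" using N unfolding sum_distrib_left[symmetric] N_def[symmetric] by simp
    finally show ?thesis using N by (intro exI[of _ "1 / sqrt N"]) auto
  qed
  define H where "H = mat_adjoint A * A"
  have Hc: "H \<in> carrier_mat n n"
    unfolding H_def by (rule mult_carrier_mat[OF mat_adjoint_carrier[OF A] A])
  have "degree (char_poly H) = n" using degree_monic_char_poly[OF Hc] by simp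
  then have "\<not> constant (poly (char_poly H))" using n by (simp add: constant_degree)
  then obtain l where "poly (char_poly H) l = 0" using fundamental_theorem_of_algebra by blast
  then have "eigenvalue H l" using eigenvalue_root_char_poly[OF Hc] by simp
  then obtain w where w: "w \<in> carrier_vec n" "w \<noteq> 0\<^sub>v n" "H *\<^sub>v w = l \<cdot>\<^sub>v w"
    using Hc unfolding eigenvalue_def eigenvector_def by auto
  obtain c where c: "c > 0" "(\<Sum>i<n. (cmod (complex_of_real c * w $ i))\<^sup>2) = 1"
    using normalize[OF w(1,2)] by blast
  define v where "v = complex_of_real c \<cdot>\<^sub>v w"
  have vc: "v \<in> carrier_vec n" using w by (simp add: v_def)
  have nv: "(\<Sum>i<n. (cmod (v $ i))\<^sup>2) = 1" using c w by (simp add: v_def)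
  define x where "x i = (\<Sum>k<n. A $$ (i,k) * v $ k)" for i
  have Hv: "(\<Sum>k<n. cnj (A $$ (k,i)) * x k) = l * v $ i" if i: "i < n" for i
  proof -
    have "H *\<^sub>v v = l \<cdot>\<^sub>v v" unfolding v_def using w Hc
      by (metis mult_mat_vec smult_smult_assoc mult.commute)
    then have "(H *\<^sub>v v) $ i = l * v $ i" using i vc by simp
    moreover have "H *\<^sub>v v = mat_adjoint A *\<^sub>v (A *\<^sub>v v)"
      unfolding H_def by (rule assoc_mult_mat_vec[OF mat_adjoint_carrier[OF A] A vc])
    moreover have "(mat_adjoint A *\<^sub>v (A *\<^sub>v v)) $ i = (\<Sum>k<n. cnj (A $$ (k,i)) * x k)"
      using A vc i by (simp add: scalar_prod_def x_def atLeast0LessThan)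
    ultimately show ?thesis by simp
  qed
  show thesis
  proof (cases "\<forall>i<n. x i = 0")
    case True
    \<comment> \<open>Here the image of \<open>v\<close> prescribes no direction for
      \<open>u\<close>. Since \<open>A\<close> is singular, so is its transpose, and the conjugate
      of a kernel vector of the transpose lies in the kernel of the adjoint.\<close>
    have "A *\<^sub>v v = 0\<^sub>v n" using True A vc
      by (intro eq_vecI) (auto simp: scalar_prod_def x_def atLeast0LessThan)
    moreover have "v \<noteq> 0\<^sub>v n" using nv by auto
    ultimately have "det A = 0" using det_0_iff_vec_prod_zero[OF A] vc by blast
    then have "det (transpose_mat A) = 0" using det_transpose[OF A] by simp
    then obtain y where y: "y \<in> carrier_vec n" "y \<noteq> 0\<^sub>v n" "transpose_mat A *\<^sub>v y = 0\<^sub>v n"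
      using det_0_iff_vec_prod_zero[of "transpose_mat A" n] A by auto
    obtain e where e: "e > 0" "(\<Sum>i<n. (cmod (complex_of_real e * y $ i))\<^sup>2) = 1"
      using normalize[OF y(1,2)] by blast
    have 0: "(\<Sum>k<n. A $$ (k,i) * y $ k) = 0" if "i < n" for i
    proof -
      have "(\<Sum>k<n. A $$ (k,i) * y $ k) = (transpose_mat A *\<^sub>v y) $ i"
        using that A y(1) by (simp add: scalar_prod_def atLeast0LessThan)
      then show ?thesis using y(3) that by simp
    qed
    show thesis
    proof (rule that[of "vec n (\<lambda>i. complex_of_real e * cnj (y $ i))" v 0])
      show "(\<Sum>i<n. (cmod (vec n (\<lambda>i. complex_of_real e * cnj (y $ i)) $ i))\<^sup>2) = 1"
        using e by (simp add: norm_mult)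
      fix i assume i: "i < n"
      have "(\<Sum>k<n. cnj (A $$ (k,i)) * (vec n (\<lambda>i. complex_of_real e * cnj (y $ i))) $ k)
          = complex_of_real e * cnj (\<Sum>k<n. A $$ (k,i) * y $ k)"
        unfolding cnj_sum sum_distrib_left by (intro sum.cong) auto
      then show "(\<Sum>k<n. cnj (A $$ (k,i)) * (vec n (\<lambda>i. complex_of_real e * cnj (y $ i))) $ k)
          = complex_of_real 0 * v $ i" using 0[OF i] by simp
      show "(\<Sum>k<n. A $$ (i,k) * v $ k) = complex_of_real 0 * (vec n (\<lambda>i. complex_of_real e * cnj (y $ i))) $ i"
        using True i by (simp add: x_def)
    qed (use vc nv in auto)
  next
    case False
    define N where "N = (\<Sum>i<n. (cmod (x i))\<^sup>2)"
    obtain i where i: "i < n" "x i \<noteq> 0" using False by auto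
    have "(cmod (x i))\<^sup>2 \<le> N" unfolding N_def using i by (intro member_le_sum) auto
    then have N: "N > 0" using i by (smt (verit) zero_less_norm_iff zero_less_power)
    \<comment> \<open>Computes \<open>N\<close>, the squared norm of the image of \<open>v\<close>,
      through the eigenvalue equation for \<open>H\<close>: the eigenvalue \<open>l\<close> equals
      \<open>N\<close>, so it is real and positive, and \<open>sqrt N\<close> is the singular
      value.\<close>
    have "complex_of_real N = (\<Sum>i<n. x i * cnj (x i))"
      by (simp add: N_def complex_norm_square del: of_real_power)
    also have "\<dots> = (\<Sum>i<n. \<Sum>k<n. x i * cnj (A $$ (i,k)) * cnj (v $ k))"
    proof (intro sum.cong refl)
      fix i
      have "cnj (x i) = (\<Sum>k<n. cnj (A $$ (i,k)) * cnj (v $ k))" by (simp add: x_def)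
      then show "x i * cnj (x i) = (\<Sum>k<n. x i * cnj (A $$ (i,k)) * cnj (v $ k))"
        by (simp add: sum_distrib_left mult_ac)
    qed
    also have "\<dots> = (\<Sum>k<n. \<Sum>i<n. x i * cnj (A $$ (i,k)) * cnj (v $ k))" by (rule sum.swap)
    also have "\<dots> = (\<Sum>k<n. cnj (v $ k) * (\<Sum>i<n. cnj (A $$ (i,k)) * x i))"
      by (simp add: sum_distrib_left mult_ac)
    also have "\<dots> = (\<Sum>k<n. l * (v $ k * cnj (v $ k)))"
      using Hv by (intro sum.cong) (auto simp: mult_ac)
    also have "\<dots> = l * complex_of_real (\<Sum>k<n. (cmod (v $ k))\<^sup>2)"
      by (simp add: sum_distrib_left complex_norm_square del: of_real_power)
    finally have l: "l = complex_of_real N" using nv by simp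
    show thesis
    proof (rule that[of "vec n (\<lambda>i. x i / sqrt N)" v "sqrt N"])
      have "(\<Sum>i<n. (cmod (vec n (\<lambda>i. x i / sqrt N) $ i))\<^sup>2) = (\<Sum>i<n. (1/N) * (cmod (x i))\<^sup>2)"
        using N by (intro sum.cong) (auto simp: norm_divide power_divide)
      also have "\<dots> = 1" using N unfolding sum_distrib_left[symmetric] N_def[symmetric] by simp
      finally show "(\<Sum>i<n. (cmod (vec n (\<lambda>i. x i / sqrt N) $ i))\<^sup>2) = 1" .
      fix i assume i: "i < n"
      show "(\<Sum>k<n. A $$ (i,k) * v $ k) = complex_of_real (sqrt N) * vec n (\<lambda>i. x i / sqrt N) $ i"
        using i N by (simp add: x_def)
      have "(\<Sum>k<n. cnj (A $$ (k,i)) * vec n (\<lambda>i. x i / sqrt N) $ k)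
         = (\<Sum>k<n. cnj (A $$ (k,i)) * x k) / sqrt N"
        unfolding sum_divide_distrib by (intro sum.cong) auto
      also have "\<dots> = complex_of_real (N / sqrt N) * v $ i" unfolding Hv[OF i] l by simp
      also have "N / sqrt N = sqrt N" using N by (simp add: real_div_sqrt)
      finally show "(\<Sum>k<n. cnj (A $$ (k,i)) * vec n (\<lambda>i. x i / sqrt N) $ k) = complex_of_real (sqrt N) * v $ i" .
    qed (use vc nv N in auto)
  qed
qed
lemma unitaryI:
  assumes c: "U \<in> carrier_mat n n"
    and "\<And>i j. i < n \<Longrightarrow> j < n \<Longrightarrow> (\<Sum>k<n. cnj (U $$ (k,i)) * U $$ (k,j)) = (if i = j then 1 else 0)"
  shows "unitary n U"
  unfolding unitary_def
proof
  show "mat_adjoint U * U = 1\<^sub>m n"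
  proof (rule eq_matI)
    fix i j assume "i < dim_row (1\<^sub>m n)" "j < dim_col (1\<^sub>m n)"
    then have ij: "i < n" "j < n" by auto
    have "(mat_adjoint U * U) $$ (i,j) = (\<Sum>k<n. mat_adjoint U $$ (i,k) * U $$ (k,j))"
      by (rule index_mat_mult_sum) (use c ij in auto)
    then show "(mat_adjoint U * U) $$ (i,j) = 1\<^sub>m n $$ (i,j)"
      using assms(2)[OF ij] c ij by simp
  qed (use c in auto)
qed (rule c)

lemma unitary_one: "unitary n (1\<^sub>m n)"
proof (rule unitaryI)
  fix i j assume ij: "i < n" "j < n"
  have "(\<Sum>k<n. cnj (1\<^sub>m n $$ (k,i)) * 1\<^sub>m n $$ (k,j)) = (\<Sum>k<n. if k = i then (if i = j then 1 else 0) else (0::complex))"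
    by (intro sum.cong) (use ij in auto)
  then show "(\<Sum>k<n. cnj (1\<^sub>m n $$ (k,i)) * 1\<^sub>m n $$ (k,j)) = (if i = j then 1 else (0::complex))" using ij by simp
qed simp

definition diag_real :: "nat \<Rightarrow> (nat \<Rightarrow> real) \<Rightarrow> complex mat" where
  "diag_real n d = mat n n (\<lambda>(i,j). if i = j then complex_of_real (d i) else 0)"

lemma diag_real_carrier [simp]: "diag_real n d \<in> carrier_mat n n"
  by (simp add: diag_real_def)

lemma dim_diag_real [simp]: "dim_row (diag_real n d) = n" "dim_col (diag_real n d) = n"
  by (simp_all add: diag_real_def)

lemma index_diag_real [simp]:
  "i < n \<Longrightarrow> j < n \<Longrightarrow> diag_real n d $$ (i,j) = (if i = j then complex_of_real (d i) else 0)"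
  by (simp add: diag_real_def)

lemma mat_adjoint_diag_real [simp]: "mat_adjoint (diag_real n d) = diag_real n d"
  by (rule eq_matI) auto

lemma diag_real_mult: "diag_real n d * diag_real n e = diag_real n (\<lambda>i. d i * e i)"
proof (rule eq_matI)
  fix i j assume "i < dim_row (diag_real n (\<lambda>i. d i * e i))" "j < dim_col (diag_real n (\<lambda>i. d i * e i))"
  then have ij: "i < n" "j < n" by auto
  have "(diag_real n d * diag_real n e) $$ (i,j) = (\<Sum>k<n. diag_real n d $$ (i,k) * diag_real n e $$ (k,j))"
    by (rule index_mat_mult_sum) (use ij in auto)
  also have "\<dots> = (\<Sum>k<n. if k = i then diag_real n d $$ (i,k) * diag_real n e $$ (k,j) else 0)"
    by (rule sum.cong) (use ij in auto)
  finally show "(diag_real n d * diag_real n e) $$ (i,j) = diag_real n (\<lambda>i. d i * e i) $$ (i,j)"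
    using ij by simp
qed auto

lemma mult3_carrier [simp]:
  "A \<in> carrier_mat n n \<Longrightarrow> B \<in> carrier_mat n n \<Longrightarrow> C \<in> carrier_mat n n \<Longrightarrow> A * B * C \<in> carrier_mat n n"
  by (rule mult_carrier_mat[of _ n n]) auto

lemma index_svd:
  assumes U: "U \<in> carrier_mat n n" and V: "V \<in> carrier_mat n n" and ij: "i < n" "j < n"
  shows "(U * diag_real n d * mat_adjoint V) $$ (i,j) = (\<Sum>k<n. U $$ (i,k) * d k * cnj (V $$ (j,k)))"
proof -
  have UD: "U * diag_real n d \<in> carrier_mat n n" by (rule mult_carrier_mat[OF U]) simp
  have "(U * diag_real n d * mat_adjoint V) $$ (i,j)
    = (\<Sum>k<n. (U * diag_real n d) $$ (i,k) * mat_adjoint V $$ (k,j))"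
    by (rule index_mat_mult_sum[OF UD]) (use V ij in auto)
  also have "\<dots> = (\<Sum>k<n. U $$ (i,k) * d k * cnj (V $$ (j,k)))"
  proof (rule sum.cong[OF refl])
    fix k assume k: "k \<in> {..<n}"
    have "(U * diag_real n d) $$ (i,k) = (\<Sum>l<n. U $$ (i,l) * diag_real n d $$ (l,k))"
      by (rule index_mat_mult_sum[OF U]) (use ij k in auto)
    also have "\<dots> = (\<Sum>l<n. if l = k then U $$ (i,l) * diag_real n d $$ (l,k) else 0)"
      by (rule sum.cong) (use k in auto)
    finally show "(U * diag_real n d) $$ (i,k) * mat_adjoint V $$ (k,j) = U $$ (i,k) * d k * cnj (V $$ (j,k))"
      using k ij V by simp
  qed
  finally show ?thesis .
qed

lemma unitary_conj_mult:
  assumes U: "unitary n U" and V: "unitary n V" and A: "A \<in> carrier_mat n n"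
    and M: "M = mat_adjoint U * A * V"
  shows "A = U * M * mat_adjoint V"
proof -
  have Uc: "U \<in> carrier_mat n n" and Vc: "V \<in> carrier_mat n n" using U V by auto
  have Ua: "mat_adjoint U \<in> carrier_mat n n" and Va: "mat_adjoint V \<in> carrier_mat n n" using Uc Vc by auto
  have UA: "mat_adjoint U * A \<in> carrier_mat n n" using Ua A by (rule mult_carrier_mat)
  have "U * M = U * (mat_adjoint U * A) * V"
    unfolding M by (rule assoc_mult_mat[OF Uc UA Vc, symmetric])
  also have "U * (mat_adjoint U * A) = U * mat_adjoint U * A"
    by (rule assoc_mult_mat[OF Uc Ua A, symmetric])
  also have "\<dots> = A" using unitary_right[OF U] A by simp
  finally have "U * M * mat_adjoint V = A * V * mat_adjoint V" by simp
  also have "\<dots> = A * (V * mat_adjoint V)" by (rule assoc_mult_mat[OF A Vc Va])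
  also have "\<dots> = A" using unitary_right[OF V] A by simp
  finally show ?thesis by simp
qed

lemma svd_compose:
  assumes U: "unitary n U" and V: "unitary n V" and U': "unitary n U'" and V': "unitary n V'"
    and D: "D \<in> carrier_mat n n"
  shows "U * (U' * D * mat_adjoint V') * mat_adjoint V = (U * U') * D * mat_adjoint (V * V')"
proof -
  have c: "U \<in> carrier_mat n n" "V \<in> carrier_mat n n" "U' \<in> carrier_mat n n" "V' \<in> carrier_mat n n"
    using assms by auto
  have ca: "mat_adjoint V \<in> carrier_mat n n" "mat_adjoint V' \<in> carrier_mat n n" using c by auto
  have UD: "U' * D \<in> carrier_mat n n" using c(3) D by (rule mult_carrier_mat)
  have UUD: "U * (U' * D) \<in> carrier_mat n n" using c(1) UD by (rule mult_carrier_mat)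
  have "U * (U' * D * mat_adjoint V') = U * (U' * D) * mat_adjoint V'"
    by (rule assoc_mult_mat[OF c(1) UD ca(2), symmetric])
  moreover have "U * (U' * D) = U * U' * D" by (rule assoc_mult_mat[OF c(1,3) D, symmetric])
  moreover have "U * (U' * D) * mat_adjoint V' * mat_adjoint V = U * (U' * D) * (mat_adjoint V' * mat_adjoint V)"
    by (rule assoc_mult_mat[OF UUD ca(2,1)])
  moreover have "mat_adjoint (V * V') = mat_adjoint V' * mat_adjoint V"
    by (rule mat_adjoint_mult[OF c(2,4)])
  ultimately show ?thesis by simp
qed

text \<open>Induction by deflation: unitaries with the singular pair as first columns turn
  \<open>A\<close> into a matrix whose first row and column vanish off the corner. The relation for
  \<open>A\<close> clears the column, the one for the adjoint clears the row, and the remaining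
  block falls to the induction hypothesis.\<close>

theorem svd_exists:
  assumes "A \<in> carrier_mat n n"
  shows "\<exists>U V d. unitary n U \<and> unitary n V \<and> (\<forall>i. 0 \<le> d i) \<and> A = U * diag_real n d * mat_adjoint V"
  using assms
proof (induction n arbitrary: A)
  case 0
  have "A = 1\<^sub>m 0 * diag_real 0 (\<lambda>_. 0) * mat_adjoint (1\<^sub>m 0)" using 0 by (intro eq_matI) auto
  moreover have "unitary 0 (1\<^sub>m 0)" by (rule unitaryI) auto
  ultimately show ?case by (intro exI[of _ "1\<^sub>m 0"] exI[of _ "\<lambda>_. 0"]) auto
next
  case (Suc n)
  note A = Suc.prems
  obtain u v s where uv: "u \<in> carrier_vec (Suc n)" "v \<in> carrier_vec (Suc n)" and s: "s \<ge> (0::real)"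
    and nu: "(\<Sum>i<Suc n. (cmod (u $ i))\<^sup>2) = 1" and nv: "(\<Sum>i<Suc n. (cmod (v $ i))\<^sup>2) = 1"
    and Av: "\<And>i. i < Suc n \<Longrightarrow> (\<Sum>k<Suc n. A $$ (i,k) * v $ k) = s * u $ i"
    and Au: "\<And>i. i < Suc n \<Longrightarrow> (\<Sum>k<Suc n. cnj (A $$ (k,i)) * u $ k) = s * v $ i"
    by (rule singular_pair_exists[OF A zero_less_Suc], rule that)
  obtain X where X: "unitary (Suc n) X" and Xu: "\<And>i. i < Suc n \<Longrightarrow> X $$ (i,0) = u $ i"
    by (rule unitary_with_first_col[OF uv(1) nu], rule that)
  obtain Y where Y: "unitary (Suc n) Y" and Yv: "\<And>i. i < Suc n \<Longrightarrow> Y $$ (i,0) = v $ i"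
    by (rule unitary_with_first_col[OF uv(2) nv], rule that)
  have Xc: "X \<in> carrier_mat (Suc n) (Suc n)" and Yc: "Y \<in> carrier_mat (Suc n) (Suc n)" using X Y by auto
  define M where "M = mat_adjoint X * A * Y"
  have XA: "mat_adjoint X * A \<in> carrier_mat (Suc n) (Suc n)"
    using mat_adjoint_carrier[OF Xc] A by (rule mult_carrier_mat)
  have Mc: "M \<in> carrier_mat (Suc n) (Suc n)" unfolding M_def using XA Yc by (rule mult_carrier_mat)
  have XAi: "(mat_adjoint X * A) $$ (i,l) = (\<Sum>k<Suc n. cnj (X $$ (k,i)) * A $$ (k,l))"
    if "i < Suc n" "l < Suc n" for i l
  proof -
    have "(mat_adjoint X * A) $$ (i,l) = (\<Sum>k<Suc n. mat_adjoint X $$ (i,k) * A $$ (k,l))"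
      by (rule index_mat_mult_sum[OF mat_adjoint_carrier[OF Xc] A that])
    also have "\<dots> = (\<Sum>k<Suc n. cnj (X $$ (k,i)) * A $$ (k,l))"
      by (rule sum.cong) (use Xc that in auto)
    finally show ?thesis .
  qed
  have Mi: "M $$ (i,j) = (\<Sum>l<Suc n. \<Sum>k<Suc n. cnj (X $$ (k,i)) * A $$ (k,l) * Y $$ (l,j))"
    if "i < Suc n" "j < Suc n" for i j
  proof -
    have "M $$ (i,j) = (\<Sum>l<Suc n. (mat_adjoint X * A) $$ (i,l) * Y $$ (l,j))"
      unfolding M_def by (rule index_mat_mult_sum[OF XA Yc that])
    also have "\<dots> = (\<Sum>l<Suc n. \<Sum>k<Suc n. cnj (X $$ (k,i)) * A $$ (k,l) * Y $$ (l,j))"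
      unfolding sum_distrib_right[symmetric] using XAi that(1) by (intro sum.cong) auto
    finally show ?thesis .
  qed
  have M0: "M $$ (i,0) = (if i = 0 then of_real s else 0)" if i: "i < Suc n" for i
  proof -
    have "M $$ (i,0) = (\<Sum>k<Suc n. \<Sum>l<Suc n. cnj (X $$ (k,i)) * A $$ (k,l) * Y $$ (l,0))"
      unfolding Mi[OF i zero_less_Suc] by (rule sum.swap)
    also have "\<dots> = (\<Sum>k<Suc n. cnj (X $$ (k,i)) * (\<Sum>l<Suc n. A $$ (k,l) * v $ l))"
      unfolding sum_distrib_left using Yv by (intro sum.cong refl) (simp add: mult.assoc)
    also have "\<dots> = (\<Sum>k<Suc n. s * (cnj (X $$ (k,i)) * X $$ (k,0)))"
      using Av Xu by (intro sum.cong refl) (simp add: mult_ac)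
    also have "\<dots> = complex_of_real s * (if i = 0 then 1 else 0)"
      unfolding sum_distrib_left[symmetric] unitary_cols[OF X i zero_less_Suc] ..
    finally show ?thesis by simp
  qed
  have M0': "M $$ (0,j) = (if j = 0 then of_real s else 0)" if j: "j < Suc n" for j
  proof -
    have "M $$ (0,j) = (\<Sum>l<Suc n. cnj (\<Sum>k<Suc n. cnj (A $$ (k,l)) * u $ k) * Y $$ (l,j))"
      unfolding Mi[OF zero_less_Suc j] cnj_sum sum_distrib_right
      using Xu by (intro sum.cong refl) (simp add: mult_ac)
    also have "\<dots> = (\<Sum>l<Suc n. s * (cnj (Y $$ (l,0)) * Y $$ (l,j)))"
      using Au Yv by (intro sum.cong refl) (simp add: mult_ac)
    also have "\<dots> = complex_of_real s * (if 0 = j then 1 else 0)"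
      unfolding sum_distrib_left[symmetric] unitary_cols[OF Y zero_less_Suc j] ..
    finally show ?thesis by simp
  qed
  define A' where "A' = mat n n (\<lambda>(i,j). M $$ (Suc i, Suc j))"
  have "A' \<in> carrier_mat n n" by (simp add: A'_def)
  from Suc.IH[OF this] obtain U V d where U: "unitary n U" and V: "unitary n V" and d: "\<And>i. 0 \<le> d i"
    and A'svd: "A' = U * diag_real n d * mat_adjoint V" by blast
  \<comment> \<open>Block sum of the 1 x 1 identity with \<open>W\<close>, so that the decomposition
    of the smaller block acts in the full dimension.\<close>
  define ext where "ext W = mat (Suc n) (Suc n) (\<lambda>(i,j). if i = 0 \<and> j = 0 then 1
     else if i = 0 \<or> j = 0 then 0 else W $$ (i - 1, j - 1))" for W :: "complex mat"
  have ext_c: "ext W \<in> carrier_mat (Suc n) (Suc n)" for W by (simp add: ext_def)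
  have ext_i: "ext W $$ (0,0) = 1" "j < n \<Longrightarrow> ext W $$ (0, Suc j) = 0" "i < n \<Longrightarrow> ext W $$ (Suc i, 0) = 0"
    "i < n \<Longrightarrow> j < n \<Longrightarrow> ext W $$ (Suc i, Suc j) = W $$ (i,j)" for W i j
    by (simp_all add: ext_def)
  have ext_u: "unitary (Suc n) (ext W)" if W: "unitary n W" for W
  proof (rule unitaryI[OF ext_c])
    fix i j assume ij: "i < Suc n" "j < Suc n"
    show "(\<Sum>k<Suc n. cnj (ext W $$ (k,i)) * ext W $$ (k,j)) = (if i = j then 1 else 0)"
      using ij unitary_cols[OF W, of "i - 1" "j - 1"]
      unfolding sum.lessThan_Suc_shift by (cases i; cases j) (auto simp: ext_i)
  qed
  define e where "e i = (case i of 0 \<Rightarrow> s | Suc i \<Rightarrow> d i)" for i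
  have "M = ext U * diag_real (Suc n) e * mat_adjoint (ext V)"
  proof (rule eq_matI)
    fix i j assume "i < dim_row (ext U * diag_real (Suc n) e * mat_adjoint (ext V))"
      "j < dim_col (ext U * diag_real (Suc n) e * mat_adjoint (ext V))"
    then have ij: "i < Suc n" "j < Suc n" using ext_c[of U] ext_c[of V] by auto
    have 1: "M $$ (Suc i, Suc j) = (\<Sum>k<n. U $$ (i,k) * d k * cnj (V $$ (j,k)))" if "i < n" "j < n" for i j
    proof -
      have "A' $$ (i,j) = (\<Sum>k<n. U $$ (i,k) * d k * cnj (V $$ (j,k)))"
        unfolding A'svd by (rule index_svd) (use U V that in auto)
      then show ?thesis using that by (simp add: A'_def)
    qed
    show "M $$ (i,j) = (ext U * diag_real (Suc n) e * mat_adjoint (ext V)) $$ (i,j)"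
      unfolding index_svd[OF ext_c ext_c ij] sum.lessThan_Suc_shift
      using ij M0[OF ij(1)] M0'[OF ij(2)] 1[of "i - 1" "j - 1"]
      by (cases i; cases j) (auto simp: ext_i e_def)
  qed (use Mc ext_c[of U] ext_c[of V] in auto)
  then have "A = X * (ext U * diag_real (Suc n) e * mat_adjoint (ext V)) * mat_adjoint Y"
    using unitary_conj_mult[OF X Y A M_def] by simp
  also have "\<dots> = (X * ext U) * diag_real (Suc n) e * mat_adjoint (Y * ext V)"
    by (rule svd_compose[OF X Y ext_u[OF U] ext_u[OF V]]) simp
  finally have "A = (X * ext U) * diag_real (Suc n) e * mat_adjoint (Y * ext V)" .
  moreover have "\<forall>i. 0 \<le> e i" using s d by (auto simp: e_def split: nat.split)
  moreover have "unitary (Suc n) (X * ext U)" by (rule unitary_mult[OF X ext_u[OF U]])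
  moreover have "unitary (Suc n) (Y * ext V)" by (rule unitary_mult[OF Y ext_u[OF V]])
  ultimately show ?case by blast
qed

section \<open>Singular values, Schatten sums and determinants from a decomposition\<close>

lemma proots_prod_linear: "proots (\<Prod>a\<leftarrow>as. [:- a, 1:]) = mset as" for as :: "complex list"
proof (induction as)
  case (Cons a as)
  have "(\<Prod>a\<leftarrow>as. [:- a, 1:]) \<noteq> 0" by (auto simp: prod_list_zero_iff)
  then show ?case using Cons by (simp add: proots_mult del: mult_pCons_left)
qed simp

lemma gram_svd:
  assumes U: "unitary n U" and V: "unitary n V" and A: "A = U * diag_real n d * mat_adjoint V"
  shows "mat_adjoint A * A = V * diag_real n (\<lambda>i. (d i)\<^sup>2) * mat_adjoint V"
proof -
  let ?D = "diag_real n d"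
  have Uc: "U \<in> carrier_mat n n" and Vc: "V \<in> carrier_mat n n" using U V by auto
  have Ua: "mat_adjoint U \<in> carrier_mat n n" and Va: "mat_adjoint V \<in> carrier_mat n n" using Uc Vc by auto
  have Dc: "?D \<in> carrier_mat n n" by simp
  have UD: "U * ?D \<in> carrier_mat n n" using Uc Dc by (rule mult_carrier_mat)
  have DU: "?D * mat_adjoint U \<in> carrier_mat n n" using Dc Ua by (rule mult_carrier_mat)
  have UDV: "U * ?D * mat_adjoint V \<in> carrier_mat n n" using UD Va by (rule mult_carrier_mat)
  have DV: "?D * mat_adjoint V \<in> carrier_mat n n" using Dc Va by (rule mult_carrier_mat)
  have "mat_adjoint A = V * (?D * mat_adjoint U)"
    unfolding A mat_adjoint_mult[OF UD Va] mat_adjoint_mult[OF Uc Dc] by simp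
  then have "mat_adjoint A * A = V * (?D * mat_adjoint U * A)"
    using assoc_mult_mat[OF Vc DU, of A n] UDV A by simp
  also have "?D * mat_adjoint U * A = ?D * (mat_adjoint U * (U * (?D * mat_adjoint V)))"
    unfolding A assoc_mult_mat[OF Uc Dc Va] by (rule assoc_mult_mat[OF Dc Ua mult_carrier_mat[OF Uc DV]])
  also have "mat_adjoint U * (U * (?D * mat_adjoint V)) = mat_adjoint U * U * (?D * mat_adjoint V)"
    by (rule assoc_mult_mat[OF Ua Uc DV, symmetric])
  also have "\<dots> = ?D * mat_adjoint V" using U DV by (simp add: unitary_def)
  also have "?D * (?D * mat_adjoint V) = ?D * ?D * mat_adjoint V"
    by (rule assoc_mult_mat[OF Dc Dc Va, symmetric])
  also have "?D * ?D = diag_real n (\<lambda>i. (d i)\<^sup>2)" by (simp add: diag_real_mult power2_eq_square)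
  also have "V * (diag_real n (\<lambda>i. (d i)\<^sup>2) * mat_adjoint V) = V * diag_real n (\<lambda>i. (d i)\<^sup>2) * mat_adjoint V"
    by (rule assoc_mult_mat[OF Vc diag_real_carrier Va, symmetric])
  finally show ?thesis .
qed

lemma similar_unitary:
  assumes V: "unitary n V" and D: "D \<in> carrier_mat n n"
  shows "similar_mat (V * D * mat_adjoint V) D"
  unfolding similar_mat_def
proof (intro exI)
  show "similar_mat_wit (V * D * mat_adjoint V) D V (mat_adjoint V)"
    by (rule similar_mat_witI[of _ _ n])
      (use V D unitary_right[OF V] in \<open>auto simp: unitary_def\<close>)
qed

lemma char_poly_diag_real: "char_poly (diag_real n d) = (\<Prod>a\<leftarrow>map (\<lambda>i. complex_of_real (d i)) [0..<n]. [:- a, 1:])"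
proof -
  have "upper_triangular (diag_real n d)" by (auto simp: upper_triangular_def)
  from char_poly_upper_triangular[OF diag_real_carrier this]
  have "char_poly (diag_real n d) = (\<Prod>a\<leftarrow>diag_mat (diag_real n d). [:- a, 1:])" .
  moreover have "diag_mat (diag_real n d) = map (\<lambda>i. complex_of_real (d i)) [0..<n]"
    by (simp add: diag_mat_def)
  ultimately show ?thesis by simp
qed

text \<open>The Gram matrix is unitarily similar to the diagonal matrix of the
  \<open>(d i)\<^sup>2\<close>, so its characteristic polynomial splits with these roots;
  nonnegativity of \<open>d\<close> undoes the square.\<close>

lemma singular_values_svd:
  assumes U: "unitary n U" and V: "unitary n V" and d: "\<And>i. 0 \<le> d i"
  shows "singular_values (U * diag_real n d * mat_adjoint V) = mset (map d [0..<n])"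
proof -
  let ?A = "U * diag_real n d * mat_adjoint V"
  have "char_poly (mat_adjoint ?A * ?A) = char_poly (diag_real n (\<lambda>i. (d i)\<^sup>2))"
    unfolding gram_svd[OF U V refl]
    by (rule char_poly_similar[OF similar_unitary[OF V diag_real_carrier]])
  then have "proots (char_poly (mat_adjoint ?A * ?A)) = mset (map (\<lambda>i. complex_of_real ((d i)\<^sup>2)) [0..<n])"
    unfolding char_poly_diag_real by (simp only: proots_prod_linear)
  then show ?thesis unfolding singular_values_def using d by (simp add: multiset.map_comp o_def del: of_real_power)
qed

text \<open>The \<open>p\<close>-th power of the Schatten quasi-norm. Without the outer root it is
  additive over singular values, hence accessible to integral formulas and to Jensen's
  inequality.\<close>

definition schatten_sum :: "real \<Rightarrow> complex mat \<Rightarrow> real" where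
  "schatten_sum p A = (\<Sum>s\<in>#singular_values A. s powr p)"

lemma schatten_sum_svd:
  assumes "unitary n U" "unitary n V" "\<And>i. 0 \<le> d i"
  shows "schatten_sum p (U * diag_real n d * mat_adjoint V) = (\<Sum>i<n. d i powr p)"
proof -
  have "schatten_sum p (U * diag_real n d * mat_adjoint V) = (\<Sum>i\<leftarrow>[0..<n]. d i powr p)"
    unfolding schatten_sum_def singular_values_svd[OF assms]
    by (simp flip: mset_map sum_mset_sum_list add: multiset.map_comp o_def)
  then show ?thesis by (simp add: interv_sum_list_conv_sum_set_nat atLeast0LessThan)
qed

lemma schatten_sum_unitary:
  assumes U: "unitary n U" and V: "unitary n V" and A: "A \<in> carrier_mat n n"
  shows "schatten_sum p (U * A * mat_adjoint V) = schatten_sum p A"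
proof -
  obtain X Y d where X: "unitary n X" and Y: "unitary n Y" and d: "\<And>i. 0 \<le> d i"
    and svd: "A = X * diag_real n d * mat_adjoint Y" using svd_exists[OF A] by blast
  have "U * A * mat_adjoint V = (U * X) * diag_real n d * mat_adjoint (V * Y)"
    unfolding svd by (rule svd_compose[OF U V X Y]) simp
  then have "schatten_sum p (U * A * mat_adjoint V) = (\<Sum>i<n. d i powr p)"
    using schatten_sum_svd[OF unitary_mult[OF U X] unitary_mult[OF V Y] d] by simp
  also have "\<dots> = schatten_sum p A" unfolding svd by (rule schatten_sum_svd[OF X Y d, symmetric])
  finally show ?thesis .
qed

text \<open>Conjugation by \<open>V\<close> diagonalises both summands at once. Singular values of a
  pencil are not polynomial in its entries; this determinant, which encodes them, is polynomial in
  the entries and their conjugates.\<close>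

lemma det_one_plus_gram:
  assumes U: "unitary n U" and V: "unitary n V" and A: "A = U * diag_real n d * mat_adjoint V"
  shows "det (1\<^sub>m n + complex_of_real t \<cdot>\<^sub>m (mat_adjoint A * A)) = complex_of_real (\<Prod>i<n. 1 + t * (d i)\<^sup>2)"
proof -
  let ?E = "diag_real n (\<lambda>i. 1 + t * (d i)\<^sup>2)"
  have Vc: "V \<in> carrier_mat n n" using V by simp
  have "1\<^sub>m n + complex_of_real t \<cdot>\<^sub>m (mat_adjoint A * A) = V * ?E * mat_adjoint V"
  proof (rule eq_matI)
    fix i j assume "i < dim_row (V * ?E * mat_adjoint V)" "j < dim_col (V * ?E * mat_adjoint V)"
    then have ij: "i < n" "j < n" using Vc by auto
    have "(V * ?E * mat_adjoint V) $$ (i,j) = (\<Sum>k<n. V $$ (i,k) * (1 + t * (d k)\<^sup>2) * cnj (V $$ (j,k)))"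
      using index_svd[OF Vc Vc ij, of "\<lambda>i. 1 + t * (d i)\<^sup>2"] by simp
    also have "\<dots> = (\<Sum>k<n. V $$ (i,k) * cnj (V $$ (j,k))) + t * (\<Sum>k<n. V $$ (i,k) * complex_of_real ((d k)\<^sup>2) * cnj (V $$ (j,k)))"
      by (simp add: sum.distrib sum_distrib_left algebra_simps)
    also have "(\<Sum>k<n. V $$ (i,k) * complex_of_real ((d k)\<^sup>2) * cnj (V $$ (j,k)))
       = (V * diag_real n (\<lambda>i. (d i)\<^sup>2) * mat_adjoint V) $$ (i,j)"
      by (rule index_svd[OF Vc Vc ij, symmetric])
    finally show "(1\<^sub>m n + complex_of_real t \<cdot>\<^sub>m (mat_adjoint A * A)) $$ (i,j) = (V * ?E * mat_adjoint V) $$ (i,j)"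
      unfolding gram_svd[OF U V A] unitary_rows[OF V ij] using ij Vc by simp
  qed (use Vc in \<open>auto simp: gram_svd[OF U V A]\<close>)
  then have "det (1\<^sub>m n + complex_of_real t \<cdot>\<^sub>m (mat_adjoint A * A)) = det ?E"
    using det_similar[OF similar_unitary[OF V diag_real_carrier]] by simp
  also have "\<dots> = prod_list (diag_mat ?E)"
    by (rule det_upper_triangular[of _ n]) (auto simp: upper_triangular_def)
  also have "\<dots> = (\<Prod>i<n. complex_of_real (1 + t * (d i)\<^sup>2))"
    by (simp add: diag_mat_def prod.list_conv_set_nth atLeast0LessThan)
  finally show ?thesis by simp
qed

section \<open>Powers as logarithmic integrals\<close>

text \<open>The measure \<open>t powr (- a - 1) dt\<close> on the positive half line. Its weight is
  homogeneous: substituting \<open>c * t\<close> for \<open>t\<close> multiplies integrals by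
  \<open>c powr a\<close>, which is the source of the powers of singular values and radii
  below.\<close>

definition powr_measure :: "real \<Rightarrow> real measure" where
  "powr_measure a = density lborel (\<lambda>t. ennreal (indicator {0<..} t * t powr (- a - 1)))"

lemma sets_powr_measure [simp, measurable_cong]: "sets (powr_measure a) = sets borel"
  by (simp add: powr_measure_def)

lemma space_powr_measure [simp]: "space (powr_measure a) = UNIV"
  by (simp add: powr_measure_def)

lemma AE_powr_measure: "AE t in powr_measure a. t > 0"
  unfolding powr_measure_def by (subst AE_density) (auto simp: indicator_def)

lemma integrable_powr_measure_iff:
  fixes g :: "real \<Rightarrow> real"
  assumes [measurable]: "g \<in> borel_measurable borel"
  shows "integrable (powr_measure a) g \<longleftrightarrow> integrable lborel (\<lambda>t. indicator {0<..} t * t powr (- a - 1) * g t)"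
  unfolding powr_measure_def by (subst integrable_density) auto

lemma integral_powr_measure_eq:
  fixes g :: "real \<Rightarrow> real"
  assumes [measurable]: "g \<in> borel_measurable borel"
  shows "integral\<^sup>L (powr_measure a) g = (\<integral>t. indicator {0<..} t * t powr (- a - 1) * g t \<partial>lborel)"
  unfolding powr_measure_def by (subst integral_density) auto

lemma powr_measure_weight_scale:
  assumes "c > 0"
  shows "indicator {0<..} (c * t) * (c * t) powr (- a - 1) = c powr (- a - 1) * (indicator {0<..} t * t powr (- a - 1) :: real)"
  using assms by (auto simp: indicator_def powr_mult zero_less_mult_iff)

lemma integrable_powr_measure_scale:
  fixes g :: "real \<Rightarrow> real"
  assumes c: "c > 0" and [measurable]: "g \<in> borel_measurable borel" and g: "integrable (powr_measure a) g"
  shows "integrable (powr_measure a) (\<lambda>t. g (c * t))"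
proof -
  have "integrable lborel (\<lambda>t. indicator {0<..} t * t powr (- a - 1) * g t)"
    using g by (simp add: integrable_powr_measure_iff)
  from lborel_integrable_real_affine[OF this, of c 0]
  have "integrable lborel (\<lambda>t. c powr (- a - 1) * (indicator {0<..} t * t powr (- a - 1) * g (c * t)))"
    using c powr_measure_weight_scale[OF c, of _ a] by (simp add: mult.assoc)
  then show ?thesis using c by (subst integrable_powr_measure_iff) auto
qed

lemma integral_powr_measure_scale:
  fixes g :: "real \<Rightarrow> real"
  assumes c: "c > 0" and [measurable]: "g \<in> borel_measurable borel"
  shows "(\<integral>t. g (c * t) \<partial>powr_measure a) = c powr a * (\<integral>t. g t \<partial>powr_measure a)"
proof -
  have "(\<integral>t. g t \<partial>powr_measure a) = (\<integral>t. indicator {0<..} t * t powr (- a - 1) * g t \<partial>lborel)"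
    by (rule integral_powr_measure_eq) simp
  also have "\<dots> = c * (\<integral>t. indicator {0<..} (c * t) * (c * t) powr (- a - 1) * g (c * t) \<partial>lborel)"
    using lborel_integral_real_affine[of c "\<lambda>t. indicator {0<..} t * t powr (- a - 1) * g t" 0] c by simp
  also have "\<dots> = c * (\<integral>t. c powr (- a - 1) * (indicator {0<..} t * t powr (- a - 1) * g (c * t)) \<partial>lborel)"
    by (simp add: powr_measure_weight_scale[OF c] mult.assoc)
  also have "\<dots> = c * c powr (- a - 1) * (\<integral>t. g (c * t) \<partial>powr_measure a)"
    by (simp add: integral_powr_measure_eq)
  finally have "c powr a * (\<integral>t. g t \<partial>powr_measure a) = (c powr a * (c * c powr (- a - 1))) * (\<integral>t. g (c * t) \<partial>powr_measure a)"
    by simp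
  also have "c powr a * (c * c powr (- a - 1)) = c powr (a + 1 + (- a - 1))"
    unfolding powr_add using c by simp
  also have "\<dots> = 1" using c by simp
  finally show ?thesis by simp
qed

lemma integral_powr_measure_mono:
  fixes g h :: "real \<Rightarrow> real"
  assumes "integrable (powr_measure a) g" "integrable (powr_measure a) h" "\<And>t. t > 0 \<Longrightarrow> g t \<le> h t"
  shows "integral\<^sup>L (powr_measure a) g \<le> integral\<^sup>L (powr_measure a) h"
  by (rule integral_mono_AE[OF assms(1,2)], rule eventually_mono[OF AE_powr_measure]) (rule assms(3))

lemma integral_powr_measure_cong:
  fixes g h :: "real \<Rightarrow> real"
  assumes "\<And>t. t > 0 \<Longrightarrow> g t = h t" and [measurable]: "g \<in> borel_measurable borel" "h \<in> borel_measurable borel"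
  shows "integral\<^sup>L (powr_measure a) g = integral\<^sup>L (powr_measure a) h"
  by (rule integral_cong_AE) (use AE_powr_measure[of a] assms(1) in \<open>auto elim!: eventually_mono\<close>)

text \<open>A zero integral would make \<open>g\<close> vanish almost everywhere, although
  \<open>g\<close> is positive between 1 and 2. Strict positivity is demanded only beyond 1 so that
  functions cut off at 1 qualify.\<close>

lemma integral_powr_measure_pos:
  fixes g :: "real \<Rightarrow> real"
  assumes g: "integrable (powr_measure a) g" and [measurable]: "g \<in> borel_measurable borel"
    and nn: "\<And>t. t > 0 \<Longrightarrow> g t \<ge> 0" and pos: "\<And>t. t > 1 \<Longrightarrow> g t > 0"
  shows "integral\<^sup>L (powr_measure a) g > 0"
proof -
  have ae: "AE t in powr_measure a. 0 \<le> g t"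
    using AE_powr_measure[of a] nn by (auto elim!: eventually_mono)
  have "integral\<^sup>L (powr_measure a) g \<noteq> 0"
  proof
    assume "integral\<^sup>L (powr_measure a) g = 0"
    then have "AE t in powr_measure a. g t = 0"
      using integral_nonneg_eq_0_iff_AE[OF g ae] by simp
    then have "AE t in lborel. t > 0 \<longrightarrow> g t = 0"
      unfolding powr_measure_def by (subst (asm) AE_density) (auto simp: indicator_def elim!: eventually_mono split: if_splits)
    then have "AE t in lborel. t \<notin> {1<..<2::real}"
      using pos by (auto elim!: eventually_mono) (smt (verit) pos)
    then have "emeasure lborel {1<..<2::real} = 0"
      by (subst (asm) AE_iff_measurable[of "{1<..<2}"]) auto
    then show False by simp
  qed
  moreover have "integral\<^sup>L (powr_measure a) g \<ge> 0" by (rule integral_nonneg_AE[OF ae])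
  ultimately show ?thesis by linarith
qed

text \<open>Near 0 the bound \<open>ln (1 + t) \<le> t\<close> leaves \<open>t powr (- a)\<close>,
  integrable for \<open>a < 1\<close>; at infinity the logarithm is dominated by a multiple of
  \<open>t powr (a/2)\<close>, leaving an exponent below -1 because \<open>a > 0\<close>.\<close>

lemma integrable_ln_powr_measure:
  assumes a: "0 < a" "a < 1"
  shows "integrable (powr_measure a) (\<lambda>t. ln (1 + t))"
proof -
  \<comment> \<open>Transfers the Henstock-Kurzweil facts on powers to Lebesgue integrability:
    nonnegativity gives absolute integrability, and Borel measurability passes from the completed
    measure to \<open>lborel\<close>.\<close>
  have pint: "integrable lborel (\<lambda>t. indicator S t * t powr e)"
    if "(\<lambda>t. t powr e) integrable_on S" "S \<in> sets borel" for S and e :: real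
  proof -
    have "(\<lambda>t. t powr e) absolutely_integrable_on S"
      by (rule nonnegative_absolutely_integrable_1[OF that(1)]) simp
    then have "integrable lebesgue (\<lambda>t. indicator S t * t powr e)"
      by (simp add: set_integrable_def)
    moreover have "(\<lambda>t. indicator S t * t powr e) \<in> borel_measurable lborel"
      using that(2) by measurable
    ultimately show ?thesis by (simp add: integrable_completion)
  qed
  \<comment> \<open>From \<open>ln y \<le> y powr (a/2) / (a/2)\<close> at \<open>y = 1 + t\<close>,
    together with \<open>1 + t \<le> 2 * t\<close> for \<open>t \<ge> 1\<close>.\<close>
  define K where "K = 2 powr (a/2) / (a/2)"
  have i1: "integrable lborel (\<lambda>t. indicator {0..1} t * t powr (- a))"
    by (rule pint) (use has_integral_powr_from_0[of "-a" 1] a in \<open>auto simp: integrable_on_def\<close>)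
  have i2: "integrable lborel (\<lambda>t. indicator {1..} t * t powr (- 1 - a/2))"
    by (rule pint) (use has_integral_powr_to_inf[of "-1 - a/2" 1] a in \<open>auto simp: integrable_on_def\<close>)
  have "integrable lborel (\<lambda>t. indicator {0<..} t * t powr (- a - 1) * ln (1 + t))"
  proof (rule Bochner_Integration.integrable_bound)
    show "integrable lborel (\<lambda>t. indicator {0..1} t * t powr (- a) + K * (indicator {1..} t * t powr (- 1 - a/2)))"
      using i1 i2 by auto
    show "AE t in lborel. norm (indicator {0<..} t * t powr (- a - 1) * ln (1 + t))
      \<le> norm (indicator {0..1} t * t powr (- a) + K * (indicator {1..} t * t powr (- 1 - a/2)))"
    proof (rule AE_I2)
      fix t :: real
      have K: "K > 0" using a by (simp add: K_def)
      consider "t \<le> 0" | "0 < t" "t < 1" | "t \<ge> 1" by linarith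
      then show "norm (indicator {0<..} t * t powr (- a - 1) * ln (1 + t))
        \<le> norm (indicator {0..1} t * t powr (- a) + K * (indicator {1..} t * t powr (- 1 - a/2)))"
      proof cases
        case 1 then show ?thesis by (auto simp: indicator_def)
      next
        case 2
        have "t powr (- a - 1) * ln (1 + t) \<le> t powr (- a - 1) * t"
          using 2 by (intro mult_left_mono ln_add_one_self_le_self) auto
        also have "\<dots> = t powr (- a - 1) * t powr 1" using 2 by simp
        also have "\<dots> = t powr (- a)" unfolding powr_add[symmetric] by simp
        finally show ?thesis using 2 by (auto simp: indicator_def)
      next
        case 3
        have "ln (1 + t) \<le> (1 + t) powr (a/2) / (a/2)"
          using 3 a by (intro ln_powr_bound) auto
        also have "\<dots> \<le> (2 * t) powr (a/2) / (a/2)"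
          using 3 a by (intro divide_right_mono powr_mono2) auto
        also have "\<dots> = K * t powr (a/2)" using 3 by (simp add: K_def powr_mult)
        finally have "t powr (- a - 1) * ln (1 + t) \<le> t powr (- a - 1) * (K * t powr (a/2))"
          by (intro mult_left_mono) auto
        also have "\<dots> = K * t powr (- a - 1 + a/2)" unfolding powr_add by simp
        also have "- a - 1 + a/2 = - 1 - a/2" by simp
        finally have "t powr (- a - 1) * ln (1 + t) \<le> K * t powr (- 1 - a/2)" .
        moreover have "norm (indicator {0<..} t * t powr (- a - 1) * ln (1 + t)) = t powr (- a - 1) * ln (1 + t)"
          using 3 by simp
        moreover have "norm (indicator {0..1} t * t powr (- a) + K * (indicator {1..} t * t powr (- 1 - a/2)))
           \<ge> K * t powr (- 1 - a/2)"
          using 3 K by (auto simp: indicator_def)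
        ultimately show ?thesis by linarith
      qed
    qed
  qed measurable
  then show ?thesis by (subst integrable_powr_measure_iff) auto
qed

lemma integrable_powr_measure_bound:
  fixes g :: "real \<Rightarrow> real"
  assumes a: "0 < a" "a < 1" and c: "c > 0" and [measurable]: "g \<in> borel_measurable borel"
    and g: "\<And>t. t > 0 \<Longrightarrow> 0 \<le> g t \<and> g t \<le> K * ln (1 + c * t)"
  shows "integrable (powr_measure a) g"
proof (rule Bochner_Integration.integrable_bound)
  show "integrable (powr_measure a) (\<lambda>t. K * ln (1 + c * t))"
    using integrable_powr_measure_scale[OF c _ integrable_ln_powr_measure[OF a]] by auto
  show "AE t in powr_measure a. norm (g t) \<le> norm (K * ln (1 + c * t))"
    using AE_powr_measure[of a] g by (auto elim!: eventually_mono) (smt (verit) g)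
qed simp

text \<open>Reciprocal of the constant in the logarithmic representation of powers: with
  \<open>a = p/2\<close> and \<open>x \<ge> 0\<close>, integrating
  \<open>ln (1 + t * x\<^sup>2)\<close> yields \<open>x powr p * ln_const a\<close>.\<close>

definition ln_const :: "real \<Rightarrow> real" where
  "ln_const a = (\<integral>t. ln (1 + t) \<partial>powr_measure a)"

lemma ln_const_pos:
  assumes "0 < a" "a < 1"
  shows "ln_const a > 0"
  unfolding ln_const_def
  by (rule integral_powr_measure_pos[OF integrable_ln_powr_measure[OF assms]]) auto

lemma integral_ln_scale:
  assumes a: "0 < a" "a < 1" and c: "c \<ge> 0"
  shows "integrable (powr_measure a) (\<lambda>t. ln (1 + c * t))"
    "(\<integral>t. ln (1 + c * t) \<partial>powr_measure a) = c powr a * ln_const a"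
proof -
  show "integrable (powr_measure a) (\<lambda>t. ln (1 + c * t))"
    using c integrable_powr_measure_scale[OF _ _ integrable_ln_powr_measure[OF a], of c] by (cases "c = 0") auto
  show "(\<integral>t. ln (1 + c * t) \<partial>powr_measure a) = c powr a * ln_const a"
    using c integral_powr_measure_scale[of c "\<lambda>t. ln (1 + t)" a] by (cases "c = 0") (auto simp: ln_const_def)
qed

text \<open>Dominated by \<open>2 * ln (1 + t)\<close>, from
  \<open>y / (1 + y) \<le> ln (1 + y)\<close> at \<open>y = min t 1\<close>. This truncation
  measures the loss caused by \<open>kap\<close> in the growth estimate for
  \<open>g\<close>.\<close>

lemma integrable_min_powr_measure:
  assumes a: "0 < a" "a < 1"
  shows "integrable (powr_measure a) (\<lambda>t. min t 1)"
proof (rule integrable_powr_measure_bound[OF a, of 1 _ 2])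
  fix t :: real assume t: "t > 0"
  have "min t 1 \<le> 2 * ln (1 + 1 * t)"
  proof -
    have "min t 1 / 2 \<le> min t 1 / (1 + min t 1)" using t by (intro divide_left_mono) (auto simp: min_def)
    also have "\<dots> \<le> ln (1 + min t 1)" 
    proof -
      have "ln (1 / (1 + min t 1)) \<le> 1 / (1 + min t 1) - 1" using t by (intro ln_le_minus_one) (auto simp: min_def)
      then show ?thesis using t by (simp add: ln_div field_simps split: if_splits)
    qed
    also have "\<dots> \<le> ln (1 + t)" using t by (subst ln_le_cancel_iff) (auto simp: min_def)
    finally show ?thesis by simp
  qed
  then show "0 \<le> min t 1 \<and> min t 1 \<le> 2 * ln (1 + 1 * t)" using t by auto
qed auto

lemma integral_min_scale:
  assumes a: "0 < a" "a < 1" and c: "c > 0"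
  shows "integrable (powr_measure a) (\<lambda>t. min t c)"
    "(\<integral>t. min t c \<partial>powr_measure a) = c powr (1 - a) * (\<integral>t. min t 1 \<partial>powr_measure a)"
proof -
  have eq: "(\<lambda>t. min t c) = (\<lambda>t. c * min (inverse c * t) 1)"
    using c by (auto simp: fun_eq_iff min_def field_simps)
  have i: "integrable (powr_measure a) (\<lambda>t. min (inverse c * t) 1)"
    using c by (intro integrable_powr_measure_scale integrable_min_powr_measure a) auto
  then show "integrable (powr_measure a) (\<lambda>t. min t c)" unfolding eq by simp
  have "(\<integral>t. min t c \<partial>powr_measure a) = c * (inverse c powr a * (\<integral>t. min t 1 \<partial>powr_measure a))"
    unfolding eq using integral_powr_measure_scale[of "inverse c" "\<lambda>t. min t 1" a] c by simp
  also have "c * (inverse c powr a * (\<integral>t. min t 1 \<partial>powr_measure a)) = (c powr 1 * c powr (- a)) * (\<integral>t. min t 1 \<partial>powr_measure a)"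
    using c by (simp add: powr_minus inverse_powr)
  also have "c powr 1 * c powr (- a) = c powr (1 - a)" unfolding powr_add[symmetric] by simp
  finally show "(\<integral>t. min t c \<partial>powr_measure a) = c powr (1 - a) * (\<integral>t. min t 1 \<partial>powr_measure a)" .
qed

section \<open>Averages over the fourth roots of unity\<close>

text \<open>Comparing coefficients gives \<open>\<i> ^ l * coeff Q l = coeff Q l\<close>, so the
  coefficients of degrees 1, 2 and 3 vanish.\<close>

lemma imag_invariant_poly:
  fixes Q :: "complex poly"
  assumes "\<And>z. poly Q (\<i> * z) = poly Q z"
  obtains T where "\<And>z. poly Q z = poly Q 0 + z ^ 4 * poly T z"
proof -
  have "Q \<circ>\<^sub>p [:0, \<i>:] = Q"
  proof -
    have "poly (Q \<circ>\<^sub>p [:0, \<i>:]) = poly Q"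
      using assms by (auto simp: fun_eq_iff poly_pcompose mult.commute)
    then show ?thesis by (simp only: poly_eq_poly_eq_iff)
  qed
  then have c: "\<i> ^ l * coeff Q l = coeff Q l" for l
    by (metis coeff_pcompose_linear)
  have "coeff (Q - [:coeff Q 0:]) l = 0" if "l < 4" for l
  proof -
    have "l = 0 \<or> l = 1 \<or> l = 2 \<or> l = 3" using that by auto
    moreover have "coeff Q 1 = 0" using c[of 1] by (auto simp: complex_eq_iff)
    moreover have "coeff Q 2 = 0" using c[of 2] by (auto simp: complex_eq_iff)
    moreover have "coeff Q 3 = 0" using c[of 3] by (auto simp: power3_eq_cube complex_eq_iff)
    ultimately show ?thesis
      by (auto simp: coeff_pCons numeral_2_eq_2 numeral_3_eq_3)
  qed
  then have "monom 1 4 dvd Q - [:coeff Q 0:]" unfolding monom_1_dvd_iff' by blast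
  then obtain T where T: "Q - [:coeff Q 0:] = monom 1 4 * T" by (auto elim: dvdE)
  show thesis
  proof (rule that[of T])
    fix z
    have "poly (Q - [:coeff Q 0:]) z = z ^ 4 * poly T z" unfolding T by (simp add: poly_monom)
    then show "poly Q z = poly Q 0 + z ^ 4 * poly T z" by (simp add: poly_0_coeff_0 algebra_simps)
  qed
qed

lemma poly_unit_disc_bound:
  fixes T :: "complex poly"
  obtains K where "K \<ge> 0" "\<And>z. cmod z \<le> 1 \<Longrightarrow> cmod (poly T z) \<le> K"
proof (rule that[of "\<Sum>i\<le>degree T. cmod (coeff T i)"])
  fix z :: complex assume z: "cmod z \<le> 1"
  have "cmod (poly T z) \<le> (\<Sum>i\<le>degree T. cmod (coeff T i * z ^ i))"
    unfolding poly_altdef by (rule norm_sum)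
  also have "\<dots> \<le> (\<Sum>i\<le>degree T. cmod (coeff T i))"
    using z by (intro sum_mono) (auto simp: norm_mult norm_power intro!: mult_left_le power_le_one)
  finally show "cmod (poly T z) \<le> (\<Sum>i\<le>degree T. cmod (coeff T i))" .
qed (simp add: sum_nonneg)

lemma poly_lipschitz_at_0:
  fixes W :: "complex poly"
  obtains K where "K \<ge> 0" "\<And>z. cmod z \<le> 1 \<Longrightarrow> cmod (poly W z - poly W 0) \<le> K * cmod z"
proof -
  obtain w V where W: "W = pCons w V" by (cases W)
  obtain K where K: "K \<ge> 0" "\<And>z. cmod z \<le> 1 \<Longrightarrow> cmod (poly V z) \<le> K"
    by (rule poly_unit_disc_bound, rule that)
  show thesis
  proof (rule that[OF K(1)])
    fix z :: complex assume "cmod z \<le> 1"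
    then show "cmod (poly W z - poly W 0) \<le> K * cmod z"
      using K(2)[of z] by (simp add: W norm_mult mult.commute[of K] mult_left_mono)
  qed
qed

text \<open>A four-point substitute for the mean over a circle. It leaves radial functions alone and
  cancels the contributions of \<open>z\<close>, \<open>z ^ 2\<close> and \<open>z ^ 3\<close>,
  which is all the accuracy required.\<close>

definition avg4 :: "(complex \<Rightarrow> real) \<Rightarrow> complex \<Rightarrow> real" where
  "avg4 h z = (h z + h (\<i> * z) + h (- z) + h (- (\<i> * z))) / 4"

lemma avg4_mono: "(\<And>w. cmod w = cmod z \<Longrightarrow> g w \<le> h w) \<Longrightarrow> avg4 g z \<le> avg4 h z"
  unfolding avg4_def by (intro divide_right_mono add_mono) (auto simp: norm_mult)

lemma avg4_const: "(\<And>w. cmod w = cmod z \<Longrightarrow> h w = c) \<Longrightarrow> avg4 h z = c"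
  unfolding avg4_def by (simp add: norm_mult)

lemma avg4_sum: "avg4 (\<lambda>w. \<Sum>f\<in>I. c f * h f w) z = (\<Sum>f\<in>I. c f * avg4 (h f) z)"
proof -
  have "avg4 (\<lambda>w. \<Sum>f\<in>I. c f * h f w) z
    = (\<Sum>f\<in>I. (c f * h f z + c f * h f (\<i> * z) + c f * h f (- z) + c f * h f (- (\<i> * z))) / 4)"
    unfolding avg4_def sum_divide_distrib[symmetric] sum.distrib ..
  also have "\<dots> = (\<Sum>f\<in>I. c f * avg4 (h f) z)"
    by (rule sum.cong) (simp_all add: avg4_def distrib_left)
  finally show ?thesis .
qed

lemma avg4_const_add: "avg4 (\<lambda>w. c + h w) z = c + avg4 h z"
  by (simp add: avg4_def add_divide_distrib)

text \<open>Approximate mean value property of the harmonic function \<open>ln |W|^2\<close>: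
  averaging logarithms amounts to the logarithm of the product \<open>S\<close> of the four rotated
  polynomials, which is invariant under multiplication of \<open>z\<close> by \<open>\<i>\<close>
  and so equals its value at 0 up to O(z^4).\<close>

lemma avg4_ln_poly_lower:
  fixes W :: "complex poly"
  assumes W0: "poly W 0 \<noteq> 0"
  obtains E r where "E \<ge> 0" "r > 0"
    "\<And>z. cmod z \<le> r \<Longrightarrow> poly W z \<noteq> 0"
    "\<And>z. cmod z \<le> r \<Longrightarrow> avg4 (\<lambda>z. ln ((cmod (poly W z))\<^sup>2 / (cmod (poly W 0))\<^sup>2)) z \<ge> - E * cmod z ^ 4"
proof -
  define w where "w = poly W 0"
  have w: "w \<noteq> 0" using W0 by (simp add: w_def)
  obtain L where L: "L \<ge> 0" "\<And>z. cmod z \<le> 1 \<Longrightarrow> cmod (poly W z - poly W 0) \<le> L * cmod z"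
    by (rule poly_lipschitz_at_0, rule that)
  define S where "S = W * (W \<circ>\<^sub>p [:0, \<i>:]) * (W \<circ>\<^sub>p [:0, -1:]) * (W \<circ>\<^sub>p [:0, -\<i>:])"
  have S: "poly S z = poly W z * poly W (\<i> * z) * poly W (- z) * poly W (- (\<i> * z))" for z
    by (simp add: S_def poly_pcompose mult.commute)
  have inv: "poly S (\<i> * z) = poly S z" for z
  proof -
    have "\<i> * (\<i> * z) = - z" by (simp add: mult.assoc[symmetric])
    then show ?thesis unfolding S by (simp only: minus_minus mult_ac)
  qed
  obtain T where T: "\<And>z. poly S z = poly S 0 + z ^ 4 * poly T z" by (rule imag_invariant_poly[OF inv], rule that)
  obtain K where K: "K \<ge> 0" "\<And>z. cmod z \<le> 1 \<Longrightarrow> cmod (poly T z) \<le> K"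
    by (rule poly_unit_disc_bound, rule that)
  define K' where "K' = K / cmod w ^ 4"
  have K': "K' \<ge> 0" using K by (simp add: K'_def)
  \<comment> \<open>The second bound keeps \<open>W\<close> away from its zeros, the third makes the
    relative error \<open>y\<close> at most 1/2.\<close>
  define r where "r = min 1 (min (cmod w / (2 * (L + 1))) (1 / (2 * (K' + 1))))"
  have r: "r > 0" using w L K' by (simp add: r_def)
  have r1: "r \<le> 1" "r \<le> cmod w / (2 * (L + 1))" "r \<le> 1 / (2 * (K' + 1))" by (simp_all add: r_def)
  have nz: "poly W z \<noteq> 0" if z: "cmod z \<le> r" for z
  proof
    assume "poly W z = 0"
    then have "cmod w \<le> L * cmod z" using L(2)[of z] z r1 by (simp add: w_def)
    also have "\<dots> \<le> L * (cmod w / (2 * (L + 1)))" using L z r1 by (intro mult_left_mono) auto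
    also have "\<dots> < cmod w"
    proof -
      have "0 < cmod w * (L + 2)" using w L by simp
      then show ?thesis using L by (simp add: field_simps)
    qed
    finally show False by simp
  qed
  show thesis
  proof (rule that[of K' r])
    fix z :: complex assume z: "cmod z \<le> r"
    have z1: "cmod z \<le> 1" using z r1 by simp
    define y where "y = K' * cmod z ^ 4"
    have "cmod z ^ 4 \<le> cmod z ^ 1" using z1 by (intro power_decreasing) auto
    then have "y \<le> K' * r" unfolding y_def using z K' by (intro mult_left_mono) auto
    also have "\<dots> \<le> K' * (1 / (2 * (K' + 1)))" using r1 K' by (intro mult_left_mono) auto
    also have "\<dots> \<le> 1/2" using K' by (simp add: field_simps)
    finally have y: "y \<le> 1/2" .
    have y0: "y \<ge> 0" using K' by (simp add: y_def)
    have S0: "poly S 0 = w ^ 4" by (simp add: S w_def power4_eq_xxxx)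
    have "cmod w ^ 4 - K * cmod z ^ 4 \<le> cmod (poly S z)"
    proof -
      have "cmod (w ^ 4) \<le> cmod (poly S z) + cmod (z ^ 4 * poly T z)"
        unfolding S0[symmetric] using T[of z] norm_triangle_ineq4[of "poly S z" "z ^ 4 * poly T z"] by simp
      also have "cmod (z ^ 4 * poly T z) \<le> cmod z ^ 4 * K"
        using K(2)[OF z1] by (simp add: norm_mult norm_power mult_left_mono)
      finally show ?thesis by (simp add: norm_power mult.commute)
    qed
    then have "(cmod w ^ 4 - K * cmod z ^ 4) / cmod w ^ 4 \<le> cmod (poly S z) / cmod w ^ 4"
      by (intro divide_right_mono) auto
    then have Sge: "1 - y \<le> cmod (poly S z) / cmod w ^ 4"
      using w by (simp add: y_def K'_def diff_divide_distrib)
    have n: "poly W z \<noteq> 0" "poly W (\<i> * z) \<noteq> 0" "poly W (- z) \<noteq> 0" "poly W (- (\<i> * z)) \<noteq> 0"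
      using z by (auto intro!: nz simp: norm_mult)
    have "avg4 (\<lambda>z. ln ((cmod (poly W z))\<^sup>2 / (cmod (poly W 0))\<^sup>2)) z = (1/2) * ln (cmod (poly S z) / cmod w ^ 4)"
      using n w unfolding avg4_def S w_def[symmetric]
      by (simp add: ln_div ln_mult ln_realpow norm_mult)
    also have "\<dots> \<ge> (1/2) * ln (1 - y)" using Sge y by (intro mult_left_mono) auto
    also have "ln (1 - y) \<ge> - y - 2 * y\<^sup>2" using y y0 by (rule ln_one_minus_pos_lower_bound[rotated])
    moreover have "2 * y\<^sup>2 \<le> y" using y y0 mult_right_mono[of "2 * y" 1 y] by (simp add: power2_eq_square)
    ultimately show "- K' * cmod z ^ 4 \<le> avg4 (\<lambda>z. ln ((cmod (poly W z))\<^sup>2 / (cmod (poly W 0))\<^sup>2)) z"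
      unfolding y_def by linarith
  qed (use K' r nz in auto)
qed

text \<open>In the expansion \<open>sq\<close> of \<open>|W|^2\<close> about \<open>w\<close>, the
  linear term averages to O(z^4) by invariance of the sum \<open>S\<close>, and the quadratic term
  is O(|z|^2) by the Lipschitz bound.\<close>

lemma avg4_poly_upper:
  fixes W :: "complex poly"
  assumes W0: "poly W 0 \<noteq> 0"
  obtains K where "K \<ge> 0"
    "\<And>z. cmod z \<le> 1 \<Longrightarrow> avg4 (\<lambda>z. (cmod (poly W z))\<^sup>2) z \<le> (cmod (poly W 0))\<^sup>2 * (1 + K * (cmod z)\<^sup>2)"
proof -
  define w where "w = poly W 0"
  have w: "w \<noteq> 0" using W0 by (simp add: w_def)
  obtain L where L: "L \<ge> 0" "\<And>z. cmod z \<le> 1 \<Longrightarrow> cmod (poly W z - poly W 0) \<le> L * cmod z"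
    by (rule poly_lipschitz_at_0, rule that)
  define S where "S = W + (W \<circ>\<^sub>p [:0, \<i>:]) + (W \<circ>\<^sub>p [:0, -1:]) + (W \<circ>\<^sub>p [:0, -\<i>:])"
  have S: "poly S z = poly W z + poly W (\<i> * z) + poly W (- z) + poly W (- (\<i> * z))" for z
    by (simp add: S_def poly_pcompose mult.commute)
  have inv: "poly S (\<i> * z) = poly S z" for z
  proof -
    have "\<i> * (\<i> * z) = - z" by (simp add: mult.assoc[symmetric])
    then show ?thesis unfolding S by (simp only: minus_minus add_ac)
  qed
  obtain T where T: "\<And>z. poly S z = poly S 0 + z ^ 4 * poly T z" by (rule imag_invariant_poly[OF inv], rule that)
  obtain K where K: "K \<ge> 0" "\<And>z. cmod z \<le> 1 \<Longrightarrow> cmod (poly T z) \<le> K"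
    by (rule poly_unit_disc_bound, rule that)
  define K' where "K' = (cmod w * K + L\<^sup>2) / (cmod w)\<^sup>2"
  have K': "K' \<ge> 0" using K by (simp add: K'_def)
  have sq: "(cmod x)\<^sup>2 = (cmod w)\<^sup>2 + 2 * Re (cnj w * (x - w)) + (cmod (x - w))\<^sup>2" for x
    by (simp only: cmod_power2) (simp add: power2_eq_square algebra_simps)
  show thesis
  proof (rule that[OF K'])
    fix z :: complex assume z: "cmod z \<le> 1"
    define P where "P = cnj w * (poly S z - 4 * w)"
    have "avg4 (\<lambda>z. (cmod (poly W z))\<^sup>2) z
       = (cmod w)\<^sup>2 + Re P / 2 + avg4 (\<lambda>z. (cmod (poly W z - w))\<^sup>2) z"
      unfolding avg4_def sq[of "poly W _"] S P_def by (simp add: algebra_simps add_divide_distrib diff_divide_distrib)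
    moreover have "Re P \<le> cmod w * (cmod z)\<^sup>2 * K"
    proof -
      have "poly S z - 4 * w = z ^ 4 * poly T z"
        using T[of z] S[of 0] by (simp add: w_def)
      then have "P = cnj w * (z ^ 4 * poly T z)" by (simp add: P_def)
      then have "cmod P = cmod w * cmod z ^ 4 * cmod (poly T z)" by (simp add: norm_mult norm_power)
      also have "\<dots> \<le> cmod w * cmod z ^ 2 * K"
        using K z by (intro mult_mono power_decreasing mult_left_mono) auto
      finally show ?thesis using complex_Re_le_cmod[of P] by simp
    qed
    moreover have "avg4 (\<lambda>z. (cmod (poly W z - w))\<^sup>2) z \<le> L\<^sup>2 * (cmod z)\<^sup>2"
    proof -
      have "avg4 (\<lambda>z. (cmod (poly W z - w))\<^sup>2) z \<le> avg4 (\<lambda>_. L\<^sup>2 * (cmod z)\<^sup>2) z"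
      proof (rule avg4_mono)
        fix v assume v: "cmod v = cmod z"
        have "(cmod (poly W v - w))\<^sup>2 \<le> (L * cmod v)\<^sup>2"
          using L(2)[of v] v z by (intro power_mono) (auto simp: w_def)
        then show "(cmod (poly W v - w))\<^sup>2 \<le> L\<^sup>2 * (cmod z)\<^sup>2" using v by (simp add: power_mult_distrib)
      qed
      then show ?thesis by (simp add: avg4_def)
    qed
    moreover have "(cmod w)\<^sup>2 * (1 + K' * (cmod z)\<^sup>2) = (cmod w)\<^sup>2 + cmod w * (cmod z)\<^sup>2 * K + L\<^sup>2 * (cmod z)\<^sup>2"
      using w by (simp add: K'_def field_simps)
    moreover have "0 \<le> cmod w * (cmod z)\<^sup>2 * K" using K by simp
    ultimately show "avg4 (\<lambda>z. (cmod (poly W z))\<^sup>2) z \<le> (cmod (poly W 0))\<^sup>2 * (1 + K' * (cmod z)\<^sup>2)"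
      unfolding w_def[symmetric] by linarith
  qed
qed

section \<open>Concavity estimates for the logarithm\<close>

lemma ln_one_plus_scale:
  fixes x k :: real
  assumes "0 \<le> k" "k \<le> 1" "0 \<le> x"
  shows "k * ln (1 + x) \<le> ln (1 + k * x)"
proof -
  \<comment> \<open>\<open>X\<close> is the convex combination of \<open>1 + x\<close> and 1 with
    weights \<open>k\<close> and \<open>1 - k\<close>; the tangent to \<open>ln\<close> at
    \<open>X\<close> lies above \<open>ln\<close> at both points.\<close>
  define X where "X = 1 + k * x"
  have X: "X > 0" using assms by (simp add: X_def add_pos_nonneg)
  have 1: "ln y \<le> ln X + y / X - 1" if "y > 0" for y
    using ln_le_minus_one[of "y / X"] X that by (simp add: ln_div)
  have "k * ln (1 + x) \<le> k * (ln X + (1 + x) / X - 1)"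
    using 1[of "1 + x"] assms by (intro mult_left_mono) auto
  moreover have "(1 - k) * ln 1 \<le> (1 - k) * (ln X + 1 / X - 1)"
    using 1[of 1] assms by (intro mult_left_mono) auto
  moreover have "k * (ln X + (1 + x) / X - 1) + (1 - k) * (ln X + 1 / X - 1) = ln X + (1 + k * x) / X - 1"
  proof -
    have "k * ((1 + x) / X) + (1 - k) * (1 / X) = (1 + k * x) / X"
      by (simp add: add_divide_distrib[symmetric] algebra_simps)
    then show ?thesis by (simp add: algebra_simps)
  qed
  ultimately show ?thesis using X by (simp add: X_def)
qed

lemma ln_one_plus_scale_ge:
  fixes x k :: real
  assumes "1 \<le> k" "0 \<le> x"
  shows "ln (1 + k * x) \<le> k * ln (1 + x)"
  using ln_one_plus_scale[of "1 / k" "k * x"] assms by (simp add: field_simps)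

text \<open>Jensen's inequality for \<open>ln\<close> with the probability weights
  \<open>1 / Y\<close> at the point 1 and \<open>y f / Y\<close> at the points
  \<open>\<rho> f\<close>.\<close>

lemma ln_one_plus_sum_weighted:
  fixes y \<rho> :: "'a \<Rightarrow> real"
  assumes "finite I" and y: "\<And>f. f \<in> I \<Longrightarrow> y f \<ge> 0" and \<rho>: "\<And>f. f \<in> I \<Longrightarrow> \<rho> f > 0"
  shows "ln (1 + (\<Sum>f\<in>I. y f)) + (\<Sum>f\<in>I. y f / (1 + (\<Sum>f\<in>I. y f)) * ln (\<rho> f)) \<le> ln (1 + (\<Sum>f\<in>I. y f * \<rho> f))"
proof -
  define Y where "Y = 1 + (\<Sum>f\<in>I. y f)"
  define X where "X = (1 + (\<Sum>f\<in>I. y f * \<rho> f)) / Y"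
  have Y: "Y > 0" using y by (simp add: Y_def sum_nonneg add_pos_nonneg)
  have S: "1 + (\<Sum>f\<in>I. y f * \<rho> f) > 0"
    using y \<rho> by (intro add_pos_nonneg sum_nonneg mult_nonneg_nonneg) (auto simp: less_imp_le)
  have X: "X > 0" using Y S by (simp add: X_def)
  have 1: "ln v \<le> ln X + v / X - 1" if "v > 0" for v
    using ln_le_minus_one[of "v / X"] X that by (simp add: ln_div)
  have "(\<Sum>f\<in>I. y f / Y * ln (\<rho> f)) \<le> (\<Sum>f\<in>I. y f / Y * (ln X + \<rho> f / X - 1))"
    using y \<rho> Y 1 by (intro sum_mono mult_left_mono) auto
  moreover have "0 \<le> 1 / Y * (ln X + 1 / X - 1)" using 1[of 1] Y by simp
  ultimately have "(\<Sum>f\<in>I. y f / Y * ln (\<rho> f)) \<le> 1 / Y * (ln X + 1 / X - 1) + (\<Sum>f\<in>I. y f / Y * (ln X + \<rho> f / X - 1))"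
    by simp
  also have "\<dots> = (1 + (\<Sum>f\<in>I. y f)) / Y * (ln X - 1) + (1 + (\<Sum>f\<in>I. y f * \<rho> f)) / Y / X"
    by (simp add: sum_distrib_right sum_distrib_left sum_divide_distrib sum.distrib sum_subtractf algebra_simps add_divide_distrib diff_divide_distrib)
  also have "\<dots> = ln X" using Y X unfolding Y_def[symmetric] X_def[symmetric] by simp
  also have "\<dots> = ln (1 + (\<Sum>f\<in>I. y f * \<rho> f)) - ln Y" unfolding X_def using Y S by (simp add: ln_div)
  finally show ?thesis unfolding Y_def by linarith
qed

text \<open>Concavity again, that is, the inequality between the geometric and arithmetic means of
  four positive numbers.\<close>

lemma avg4_ln_le:
  assumes "\<And>w. cmod w = cmod z \<Longrightarrow> h w > 0"
  shows "avg4 (\<lambda>w. ln (h w)) z \<le> ln (avg4 h z)"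
proof -
  define m where "m = avg4 h z"
  have p: "h z > 0" "h (\<i> * z) > 0" "h (- z) > 0" "h (- (\<i> * z)) > 0"
    using assms by (auto simp: norm_mult)
  then have m: "m > 0" by (simp add: m_def avg4_def)
  have 1: "ln v \<le> ln m + v / m - 1" if "v > 0" for v
    using ln_le_minus_one[of "v / m"] m that by (simp add: ln_div)
  have "ln (h z) + ln (h (\<i> * z)) + ln (h (- z)) + ln (h (- (\<i> * z)))
    \<le> 4 * ln m + (h z + h (\<i> * z) + h (- z) + h (- (\<i> * z))) / m - 4"
    using 1[OF p(1)] 1[OF p(2)] 1[OF p(3)] 1[OF p(4)] by (simp add: add_divide_distrib)
  also have "(h z + h (\<i> * z) + h (- z) + h (- (\<i> * z))) = 4 * m" by (simp add: m_def avg4_def)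
  finally show ?thesis using m unfolding avg4_def[of "\<lambda>w. ln (h w)"] m_def[symmetric] by simp
qed
lemma ln_one_plus_sum_le:
  fixes y :: "'a \<Rightarrow> real"
  assumes "finite I" "\<And>f. f \<in> I \<Longrightarrow> y f \<ge> 0"
  shows "ln (1 + (\<Sum>f\<in>I. y f)) \<le> (\<Sum>f\<in>I. ln (1 + y f))"
  using assms
proof (induction I rule: finite_induct)
  case (insert f I)
  have s: "(\<Sum>f\<in>I. y f) \<ge> 0" "y f \<ge> 0" using insert.prems by (auto intro!: sum_nonneg)
  have "1 + (\<Sum>f\<in>insert f I. y f) \<le> (1 + y f) * (1 + (\<Sum>f\<in>I. y f))"
    using insert.hyps s by (simp add: algebra_simps)
  then have "ln (1 + (\<Sum>f\<in>insert f I. y f)) \<le> ln ((1 + y f) * (1 + (\<Sum>f\<in>I. y f)))"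
    using s insert.hyps by (subst ln_le_cancel_iff) (auto intro!: add_pos_nonneg mult_pos_pos)
  also have "\<dots> = ln (1 + y f) + ln (1 + (\<Sum>f\<in>I. y f))"
    using s by (intro ln_mult_pos) auto
  also have "\<dots> \<le> ln (1 + y f) + (\<Sum>f\<in>I. ln (1 + y f))"
    using insert.IH insert.prems by auto
  also have "\<dots> = (\<Sum>f\<in>insert f I. ln (1 + y f))" using insert.hyps by simp
  finally show ?case .
qed simp

text \<open>From \<open>1 + x ^ j \<le> (1 + x) ^ j\<close>; passing from \<open>c\<close> to
  \<open>1 + c \<ge> 1\<close> lets the coefficient be absorbed as
  \<open>c \<le> (1 + c) ^ j\<close>.\<close>

lemma ln_one_plus_power_le:
  fixes c t :: real
  assumes "c \<ge> 0" "t \<ge> 0" "j \<ge> 1"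
  shows "ln (1 + c * t ^ j) \<le> j * ln (1 + (1 + c) * t)"
proof -
  have p: "1 + x ^ j \<le> (1 + x) ^ j" if "x \<ge> 0" for x :: real
    using \<open>j \<ge> 1\<close>
  proof (induction j rule: dec_induct)
    case (step n)
    have "1 + x ^ Suc n \<le> (1 + x) * (1 + x ^ n)" using that by (simp add: algebra_simps)
    also have "\<dots> \<le> (1 + x) * (1 + x) ^ n" using step.IH that by (intro mult_left_mono) auto
    finally show ?case by simp
  qed simp
  have "c \<le> (1 + c) ^ 1" by simp
  also have "\<dots> \<le> (1 + c) ^ j" using assms by (intro power_increasing) auto
  finally have "c * t ^ j \<le> ((1 + c) * t) ^ j" using assms by (simp add: power_mult_distrib mult_right_mono)
  then have "1 + c * t ^ j \<le> (1 + (1 + c) * t) ^ j" using p[of "(1 + c) * t"] assms by simp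
  then have "ln (1 + c * t ^ j) \<le> ln ((1 + (1 + c) * t) ^ j)"
    using assms by (intro ln_mono) (auto intro!: add_pos_nonneg)
  also have "\<dots> = j * ln (1 + (1 + c) * t)" using assms by (intro ln_realpow)
  finally show ?thesis .
qed

lemma ln_one_plus_poly_bound:
  fixes c :: "'a \<Rightarrow> real" and j :: "'a \<Rightarrow> nat"
  assumes "finite I" and c: "\<And>f. f \<in> I \<Longrightarrow> c f \<ge> 0" and j: "\<And>f. f \<in> I \<Longrightarrow> j f \<ge> 1" and t: "t \<ge> 0"
  shows "ln (1 + (\<Sum>f\<in>I. c f * t ^ j f)) \<le> (\<Sum>f\<in>I. real (j f)) * ln (1 + (1 + (\<Sum>f\<in>I. c f)) * t)"
proof -
  have "ln (1 + (\<Sum>f\<in>I. c f * t ^ j f)) \<le> (\<Sum>f\<in>I. ln (1 + c f * t ^ j f))"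
    using assms by (intro ln_one_plus_sum_le) auto
  also have "\<dots> \<le> (\<Sum>f\<in>I. j f * ln (1 + (1 + (\<Sum>f\<in>I. c f)) * t))"
  proof (rule sum_mono)
    fix f assume f: "f \<in> I"
    have "c f \<le> (\<Sum>f\<in>I. c f)" using assms f by (intro member_le_sum) auto
    have "ln (1 + c f * t ^ j f) \<le> j f * ln (1 + (1 + c f) * t)"
      using c[OF f] j[OF f] t by (intro ln_one_plus_power_le)
    also have "\<dots> \<le> j f * ln (1 + (1 + (\<Sum>f\<in>I. c f)) * t)"
      using c[OF f] t \<open>c f \<le> _\<close> by (intro mult_left_mono ln_mono add_mono mult_right_mono) (auto intro!: add_pos_nonneg)
    finally show "ln (1 + c f * t ^ j f) \<le> j f * ln (1 + (1 + (\<Sum>f\<in>I. c f)) * t)" .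
  qed
  finally show ?thesis by (simp add: sum_distrib_right)
qed

lemma integrable_ln_poly:
  fixes c :: "'a \<Rightarrow> real" and j :: "'a \<Rightarrow> nat"
  assumes a: "0 < a" "a < 1" and I: "finite I"
    and c: "\<And>f. f \<in> I \<Longrightarrow> c f \<ge> 0" and j: "\<And>f. f \<in> I \<Longrightarrow> j f \<ge> 1"
  shows "integrable (powr_measure a) (\<lambda>t. ln (1 + (\<Sum>f\<in>I. c f * t ^ j f)))"
proof (rule integrable_powr_measure_bound[OF a])
  have "(\<Sum>f\<in>I. c f) \<ge> 0" using c by (rule sum_nonneg)
  then show "0 < 1 + (\<Sum>f\<in>I. c f)" by simp
  fix t :: real assume t: "t > 0"
  have "(\<Sum>f\<in>I. c f * t ^ j f) \<ge> 0" using c t by (intro sum_nonneg) auto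
  then show "0 \<le> ln (1 + (\<Sum>f\<in>I. c f * t ^ j f)) \<and>
    ln (1 + (\<Sum>f\<in>I. c f * t ^ j f)) \<le> (\<Sum>f\<in>I. real (j f)) * ln (1 + (1 + (\<Sum>f\<in>I. c f)) * t)"
    using ln_one_plus_poly_bound[OF I c j, where t = t] t by auto
qed measurable

text \<open>\<open>Phi t z\<close> models \<open>det (1 + t M(z)* M(z))\<close>; the summand \<open>f\<close> comes from the polynomial \<open>z^(e f) * W f z\<close>.
  \<open>Low\<close> keeps the leading term of each of these polynomials.\<close>

locale poly_family =
  fixes I :: "'i set" and j e :: "'i \<Rightarrow> nat" and W :: "'i \<Rightarrow> complex poly"
  assumes fin: "finite I" and j: "f \<in> I \<Longrightarrow> j f \<ge> 1" and W0: "f \<in> I \<Longrightarrow> poly (W f) 0 \<noteq> 0"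
begin

definition b :: "'i \<Rightarrow> real" where "b f = (cmod (poly (W f) 0))\<^sup>2"

definition Phi :: "real \<Rightarrow> complex \<Rightarrow> real" where
  "Phi t z = 1 + (\<Sum>f\<in>I. cmod z ^ (2 * e f) * (cmod (poly (W f) z))\<^sup>2 * t ^ j f)"

definition Low :: "real \<Rightarrow> real \<Rightarrow> real" where
  "Low t r = 1 + (\<Sum>f\<in>I. b f * r ^ (2 * e f) * t ^ j f)"

lemma b_pos: "f \<in> I \<Longrightarrow> b f > 0"
  using W0 by (simp add: b_def)

lemma Phi_ge_1: "t > 0 \<Longrightarrow> Phi t z \<ge> 1"
  unfolding Phi_def by (simp add: sum_nonneg)

lemma Low_ge_1: "t > 0 \<Longrightarrow> Low t r \<ge> 1"
  unfolding Low_def using b_pos by (auto intro!: sum_nonneg mult_nonneg_nonneg simp: less_imp_le power_mult)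

lemma integrable_Phi: "0 < a \<Longrightarrow> a < 1 \<Longrightarrow> integrable (powr_measure a) (\<lambda>t. ln (Phi t z))"
  unfolding Phi_def by (rule integrable_ln_poly) (use fin j in auto)

lemma integrable_Low: "0 < a \<Longrightarrow> a < 1 \<Longrightarrow> integrable (powr_measure a) (\<lambda>t. ln (Low t r))"
  unfolding Low_def by (rule integrable_ln_poly) (use fin j b_pos in \<open>auto simp: less_imp_le power_mult\<close>)

text \<open>Jensen with the terms of \<open>Low\<close> as weights reduces the claim to the ratios
  \<open>\<rho> f\<close>, whose averaged logarithms are at least \<open>- E' r^4\<close>. The
  weights add up to \<open>(Y - 1) / Y \<le> ln Y\<close>, which makes the error relative to
  \<open>ln (Low t r)\<close> and uniform in \<open>t\<close>.\<close>

lemma avg4_Phi_lower: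
  obtains E r where "E \<ge> 0" "r > 0"
    "\<And>z t. cmod z \<le> r \<Longrightarrow> t > 0 \<Longrightarrow> (1 - E * cmod z ^ 4) * ln (Low t (cmod z)) \<le> avg4 (\<lambda>z. ln (Phi t z)) z"
proof -
  define Q where "Q f E r \<longleftrightarrow> E \<ge> 0 \<and> r > (0::real) \<and> (\<forall>z. cmod z \<le> r \<longrightarrow> poly (W f) z \<noteq> 0 \<and>
     avg4 (\<lambda>z. ln ((cmod (poly (W f) z))\<^sup>2 / (cmod (poly (W f) 0))\<^sup>2)) z \<ge> - E * cmod z ^ 4)" for f E r
  have "\<forall>f\<in>I. \<exists>E r. Q f E r"
  proof
    fix f assume "f \<in> I"
    show "\<exists>E r. Q f E r"
      by (rule avg4_ln_poly_lower[OF W0[OF \<open>f \<in> I\<close>]]) (auto simp: Q_def)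
  qed
  then obtain E R where "\<forall>f\<in>I. Q f (E f) (R f)" by metis
  then have ER: "\<And>f. f \<in> I \<Longrightarrow> E f \<ge> 0 \<and> R f > (0::real) \<and> (\<forall>z. cmod z \<le> R f \<longrightarrow> poly (W f) z \<noteq> 0 \<and>
     avg4 (\<lambda>z. ln ((cmod (poly (W f) z))\<^sup>2 / (cmod (poly (W f) 0))\<^sup>2)) z \<ge> - E f * cmod z ^ 4)"
    by (simp add: Q_def)
  define r where "r = Min (insert 1 (R ` I))"
  define E' where "E' = (\<Sum>f\<in>I. E f)"
  have r: "r > 0" using fin ER by (simp add: r_def)
  have rR: "r \<le> R f" if "f \<in> I" for f using fin that by (simp add: r_def)
  have E': "E' \<ge> 0" "\<And>f. f \<in> I \<Longrightarrow> E f \<le> E'"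
    using ER fin by (auto simp: E'_def intro!: sum_nonneg member_le_sum)
  show thesis
  proof (rule that[OF E'(1) r])
    fix z :: complex and t :: real assume z: "cmod z \<le> r" and t: "t > 0"
    define y where "y f = b f * cmod z ^ (2 * e f) * t ^ j f" for f
    define \<rho> where "\<rho> f z = (cmod (poly (W f) z))\<^sup>2 / (cmod (poly (W f) 0))\<^sup>2" for f z
    have y: "y f \<ge> 0" if "f \<in> I" for f using b_pos[OF that] t by (simp add: y_def)
    define Y where "Y = 1 + (\<Sum>f\<in>I. y f)"
    have YL: "Y = Low t (cmod z)" by (simp add: Y_def y_def Low_def)
    have Y: "Y \<ge> 1" using Low_ge_1[OF t] by (simp add: YL)
    have "avg4 (\<lambda>w. ln Y + (\<Sum>f\<in>I. y f / Y * ln (\<rho> f w))) z \<le> avg4 (\<lambda>w. ln (Phi t w)) z"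
    proof (rule avg4_mono)
      fix w assume w: "cmod w = cmod z"
      have "\<rho> f w > 0" if "f \<in> I" for f
        using ER[OF that] W0[OF that] rR[OF that] z w by (auto simp: \<rho>_def)
      from ln_one_plus_sum_weighted[OF fin y this]
      have "ln Y + (\<Sum>f\<in>I. y f / Y * ln (\<rho> f w)) \<le> ln (1 + (\<Sum>f\<in>I. y f * \<rho> f w))" by (simp add: Y_def)
      also have "1 + (\<Sum>f\<in>I. y f * \<rho> f w) = Phi t w"
        unfolding Phi_def using W0 w by (intro arg_cong[of _ _ "(+) 1"] sum.cong) (auto simp: y_def \<rho>_def b_def)
      finally show "ln Y + (\<Sum>f\<in>I. y f / Y * ln (\<rho> f w)) \<le> ln (Phi t w)" .
    qed
    also have "avg4 (\<lambda>w. ln Y + (\<Sum>f\<in>I. y f / Y * ln (\<rho> f w))) z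
      = ln Y + (\<Sum>f\<in>I. y f / Y * avg4 (\<lambda>w. ln (\<rho> f w)) z)"
      by (simp only: avg4_const_add avg4_sum)
    finally have 1: "ln Y + (\<Sum>f\<in>I. y f / Y * avg4 (\<lambda>w. ln (\<rho> f w)) z) \<le> avg4 (\<lambda>w. ln (Phi t w)) z" .
    have "(\<Sum>f\<in>I. y f / Y * (- E' * cmod z ^ 4)) \<le> (\<Sum>f\<in>I. y f / Y * avg4 (\<lambda>w. ln (\<rho> f w)) z)"
    proof (intro sum_mono mult_left_mono)
      fix f assume f: "f \<in> I"
      have "- E' * cmod z ^ 4 \<le> - E f * cmod z ^ 4" using E'(2)[OF f] by (intro mult_right_mono) auto
      also have "\<dots> \<le> avg4 (\<lambda>w. ln (\<rho> f w)) z" using ER[OF f] rR[OF f] z by (auto simp: \<rho>_def)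
      finally show "- E' * cmod z ^ 4 \<le> avg4 (\<lambda>w. ln (\<rho> f w)) z" .
      show "0 \<le> y f / Y" using y[OF f] Y by simp
    qed
    also have "(\<Sum>f\<in>I. y f / Y * (- E' * cmod z ^ 4)) = (\<Sum>f\<in>I. y f) / Y * (- E' * cmod z ^ 4)"
      unfolding sum_divide_distrib sum_distrib_right ..
    also have "(\<Sum>f\<in>I. y f) = Y - 1" by (simp add: Y_def)
    finally have 2: "(Y - 1) / Y * (- E' * cmod z ^ 4) \<le> (\<Sum>f\<in>I. y f / Y * avg4 (\<lambda>w. ln (\<rho> f w)) z)" .
    have "ln (1 / Y) \<le> 1 / Y - 1" using Y by (intro ln_le_minus_one) auto
    then have "(Y - 1) / Y \<le> ln Y" using Y by (simp add: ln_div diff_divide_distrib)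
    then have "(Y - 1) / Y * (E' * cmod z ^ 4) \<le> ln Y * (E' * cmod z ^ 4)" using E' by (intro mult_right_mono) auto
    then show "(1 - E' * cmod z ^ 4) * ln (Low t (cmod z)) \<le> avg4 (\<lambda>z. ln (Phi t z)) z"
      using 1 2 unfolding YL[symmetric] by (simp add: algebra_simps)
  qed
qed

text \<open>Jensen moves the average under the logarithm, where each term exceeds its leading part
  by at most the factor \<open>k\<close>; concavity takes \<open>k\<close> out of the
  logarithm.\<close>

lemma avg4_Phi_upper:
  obtains K where "K \<ge> 0"
    "\<And>z t. cmod z \<le> 1 \<Longrightarrow> t > 0 \<Longrightarrow> avg4 (\<lambda>z. ln (Phi t z)) z \<le> (1 + K * (cmod z)\<^sup>2) * ln (Low t (cmod z))"
proof -
  define Q where "Q f K \<longleftrightarrow> K \<ge> 0 \<and> (\<forall>z. cmod z \<le> 1 \<longrightarrow>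
      avg4 (\<lambda>z. (cmod (poly (W f) z))\<^sup>2) z \<le> (cmod (poly (W f) 0))\<^sup>2 * (1 + K * (cmod z)\<^sup>2))" for f K
  have "\<forall>f\<in>I. \<exists>K. Q f K"
  proof
    fix f assume "f \<in> I"
    show "\<exists>K. Q f K"
      by (rule avg4_poly_upper[OF W0[OF \<open>f \<in> I\<close>]]) (auto simp: Q_def)
  qed
  then obtain K where "\<forall>f\<in>I. Q f (K f)" by metis
  then have K: "\<And>f. f \<in> I \<Longrightarrow> K f \<ge> 0 \<and> (\<forall>z. cmod z \<le> 1 \<longrightarrow>
      avg4 (\<lambda>z. (cmod (poly (W f) z))\<^sup>2) z \<le> (cmod (poly (W f) 0))\<^sup>2 * (1 + K f * (cmod z)\<^sup>2))"
    by (simp add: Q_def)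
  define K' where "K' = (\<Sum>f\<in>I. K f)"
  have K': "K' \<ge> 0" "\<And>f. f \<in> I \<Longrightarrow> K f \<le> K'"
    using K fin by (auto simp: K'_def intro!: sum_nonneg member_le_sum)
  show thesis
  proof (rule that[OF K'(1)])
    fix z :: complex and t :: real assume z: "cmod z \<le> 1" and t: "t > 0"
    define k where "k = 1 + K' * (cmod z)\<^sup>2"
    have k: "k \<ge> 1" using K' by (simp add: k_def)
    have "avg4 (\<lambda>z. ln (Phi t z)) z \<le> ln (avg4 (Phi t) z)"
    proof (rule avg4_ln_le)
      show "0 < Phi t w" for w using Phi_ge_1[OF t, of w] by linarith
    qed
    also have "avg4 (Phi t) z = avg4 (\<lambda>w. 1 + (\<Sum>f\<in>I. (cmod z ^ (2 * e f) * t ^ j f) * (cmod (poly (W f) w))\<^sup>2)) z"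
      unfolding Phi_def avg4_def by (simp add: norm_mult mult_ac)
    also have "\<dots> = 1 + (\<Sum>f\<in>I. (cmod z ^ (2 * e f) * t ^ j f) * avg4 (\<lambda>w. (cmod (poly (W f) w))\<^sup>2) z)"
      by (simp only: avg4_const_add avg4_sum)
    also have "ln \<dots> \<le> ln (1 + k * (\<Sum>f\<in>I. b f * cmod z ^ (2 * e f) * t ^ j f))"
    proof (intro ln_mono add_left_mono)
      have "avg4 (\<lambda>w. (cmod (poly (W f) w))\<^sup>2) z \<ge> 0" for f by (simp add: avg4_def)
      then show "0 < 1 + (\<Sum>f\<in>I. (cmod z ^ (2 * e f) * t ^ j f) * avg4 (\<lambda>w. (cmod (poly (W f) w))\<^sup>2) z)"
        using t by (intro add_pos_nonneg sum_nonneg mult_nonneg_nonneg) auto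
      show "(\<Sum>f\<in>I. (cmod z ^ (2 * e f) * t ^ j f) * avg4 (\<lambda>w. (cmod (poly (W f) w))\<^sup>2) z)
         \<le> k * (\<Sum>f\<in>I. b f * cmod z ^ (2 * e f) * t ^ j f)"
        unfolding sum_distrib_left
      proof (rule sum_mono)
        fix f assume f: "f \<in> I"
        have "avg4 (\<lambda>w. (cmod (poly (W f) w))\<^sup>2) z \<le> b f * (1 + K f * (cmod z)\<^sup>2)"
          using K[OF f] z by (simp add: b_def)
        also have "\<dots> \<le> b f * k" unfolding k_def using K'(2)[OF f] b_pos[OF f]
          by (intro mult_left_mono add_left_mono mult_right_mono) auto
        finally have "(cmod z ^ (2 * e f) * t ^ j f) * avg4 (\<lambda>w. (cmod (poly (W f) w))\<^sup>2) z
           \<le> (cmod z ^ (2 * e f) * t ^ j f) * (b f * k)" using t by (intro mult_left_mono) auto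
        then show "(cmod z ^ (2 * e f) * t ^ j f) * avg4 (\<lambda>w. (cmod (poly (W f) w))\<^sup>2) z
           \<le> k * (b f * cmod z ^ (2 * e f) * t ^ j f)" by (simp add: mult_ac)
      qed
    qed
    also have "\<dots> \<le> k * ln (1 + (\<Sum>f\<in>I. b f * cmod z ^ (2 * e f) * t ^ j f))"
      using k b_pos t by (intro ln_one_plus_scale_ge sum_nonneg) (auto simp: less_imp_le)
    finally show "avg4 (\<lambda>z. ln (Phi t z)) z \<le> (1 + K' * (cmod z)\<^sup>2) * ln (Low t (cmod z))"
      by (simp add: Low_def k_def)
  qed
qed

definition G :: "real \<Rightarrow> real \<Rightarrow> real" where
  "G a r = (\<integral>t. ln (Low t r) \<partial>powr_measure a)"

lemma integral_avg4_Phi: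
  assumes a: "0 < a" "a < 1"
    and rad: "\<And>z. (\<integral>t. ln (Phi t z) \<partial>powr_measure a) = F (cmod z)"
  shows "integrable (powr_measure a) (\<lambda>t. avg4 (\<lambda>z. ln (Phi t z)) z)"
    "(\<integral>t. avg4 (\<lambda>z. ln (Phi t z)) z \<partial>powr_measure a) = F (cmod z)"
  unfolding avg4_def using integrable_Phi[OF a] by (auto simp: rad norm_mult)

text \<open>The integral is radial by \<open>rad\<close>, hence unaffected by averaging over the
  four rotations. So the pointwise bounds for averages bound \<open>F\<close> itself by the integral
  \<open>G\<close> of the explicit function \<open>Low\<close>.\<close>

lemma radial_sandwich:
  assumes a: "0 < a" "a < 1"
    and rad: "\<And>z. (\<integral>t. ln (Phi t z) \<partial>powr_measure a) = F (cmod z)"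
  obtains E K \<delta> where "E \<ge> 0" "K \<ge> 0" "0 < \<delta>" "\<delta> \<le> 1"
    "\<And>r. 0 \<le> r \<Longrightarrow> r \<le> \<delta> \<Longrightarrow> (1 - E * r ^ 4) * G a r \<le> F r"
    "\<And>r. 0 \<le> r \<Longrightarrow> r \<le> \<delta> \<Longrightarrow> F r \<le> (1 + K * r\<^sup>2) * G a r"
proof -
  obtain E d where E: "E \<ge> 0" "d > 0"
    "\<And>z t. cmod z \<le> d \<Longrightarrow> t > 0 \<Longrightarrow> (1 - E * cmod z ^ 4) * ln (Low t (cmod z)) \<le> avg4 (\<lambda>z. ln (Phi t z)) z"
    by (rule avg4_Phi_lower, rule that)
  obtain K where K: "K \<ge> 0"
    "\<And>z t. cmod z \<le> 1 \<Longrightarrow> t > 0 \<Longrightarrow> avg4 (\<lambda>z. ln (Phi t z)) z \<le> (1 + K * (cmod z)\<^sup>2) * ln (Low t (cmod z))"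
    by (rule avg4_Phi_upper, rule that)
  show thesis
  proof (rule that[OF E(1) K(1), of "min 1 d"])
    fix r :: real assume r: "0 \<le> r" "r \<le> min 1 d"
    then have cr: "cmod (of_real r) = r" by simp
    have i: "integrable (powr_measure a) (\<lambda>t. c * ln (Low t r))" for c
      using integrable_Low[OF a] by simp
    have "(1 - E * r ^ 4) * G a r = (\<integral>t. (1 - E * r ^ 4) * ln (Low t r) \<partial>powr_measure a)"
      by (simp add: G_def)
    also have "\<dots> \<le> (\<integral>t. avg4 (\<lambda>z. ln (Phi t z)) (of_real r) \<partial>powr_measure a)"
      using E(3)[of "of_real r"] r by (intro integral_powr_measure_mono i integral_avg4_Phi(1)[OF a rad]) auto
    also have "\<dots> = F r" using integral_avg4_Phi(2)[OF a rad] cr by simp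
    finally show "(1 - E * r ^ 4) * G a r \<le> F r" .
    have "F r = (\<integral>t. avg4 (\<lambda>z. ln (Phi t z)) (of_real r) \<partial>powr_measure a)"
      using integral_avg4_Phi(2)[OF a rad, of "of_real r"] cr by simp
    also have "\<dots> \<le> (\<integral>t. (1 + K * r\<^sup>2) * ln (Low t r) \<partial>powr_measure a)"
      using K(2)[of "of_real r"] r by (intro integral_powr_measure_mono i integral_avg4_Phi(1)[OF a rad]) auto
    also have "\<dots> = (1 + K * r\<^sup>2) * G a r" by (simp add: G_def)
    finally show "F r \<le> (1 + K * r\<^sup>2) * G a r" .
  qed (use E in auto)
qed

end

section \<open>The contribution of the minors exceeding the rank\<close>

text \<open>Weierstrass product inequality, by induction; it yields the bound
  \<open>1 - O(1/t)\<close> for \<open>kap\<close>.\<close>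

lemma one_minus_sum_le_prod:
  fixes x :: "'a \<Rightarrow> real"
  assumes "finite A" "\<And>k. k \<in> A \<Longrightarrow> 0 \<le> x k \<and> x k \<le> 1"
  shows "1 - (\<Sum>k\<in>A. x k) \<le> (\<Prod>k\<in>A. 1 - x k)"
  using assms
proof (induction A rule: finite_induct)
  case (insert k A)
  have le: "(\<Prod>k\<in>A. 1 - x k) \<le> 1" using insert.prems by (intro prod_le_1) auto
  then have "x k * (\<Prod>k\<in>A. 1 - x k) \<le> x k" using insert.prems by (intro mult_left_le) auto
  then show ?case using insert.IH insert.prems insert.hyps by (simp add: algebra_simps)
qed simp

text \<open>\<open>D\<close> indexes the nonzero singular values of \<open>A\<close>, \<open>d\<close> their squares, and \<open>I\<close> the terms of order \<open>card D + i f\<close> in \<open>t\<close>.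
  Dividing these by \<open>\<Prod>k\<in>D. 1 + t * d k\<close> gives \<open>kap t * v t r\<close>.\<close>

locale weighted_family =
  fixes a :: real and D :: "'k set" and d :: "'k \<Rightarrow> real"
    and I :: "'i set" and i e :: "'i \<Rightarrow> nat" and \<beta> :: "'i \<Rightarrow> real"
  assumes a: "0 < a" "a < 1" and finD: "finite D" and d: "k \<in> D \<Longrightarrow> d k > 0"
    and fin: "finite I" and i: "f \<in> I \<Longrightarrow> i f \<ge> 1" and \<beta>: "f \<in> I \<Longrightarrow> \<beta> f > 0"
begin

definition kap :: "real \<Rightarrow> real" where
  "kap t = (\<Prod>k\<in>D. t * d k / (1 + t * d k))"

definition v :: "real \<Rightarrow> real \<Rightarrow> real" where
  "v t r = (\<Sum>f\<in>I. \<beta> f * r ^ (2 * e f) * t ^ i f)"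

definition g :: "real \<Rightarrow> real" where
  "g r = (\<integral>t. ln (1 + kap t * v t r) \<partial>powr_measure a)"

lemma kap_nonneg: "t > 0 \<Longrightarrow> kap t \<ge> 0"
  unfolding kap_def using d by (intro prod_nonneg) (auto simp: less_imp_le)

lemma kap_le_1: "t > 0 \<Longrightarrow> kap t \<le> 1"
  unfolding kap_def
proof (rule prod_le_1)
  fix k assume "t > 0" "k \<in> D"
  then have "t * d k > 0" using d by simp
  then show "0 \<le> t * d k / (1 + t * d k) \<and> t * d k / (1 + t * d k) \<le> 1" by simp
qed

lemma kap_pos: "t > 0 \<Longrightarrow> kap t > 0"
  unfolding kap_def
proof (rule prod_pos)
  fix k assume "t > 0" "k \<in> D"
  then have "t * d k > 0" using d by simp
  then show "0 < t * d k / (1 + t * d k)" by simp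
qed

lemma kap_ge_1: "t \<ge> 1 \<Longrightarrow> kap 1 \<le> kap t"
  unfolding kap_def
proof (rule prod_mono)
  fix k assume t: "t \<ge> 1" and k: "k \<in> D"
  have dk: "d k > 0" using d[OF k] .
  moreover have "d k \<le> t * d k" using t dk by simp
  ultimately have "d k * (1 + t * d k) \<le> t * d k * (1 + d k)" "0 < 1 + d k" "0 < 1 + t * d k"
    using t by (auto simp: algebra_simps intro!: add_pos_pos add_pos_nonneg)
  then have "d k / (1 + d k) \<le> t * d k / (1 + t * d k)" by (simp add: frac_le_eq divide_nonpos_pos)
  then show "0 \<le> 1 * d k / (1 + 1 * d k) \<and> 1 * d k / (1 + 1 * d k) \<le> t * d k / (1 + t * d k)"
    using dk by simp
qed

text \<open>The summand 1 keeps \<open>c\<close> positive when \<open>D\<close> is empty, so that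
  \<open>c * s\<close> can serve as a truncation level in the growth estimate.\<close>

definition c :: real where "c = 1 + (\<Sum>k\<in>D. 1 / d k)"

lemma c_pos: "c > 0"
  unfolding c_def using d by (auto intro!: add_pos_nonneg sum_nonneg simp: less_imp_le)

lemma kap_lower: 
  assumes t: "t > 0" 
  shows "1 - c / t \<le> kap t"
proof -
  have "1 - (\<Sum>k\<in>D. 1 / (1 + t * d k)) \<le> (\<Prod>k\<in>D. 1 - 1 / (1 + t * d k))"
  proof (rule one_minus_sum_le_prod[OF finD])
    fix k assume "k \<in> D"
    then have "t * d k > 0" using d t by simp
    then show "0 \<le> 1 / (1 + t * d k) \<and> 1 / (1 + t * d k) \<le> 1" by simp
  qed
  also have "\<dots> = kap t"
    unfolding kap_def
  proof (rule prod.cong[OF refl])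
    fix k assume "k \<in> D"
    then have "1 + t * d k > 0" using d t by (simp add: add_pos_pos)
    then show "1 - 1 / (1 + t * d k) = t * d k / (1 + t * d k)" by (simp add: field_simps)
  qed
  finally have "1 - (\<Sum>k\<in>D. 1 / (1 + t * d k)) \<le> kap t" .
  moreover have "(\<Sum>k\<in>D. 1 / (1 + t * d k)) \<le> c / t"
  proof -
    have "(\<Sum>k\<in>D. 1 / (1 + t * d k)) \<le> (\<Sum>k\<in>D. (1 / d k) / t)"
    proof (rule sum_mono)
      fix k assume "k \<in> D"
      then have "t * d k > 0" using d t by simp
      then show "1 / (1 + t * d k) \<le> 1 / d k / t" by (simp add: frac_le mult.commute)
    qed
    also have "\<dots> \<le> c / t" unfolding sum_divide_distrib[symmetric] c_def using t by (intro divide_right_mono) auto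
    finally show ?thesis .
  qed
  ultimately show ?thesis by linarith
qed

lemma v_nonneg: "t > 0 \<Longrightarrow> v t r \<ge> 0"
  unfolding v_def using \<beta> by (intro sum_nonneg mult_nonneg_nonneg) (auto simp: less_imp_le power_mult)

lemma kv_bounds:
  assumes "t > 0"
  shows "0 \<le> ln (1 + kap t * v t r)" "ln (1 + kap t * v t r) \<le> ln (1 + v t r)"
proof -
  have "0 \<le> kap t * v t r" using kap_nonneg[OF assms] v_nonneg[OF assms] by simp
  moreover have "kap t * v t r \<le> 1 * v t r"
    using kap_le_1[OF assms] v_nonneg[OF assms] by (intro mult_right_mono)
  ultimately show "0 \<le> ln (1 + kap t * v t r)" "ln (1 + kap t * v t r) \<le> ln (1 + v t r)" by auto
qed

lemma measurable_kap [measurable]: "kap \<in> borel_measurable borel"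
  unfolding kap_def by measurable

lemma measurable_v [measurable]: "(\<lambda>t. v t r) \<in> borel_measurable borel"
  unfolding v_def by measurable

lemma integrable_v: "integrable (powr_measure a) (\<lambda>t. ln (1 + v t r))"
  unfolding v_def by (rule integrable_ln_poly[OF a fin]) (use i \<beta> in \<open>auto simp: less_imp_le power_mult\<close>)

lemma integrable_kv: "integrable (powr_measure a) (\<lambda>t. ln (1 + kap t * v t r))"
proof (rule Bochner_Integration.integrable_bound[OF integrable_v[of r]])
  show "AE t in powr_measure a. norm (ln (1 + kap t * v t r)) \<le> norm (ln (1 + v t r))"
    using AE_powr_measure[of a] 
  proof eventually_elim
    case (elim t)
    then show ?case using kv_bounds[OF elim, of r] by simp
  qed
qed measurable

lemma g_nonneg: "g r \<ge> 0"
  unfolding g_def using AE_powr_measure[of a]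
  by (intro integral_nonneg_AE) (auto elim!: eventually_mono intro: kv_bounds)

text \<open>The constant produced by \<open>ln_one_plus_poly_bound\<close> for the coefficients
  \<open>\<beta>\<close>, followed by \<open>ln (1 + x) \<le> x\<close>.\<close>

definition c1 :: real where "c1 = (\<Sum>f\<in>I. real (i f)) * (1 + (\<Sum>f\<in>I. \<beta> f))"

lemma c1_nonneg: "c1 \<ge> 0"
  unfolding c1_def using \<beta> by (intro mult_nonneg_nonneg sum_nonneg add_nonneg_nonneg) (auto simp: less_imp_le)

text \<open>The hypothesis on the orders gives
  \<open>r ^ (2 * e f) \<le> (r powr (2 * \<mu>)) ^ i f\<close> for \<open>r \<le> 1\<close>, so
  \<open>v\<close> is dominated by a polynomial without constant term in the single variable
  \<open>X * t\<close>.\<close>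

lemma ln_v_le:
  fixes \<mu> :: real
  assumes t: "t > 0" and r: "0 < r" "r \<le> 1" and \<mu>: "\<And>f. f \<in> I \<Longrightarrow> real (e f) \<ge> \<mu> * i f"
  shows "ln (1 + v t r) \<le> c1 * r powr (2 * \<mu>) * t"
proof -
  define X where "X = r powr (2 * \<mu>)"
  have X: "X > 0" using r by (simp add: X_def)
  have "v t r \<le> (\<Sum>f\<in>I. \<beta> f * (X * t) ^ i f)"
    unfolding v_def
  proof (rule sum_mono)
    fix f assume f: "f \<in> I"
    have "r ^ (2 * e f) = r powr real (2 * e f)" using r by (simp only: powr_realpow)
    also have "\<dots> \<le> r powr (2 * \<mu> * i f)" using r \<mu>[OF f] by (intro powr_mono') auto
    also have "\<dots> = X ^ i f" using r by (simp add: X_def powr_powr[symmetric] powr_realpow)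
    finally have "\<beta> f * r ^ (2 * e f) * t ^ i f \<le> \<beta> f * X ^ i f * t ^ i f"
      using \<beta>[OF f] t by (intro mult_right_mono mult_left_mono) auto
    then show "\<beta> f * r ^ (2 * e f) * t ^ i f \<le> \<beta> f * (X * t) ^ i f" by (simp add: power_mult_distrib mult.assoc)
  qed
  then have "ln (1 + v t r) \<le> ln (1 + (\<Sum>f\<in>I. \<beta> f * (X * t) ^ i f))"
    using v_nonneg[OF t, of r] by (intro ln_mono) auto
  also have "\<dots> \<le> (\<Sum>f\<in>I. real (i f)) * ln (1 + (1 + (\<Sum>f\<in>I. \<beta> f)) * (X * t))"
    using X t by (intro ln_one_plus_poly_bound fin i) (auto simp: \<beta> less_imp_le)
  also have "\<dots> \<le> (\<Sum>f\<in>I. real (i f)) * ((1 + (\<Sum>f\<in>I. \<beta> f)) * (X * t))"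
    using X t \<beta> by (intro mult_left_mono ln_add_one_self_le_self mult_nonneg_nonneg add_nonneg_nonneg sum_nonneg) (auto simp: less_imp_le)
  finally show ?thesis by (simp add: c1_def X_def mult_ac)
qed

text \<open>Under \<open>t \<mapsto> t / s\<close> with \<open>s = (\<rho> / r)^(2\<mu>)\<close> every monomial \<open>r^(2 * e f) * t^(i f)\<close> of \<open>v\<close> can only grow;
  the error term is due to \<open>kap\<close>, which is \<open>1 - O(1/t)\<close>.\<close>

lemma g_growth:
  fixes \<mu> :: real
  assumes \<mu>: "\<And>f. f \<in> I \<Longrightarrow> real (e f) \<ge> \<mu> * i f" and \<mu>0: "\<mu> > 0"
  obtains C where "C \<ge> 0"
    "\<And>r \<rho>. 0 < r \<Longrightarrow> r \<le> \<rho> \<Longrightarrow> \<rho> \<le> 1 \<Longrightarrow> g \<rho> \<ge> (\<rho> / r) powr (2 * \<mu> * a) * g r - C * \<rho> powr (2 * \<mu>)"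
proof -
  define M where "M = (\<integral>t. min t 1 \<partial>powr_measure a)"
  have M: "M \<ge> 0" unfolding M_def using AE_powr_measure[of a]
    by (intro integral_nonneg_AE) (auto elim!: eventually_mono)
  define C where "C = c1 * c powr (1 - a) * M"
  have "g \<rho> \<ge> (\<rho> / r) powr (2 * \<mu> * a) * g r - C * \<rho> powr (2 * \<mu>)"
    if r: "0 < r" "r \<le> \<rho>" "\<rho> \<le> 1" for r \<rho>
  proof -
    define l where "l = \<rho> / r"
    \<comment> \<open>The dilation factor for which \<open>s ^ i f \<le> l ^ (2 * e f)\<close> holds
      for all \<open>f\<close>; moving from \<open>r\<close> to \<open>\<rho>\<close> then pays for
      replacing \<open>t\<close> by \<open>t / s\<close>.\<close>
    define s where "s = l powr (2 * \<mu>)"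
    have l: "l \<ge> 1" using r by (simp add: l_def)
    have s: "s \<ge> 1" unfolding s_def using l \<mu>0 by (intro ge_one_powr_ge_zero) auto
    define h where "h t = ln (1 + kap t * v t \<rho>)" for t
    have [measurable]: "h \<in> borel_measurable borel" unfolding h_def by measurable
    have hint: "integrable (powr_measure a) (\<lambda>t. h (1 / s * t))"
      using s integrable_kv[of \<rho>] by (intro integrable_powr_measure_scale) (auto simp: h_def)
    have cs: "c * s > 0" using c_pos s by simp
    define X where "X = c1 * r powr (2 * \<mu>)"
    have X: "X \<ge> 0" using c1_nonneg by (simp add: X_def)
    have pw: "ln (1 + kap t * v t r) - X * min t (c * s) \<le> h (1 / s * t)" if t: "t > 0" for t
    proof -
      define t' where "t' = 1 / s * t"
      have t': "t' > 0" using t s by (simp add: t'_def)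
      have "v t r \<le> v t' \<rho>"
        unfolding v_def
      proof (rule sum_mono)
        fix f assume f: "f \<in> I"
        have "s ^ i f = l powr (2 * \<mu> * i f)"
          unfolding s_def using l by (subst powr_realpow[symmetric]) (auto simp: powr_powr)
        also have "\<dots> \<le> l powr (2 * e f)" using l \<mu>[OF f] by (intro powr_mono) auto
        also have "\<dots> = l ^ (2 * e f)" using l by (subst powr_realpow[symmetric]) auto
        finally have sl: "s ^ i f \<le> l ^ (2 * e f)" .
        have "r ^ (2 * e f) * t ^ i f = r ^ (2 * e f) * (s ^ i f * t' ^ i f)"
          using s by (simp add: t'_def power_divide)
        also have "\<dots> \<le> r ^ (2 * e f) * (l ^ (2 * e f) * t' ^ i f)"
          using sl t' r by (intro mult_left_mono mult_right_mono) auto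
        also have "\<dots> = \<rho> ^ (2 * e f) * t' ^ i f"
          using r by (simp add: l_def power_divide)
        finally show "\<beta> f * r ^ (2 * e f) * t ^ i f \<le> \<beta> f * \<rho> ^ (2 * e f) * t' ^ i f"
          using \<beta>[OF f] by (simp add: mult.assoc)
      qed
      then have "ln (1 + kap t' * v t r) \<le> h t'"
        unfolding h_def using kap_nonneg[OF t'] v_nonneg[OF t]
        by (intro ln_mono add_left_mono mult_left_mono) (auto intro!: add_pos_nonneg)
      moreover have "kap t' * ln (1 + v t r) \<le> ln (1 + kap t' * v t r)"
        using kap_nonneg[OF t'] kap_le_1[OF t'] v_nonneg[OF t] by (rule ln_one_plus_scale)
      \<comment> \<open>Two bounds for the loss: \<open>1 - kap t' \<le> 1\<close> with
        \<open>ln (1 + v t r) \<le> X * t\<close>, and \<open>1 - kap t' \<le> c * s / t\<close>,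
        which cancels the factor \<open>t\<close>.\<close>
      moreover have "ln (1 + v t r) - kap t' * ln (1 + v t r) \<le> X * min t (c * s)"
      proof -
        have L: "ln (1 + v t r) \<le> X * t" "0 \<le> ln (1 + v t r)"
          using ln_v_le[OF t r(1) _ \<mu>] r v_nonneg[OF t, of r] by (auto simp: X_def)
        have k: "0 \<le> kap t'" "1 - kap t' \<le> c * s / t"
          using kap_nonneg[OF t'] kap_lower[OF t'] s t by (auto simp: t'_def)
        have "(1 - kap t') * ln (1 + v t r) \<le> X * t"
          using L k by (intro order_trans[OF mult_right_mono[of "1 - kap t'" 1] ]) auto
        moreover have "(1 - kap t') * ln (1 + v t r) \<le> X * (c * s)"
        proof -
          have "(1 - kap t') * ln (1 + v t r) \<le> c * s / t * ln (1 + v t r)"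
            using L k by (intro mult_right_mono) auto
          also have "\<dots> \<le> c * s / t * (X * t)" using L cs t by (intro mult_left_mono) auto
          finally show ?thesis using t by (simp add: mult_ac)
        qed
        ultimately show ?thesis using X by (simp add: min_def algebra_simps)
      qed
      moreover have "ln (1 + kap t * v t r) \<le> ln (1 + v t r)" by (rule kv_bounds[OF t])
      ultimately show ?thesis unfolding t'_def[symmetric] by linarith
    qed
    have "g r - X * ((c * s) powr (1 - a) * M) = (\<integral>t. ln (1 + kap t * v t r) - X * min t (c * s) \<partial>powr_measure a)"
      using integral_min_scale[OF a cs] integrable_kv[of r] by (simp add: g_def M_def)
    also have "\<dots> \<le> (\<integral>t. h (1 / s * t) \<partial>powr_measure a)"
      using integral_min_scale(1)[OF a cs] integrable_kv[of r] pw by (intro integral_powr_measure_mono hint) auto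
    also have "\<dots> = (1 / s) powr a * g \<rho>"
      using s integral_powr_measure_scale[of "1/s" h a] by (simp add: g_def h_def)
    finally have "s powr a * (g r - X * ((c * s) powr (1 - a) * M)) \<le> s powr a * ((1 / s) powr a * g \<rho>)"
      by (intro mult_left_mono) auto
    also have "s powr a * ((1 / s) powr a * g \<rho>) = g \<rho>"
      using s by (simp add: powr_divide)
    also have "s powr a * (g r - X * ((c * s) powr (1 - a) * M))
      = s powr a * g r - c1 * c powr (1 - a) * M * (r powr (2 * \<mu>) * (s powr a * s powr (1 - a)))"
      using c_pos s by (simp add: X_def powr_mult algebra_simps)
    \<comment> \<open>The powers of \<open>s\<close> from the two scalings add up to one, so that
      \<open>r\<close> drops out of the error term.\<close>
    also have "s powr a * s powr (1 - a) = s" using s by (simp add: powr_add[symmetric])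
    also have "r powr (2 * \<mu>) * s = \<rho> powr (2 * \<mu>)"
      using r by (simp add: s_def l_def powr_divide)
    also have "s powr a = (\<rho> / r) powr (2 * \<mu> * a)" by (simp add: s_def l_def powr_powr)
    finally show ?thesis by (simp add: C_def)
  qed
  moreover have "C \<ge> 0" using c1_nonneg M by (simp add: C_def)
  ultimately show thesis by (intro that[of C])
qed

text \<open>A single term of \<open>v\<close> suffices: \<open>r ^ (2 * e f) * t ^ i f\<close> is
  the power \<open>i f\<close> of \<open>t / T\<close> with
  \<open>T = r powr (- 2 * e f / i f)\<close>, and for \<open>t \<ge> T \<ge> 1\<close> the factor
  \<open>kap t\<close> is at least \<open>kap 1\<close>. Dilation by \<open>T\<close> then produces
  the power of \<open>r\<close>.\<close>

lemma g_lower: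
  assumes f: "f \<in> I"
  obtains C where "C > 0" "\<And>r. 0 < r \<Longrightarrow> r \<le> 1 \<Longrightarrow> g r \<ge> C * r powr (2 * a * e f / i f)"
proof -
  define \<psi> where "\<psi> t = (if t \<ge> 1 then ln (1 + kap 1 * \<beta> f * t ^ i f) else 0)" for t
  have m [measurable]: "\<psi> \<in> borel_measurable borel" unfolding \<psi>_def by measurable
  have kb: "kap 1 * \<beta> f > 0" using kap_pos[of 1] \<beta>[OF f] by simp
  have "integrable (powr_measure a) (\<lambda>t. ln (1 + (\<Sum>x\<in>{f}. kap 1 * \<beta> f * t ^ i x)))"
    using kb i[OF f] by (intro integrable_ln_poly a) auto
  then have "integrable (powr_measure a) (\<lambda>t. ln (1 + kap 1 * \<beta> f * t ^ i f))" by simp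
  then have int: "integrable (powr_measure a) \<psi>"
  proof (rule Bochner_Integration.integrable_bound)
    show "AE t in powr_measure a. norm (\<psi> t) \<le> norm (ln (1 + kap 1 * \<beta> f * t ^ i f))"
      unfolding \<psi>_def by (rule AE_I2) auto
  qed measurable
  have pos: "integral\<^sup>L (powr_measure a) \<psi> > 0"
    by (rule integral_powr_measure_pos[OF int m]) (use kb in \<open>auto simp: \<psi>_def intro!: ln_gt_zero mult_pos_pos\<close>)
  show thesis
  proof (rule that[OF pos])
    fix r :: real assume r: "0 < r" "r \<le> 1"
    define q where "q = 2 * real (e f) / i f"
    define T where "T = r powr (- q)"
    have i0: "real (i f) > 0" using i[OF f] by simp
    have q: "q \<ge> 0" by (simp add: q_def)
    have T: "T \<ge> 1" unfolding T_def using r q powr_mono2'[of "-q" r 1] by simp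
    have Ti: "T ^ i f * r ^ (2 * e f) = 1"
    proof -
      have "T ^ i f = r powr (- q * i f)" unfolding T_def using r by (subst powr_realpow[symmetric]) (auto simp: powr_powr)
      also have "- q * i f = - real (2 * e f)" using i0 by (simp add: q_def)
      finally show ?thesis using r by (simp add: powr_minus powr_realpow del: of_nat_mult)
    qed
    have "(1 / T) powr a * integral\<^sup>L (powr_measure a) \<psi> = (\<integral>t. \<psi> (1 / T * t) \<partial>powr_measure a)"
      using T by (subst integral_powr_measure_scale) auto
    also have "\<dots> \<le> g r"
      unfolding g_def
    proof (rule integral_powr_measure_mono[OF _ integrable_kv])
      show "integrable (powr_measure a) (\<lambda>t. \<psi> (1 / T * t))"
        using T int by (intro integrable_powr_measure_scale) auto
      fix t :: real assume t: "t > 0"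
      show "\<psi> (1 / T * t) \<le> ln (1 + kap t * v t r)"
      proof (cases "t \<ge> T")
        case True
        then have t1: "t \<ge> 1" using T by simp
        have "kap 1 * \<beta> f * (1 / T * t) ^ i f = kap 1 * (\<beta> f * r ^ (2 * e f) * t ^ i f)"
        proof -
          have "(1 / T) ^ i f = r ^ (2 * e f)" using Ti T by (simp add: power_one_over field_simps)
          then show ?thesis unfolding power_mult_distrib by (simp only: mult_ac)
        qed
        also have "\<dots> \<le> kap t * v t r"
        proof (rule mult_mono)
          show "\<beta> f * r ^ (2 * e f) * t ^ i f \<le> v t r"
            unfolding v_def using fin f \<beta> t by (intro member_le_sum) (auto simp: less_imp_le power_mult)
        qed (use kap_ge_1[OF t1] kap_nonneg[OF t] \<beta>[OF f] t r in auto)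
        finally have le: "kap 1 * \<beta> f * (1 / T * t) ^ i f \<le> kap t * v t r" .
        have nn: "0 \<le> kap 1 * \<beta> f * (1 / T * t) ^ i f"
          using t T by (intro mult_nonneg_nonneg[OF less_imp_le[OF kb]]) auto
        have "1 \<le> 1 / T * t" using True T by (simp add: field_simps)
        then have "\<psi> (1 / T * t) = ln (1 + kap 1 * \<beta> f * (1 / T * t) ^ i f)"
          unfolding \<psi>_def by simp
        also have "\<dots> \<le> ln (1 + kap t * v t r)" using le nn by (intro ln_mono) auto
        finally show ?thesis .
      next
        case False
        then show ?thesis using T kv_bounds[OF t, of r] by (auto simp: \<psi>_def field_simps)
      qed
    qed
    also have "(1 / T) powr a = r powr (2 * a * e f / i f)"
      using r by (simp add: T_def powr_minus powr_powr q_def field_simps)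
    finally show "g r \<ge> integral\<^sup>L (powr_measure a) \<psi> * r powr (2 * a * e f / i f)" by (simp add: mult.commute)
  qed
qed

end

section \<open>Comparison of exponents at the origin\<close>

lemma tendsto_powr_at_right_0:
  fixes s :: real
  assumes "s > 0"
  shows "((\<lambda>r. r powr s) \<longlongrightarrow> 0) (at_right 0)"
  by (rule tendsto_zero_powrI[where b = s])
    (use assms in \<open>auto simp: eventually_at_right_less intro!: eventually_at_rightI[of 0 1]\<close>)

lemma filterlim_powr_at_right_0:
  fixes s :: real
  assumes "s > 0"
  shows "filterlim (\<lambda>r. r powr s) (at_right 0) (at_right 0)"
  unfolding filterlim_at using tendsto_powr_at_right_0[OF assms]
  by (auto intro!: eventually_at_rightI[of 0 1])

lemma powr_difference_quotient:
  fixes m q :: real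
  assumes "q > 0"
  shows "((\<lambda>r. ((1 + r powr q) powr m - 1) / r powr q) \<longlongrightarrow> m) (at_right 0)"
proof -
  have "((\<lambda>x. ((1 + x) powr m - 1) / x) \<longlongrightarrow> m) (at_right 0)"
    by real_asymp
  from filterlim_compose[OF this filterlim_powr_at_right_0[OF assms]] show ?thesis by simp
qed

text \<open>The substitution \<open>x = r powr q\<close> removes the exponent; what remains is the
  Taylor expansion of \<open>(1 + x) powr m\<close> at 0.\<close>

lemma powr_second_difference_quotient:
  fixes m q :: real
  assumes "q > 0"
  shows "((\<lambda>r. ((1 + r powr q) powr m - 1 - m * r powr q) / (r powr q)\<^sup>2) \<longlongrightarrow> m * (m - 1) / 2) (at_right 0)"
proof -
  have "((\<lambda>x. ((1 + x) powr m - 1 - m * x) / x\<^sup>2) \<longlongrightarrow> m * (m - 1) / 2) (at_right 0)"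
    by real_asymp
  from filterlim_compose[OF this filterlim_powr_at_right_0[OF assms]] show ?thesis by simp
qed

lemma tendsto_quotient_upper_exponent:
  fixes g :: "real \<Rightarrow> real"
  assumes lim: "((\<lambda>r. g r / r powr q) \<longlongrightarrow> L) (at_right 0)" and L: "L > 0"
    and M: "\<And>r. 0 < r \<Longrightarrow> r \<le> 1 \<Longrightarrow> g r \<le> M * r powr s"
  shows "s \<le> q"
proof (rule ccontr)
  assume "\<not> s \<le> q"
  then have "s - q > 0" by simp
  have "((\<lambda>r. M * r powr (s - q)) \<longlongrightarrow> M * 0) (at_right 0)"
    by (intro tendsto_mult tendsto_const tendsto_powr_at_right_0 \<open>s - q > 0\<close>)
  moreover have "eventually (\<lambda>r. g r / r powr q \<le> M * r powr (s - q)) (at_right 0)"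
  proof (rule eventually_at_rightI[of 0 1])
    fix r :: real assume r: "r \<in> {0<..<1}"
    have "g r / r powr q \<le> M * r powr s / r powr q" using M[of r] r by (intro divide_right_mono) auto
    then show "g r / r powr q \<le> M * r powr (s - q)" by (simp add: powr_diff)
  qed simp
  ultimately have "L \<le> M * 0" by (intro tendsto_le[OF _ _ lim]) auto
  then show False using L by simp
qed

lemma tendsto_quotient_lower_exponent:
  fixes g :: "real \<Rightarrow> real"
  assumes lim: "((\<lambda>r. g r / r powr q) \<longlongrightarrow> L) (at_right 0)"
    and c: "c > 0" "\<And>r. 0 < r \<Longrightarrow> r \<le> 1 \<Longrightarrow> g r \<ge> c * r powr s"
  shows "q \<le> s"
proof (rule ccontr)
  assume "\<not> q \<le> s"
  then have "q - s > 0" by simp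
  have "((\<lambda>r. g r / r powr q * r powr (q - s)) \<longlongrightarrow> L * 0) (at_right 0)"
    by (intro tendsto_mult lim tendsto_powr_at_right_0 \<open>q - s > 0\<close>)
  moreover have "eventually (\<lambda>r. c \<le> g r / r powr q * r powr (q - s)) (at_right 0)"
  proof (rule eventually_at_rightI[of 0 1])
    fix r :: real assume r: "r \<in> {0<..<1}"
    have "c * r powr s / r powr s \<le> g r / r powr s" using c(2)[of r] r by (intro divide_right_mono) auto
    then show "c \<le> g r / r powr q * r powr (q - s)" using r by (simp add: powr_diff)
  qed simp
  ultimately have "c \<le> L * 0" by (intro tendsto_le[OF _ _ tendsto_const]) auto
  then show False using c by simp
qed

text \<open>The sandwich yields a positive limit of \<open>g r / r powr q\<close>, so the growth
  estimates for \<open>g\<close> become inequalities between \<open>q\<close> and the ratios of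
  \<open>e f\<close> to \<open>i f\<close>. Hypothesis \<open>e2\<close> is the dichotomy supplied
  by the minors: once every order exceeds its excess, every order is at least twice the
  excess.\<close>

lemma (in weighted_family) sandwich_exponent:
  assumes p: "p = 2 * a" and q: "0 < q" "q < 2" and C0: "C0 > 0" and E: "E \<ge> 0" and K: "K \<ge> 0" and \<delta>: "0 < \<delta>" "\<delta> \<le> 1"
    and lo: "\<And>r. 0 < r \<Longrightarrow> r \<le> \<delta> \<Longrightarrow> (1 - E * r ^ 4) * (C0 + g r) \<le> C0 * (1 + r powr q) powr (p / q)"
    and up: "\<And>r. 0 < r \<Longrightarrow> r \<le> \<delta> \<Longrightarrow> C0 * (1 + r powr q) powr (p / q) \<le> (1 + K * r\<^sup>2) * (C0 + g r)"
    and e1: "\<And>f. f \<in> I \<Longrightarrow> e f \<ge> i f"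
    and e2: "(\<And>f. f \<in> I \<Longrightarrow> e f > i f) \<Longrightarrow> (\<And>f. f \<in> I \<Longrightarrow> e f \<ge> 2 * i f)"
  shows "q = p"
proof -
  define m where "m = p / q"
  have p0: "p > 0" "p < 2" using p a by auto
  have m: "m > 0" using p0 q by (simp add: m_def)
  define F where "F r = (1 + r powr q) powr m" for r
  define L where "L = C0 * m"
  have L: "L > 0" using C0 m by (simp add: L_def)
  have Flim: "((\<lambda>r. (F r - 1) / r powr q) \<longlongrightarrow> m) (at_right 0)"
    unfolding F_def by (rule powr_difference_quotient[OF q(1)])
  have small: "((\<lambda>r::real. r ^ k) \<longlongrightarrow> 0) (at_right 0)" if "k > 0" for k :: nat
  proof -
    have "((\<lambda>r::real. r ^ k) \<longlongrightarrow> 0 ^ k) (at_right 0)" by (intro tendsto_intros)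
    then show ?thesis using that by simp
  qed
  have smallq: "((\<lambda>r::real. r ^ k / r powr q) \<longlongrightarrow> 0) (at_right 0)" if "k \<ge> 2" for k :: nat
  proof -
    have "real k - q > 0" using q that by simp
    from tendsto_powr_at_right_0[OF this] show ?thesis
      by (rule Lim_transform_eventually)
        (auto intro!: eventually_at_rightI[of 0 1] simp: powr_diff powr_realpow)
  qed
  define d' where "d' = min \<delta> (1 / (2 * (E + 1)))"
  have d': "d' > 0" "d' \<le> \<delta>" "d' \<le> 1 / (2 * (E + 1))" using \<delta> E by (auto simp: d'_def)
  have Er: "E * r ^ 4 \<le> 1/2" if "0 < r" "r \<le> d'" for r
  proof -
    have "r ^ 4 \<le> r ^ 1" using that d' \<delta> by (intro power_decreasing) auto
    then have "E * r ^ 4 \<le> E * (1 / (2 * (E + 1)))" using that d' E by (intro mult_left_mono) auto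
    also have "\<dots> \<le> 1/2" using E by (simp add: field_simps)
    finally show ?thesis .
  qed
  \<comment> \<open>Only first order is at stake: the errors O(r^2) and O(r^4) both vanish after
    division by \<open>r powr q\<close> because \<open>q < 2\<close>.\<close>
  have glim: "((\<lambda>r. g r / r powr q) \<longlongrightarrow> L) (at_right 0)"
  proof (rule tendsto_sandwich)
    show "eventually (\<lambda>r. (C0 * ((F r - 1) / r powr q) - C0 * K * (r ^ 2 / r powr q)) / (1 + K * r ^ 2) \<le> g r / r powr q) (at_right 0)"
    proof (rule eventually_at_rightI[of 0 d'])
      fix r assume r: "r \<in> {0<..<d'}"
      have "C0 * F r \<le> (1 + K * r\<^sup>2) * (C0 + g r)" using up[of r] r d' by (simp add: F_def m_def)
      then have "(C0 * (F r - 1) - C0 * K * r ^ 2) / r powr q \<le> ((1 + K * r\<^sup>2) * g r) / r powr q"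
        by (intro divide_right_mono) (auto simp: algebra_simps)
      then have "C0 * ((F r - 1) / r powr q) - C0 * K * (r ^ 2 / r powr q) \<le> g r / r powr q * (1 + K * r ^ 2)"
        unfolding diff_divide_distrib[of "C0 * (F r - 1)"] by (simp add: mult_ac)
      then show "(C0 * ((F r - 1) / r powr q) - C0 * K * (r ^ 2 / r powr q)) / (1 + K * r ^ 2) \<le> g r / r powr q"
        using K by (subst pos_divide_le_eq) (auto intro!: add_pos_nonneg)
    qed (use d' in simp)
    show "eventually (\<lambda>r. g r / r powr q \<le> (C0 * ((F r - 1) / r powr q) + C0 * E * (r ^ 4 / r powr q)) / (1 - E * r ^ 4)) (at_right 0)"
    proof (rule eventually_at_rightI[of 0 d'])
      fix r assume r: "r \<in> {0<..<d'}"
      have "(1 - E * r ^ 4) * (C0 + g r) \<le> C0 * F r" using lo[of r] r d' by (simp add: F_def m_def)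
      then have "((1 - E * r ^ 4) * g r) / r powr q \<le> (C0 * (F r - 1) + C0 * E * r ^ 4) / r powr q"
        by (intro divide_right_mono) (auto simp: algebra_simps)
      then have "g r / r powr q * (1 - E * r ^ 4) \<le> C0 * ((F r - 1) / r powr q) + C0 * E * (r ^ 4 / r powr q)"
        unfolding add_divide_distrib[of "C0 * (F r - 1)"] by (simp add: mult_ac)
      moreover have "1 - E * r ^ 4 > 0" using Er[of r] r by simp
      ultimately show "g r / r powr q \<le> (C0 * ((F r - 1) / r powr q) + C0 * E * (r ^ 4 / r powr q)) / (1 - E * r ^ 4)"
        by (subst pos_le_divide_eq)
    qed (use d' in simp)
    have "((\<lambda>r. (C0 * ((F r - 1) / r powr q) - C0 * K * (r ^ 2 / r powr q)) / (1 + K * r ^ 2))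
        \<longlongrightarrow> (C0 * m - C0 * K * 0) / (1 + K * 0)) (at_right 0)"
      by (intro tendsto_intros Flim smallq small) auto
    then show "((\<lambda>r. (C0 * ((F r - 1) / r powr q) - C0 * K * (r ^ 2 / r powr q)) / (1 + K * r ^ 2)) \<longlongrightarrow> L) (at_right 0)"
      by (simp add: L_def)
    have "((\<lambda>r. (C0 * ((F r - 1) / r powr q) + C0 * E * (r ^ 4 / r powr q)) / (1 - E * r ^ 4))
        \<longlongrightarrow> (C0 * m + C0 * E * 0) / (1 - E * 0)) (at_right 0)"
      by (intro tendsto_intros Flim smallq small) auto
    then show "((\<lambda>r. (C0 * ((F r - 1) / r powr q) + C0 * E * (r ^ 4 / r powr q)) / (1 - E * r ^ 4)) \<longlongrightarrow> L) (at_right 0)"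
      by (simp add: L_def)
  qed
  \<comment> \<open>The growth estimate between \<open>r\<close> and \<open>\<rho> = 1\<close>
    bounds \<open>g r\<close> by a multiple of \<open>r powr (\<mu> * p)\<close>, which is
    compatible with the positive limit only if \<open>\<mu> * p \<le> q\<close>.\<close>
  have upper: "\<mu> * p \<le> q" if \<mu>: "\<mu> > 0" "\<And>f. f \<in> I \<Longrightarrow> real (e f) \<ge> \<mu> * i f" for \<mu> :: real
  proof -
    obtain C where C: "C \<ge> 0"
      "\<And>r \<rho>. 0 < r \<Longrightarrow> r \<le> \<rho> \<Longrightarrow> \<rho> \<le> 1 \<Longrightarrow> g \<rho> \<ge> (\<rho> / r) powr (2 * \<mu> * a) * g r - C * \<rho> powr (2 * \<mu>)"
      using g_growth[OF \<mu>(2,1)] by blast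
    show ?thesis
    proof (rule tendsto_quotient_upper_exponent[OF glim L])
      fix r :: real assume r: "0 < r" "r \<le> 1"
      have "r powr (\<mu> * p) * ((1 / r) powr (\<mu> * p) * g r) \<le> r powr (\<mu> * p) * (g 1 + C)"
        using C(2)[of r 1] r by (intro mult_left_mono) (auto simp: p mult_ac)
      moreover have "r powr (\<mu> * p) * ((1 / r) powr (\<mu> * p) * g r) = g r"
        using r by (simp add: powr_divide)
      ultimately show "g r \<le> (g 1 + C) * r powr (\<mu> * p)" by (simp add: mult.commute)
    qed
  qed
  have pq: "p \<le> q" using upper[of 1] e1 by simp
  have "\<not> p < q"
  proof
    assume lt: "p < q"
    \<comment> \<open>Conversely, each term bounds \<open>g\<close> from below by a multiple of
      \<open>r powr (p * e f / i f)\<close>; this exponent cannot be smaller than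
      \<open>q\<close>.\<close>
    have mu: "real (e f) \<ge> q / p * i f" if f: "f \<in> I" for f
    proof -
      obtain c where c: "c > 0" "\<And>r. 0 < r \<Longrightarrow> r \<le> 1 \<Longrightarrow> g r \<ge> c * r powr (2 * a * e f / i f)"
        using g_lower[OF f] by blast
      have "q \<le> 2 * a * e f / i f" by (rule tendsto_quotient_lower_exponent[OF glim c])
      then show ?thesis using i[OF f] p0 by (simp add: p field_simps)
    qed
    have "e f > i f" if f: "f \<in> I" for f
    proof -
      have "1 * real (i f) < q / p * i f" using lt p0 i[OF f] by (intro mult_strict_right_mono) auto
      then show ?thesis using mu[OF f] by simp
    qed
    then have "e f \<ge> 2 * i f" if "f \<in> I" for f using e2 that by blast
    then have "real (e f) \<ge> 2 * real (i f)" if "f \<in> I" for f using that by (metis of_nat_le_iff of_nat_mult of_nat_numeral)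
    then have "2 * p \<le> q" using upper[of 2] by simp
    then have p1: "p < 1" using q by simp
    obtain C where C: "C \<ge> 0"
      "\<And>r \<rho>. 0 < r \<Longrightarrow> r \<le> \<rho> \<Longrightarrow> \<rho> \<le> 1 \<Longrightarrow> g \<rho> \<ge> (\<rho> / r) powr (2 * (q / p) * a) * g r - C * \<rho> powr (2 * (q / p))"
      using g_growth[OF mu, OF _ divide_pos_pos[OF q(1) p0(1)]] by blast
    \<comment> \<open>The growth estimate with \<open>\<mu> = q / p\<close>, for which the factor is
      exactly \<open>(\<rho> / r) powr q\<close>; letting \<open>r\<close> tend to 0 replaces
      \<open>g r / r powr q\<close> by its limit.\<close>
    have gL: "g \<rho> \<ge> L * \<rho> powr q - C * \<rho> powr (2 * q / p)" if \<rho>: "0 < \<rho>" "\<rho> \<le> 1" for \<rho>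
    proof (rule tendsto_upperbound)
      show "((\<lambda>r. \<rho> powr q * (g r / r powr q) - C * \<rho> powr (2 * q / p)) \<longlongrightarrow> L * \<rho> powr q - C * \<rho> powr (2 * q / p)) (at_right 0)"
        using tendsto_diff[OF tendsto_mult[OF tendsto_const[of "\<rho> powr q"] glim] tendsto_const[of "C * \<rho> powr (2 * q / p)"]]
        by (simp add: mult.commute)
      show "eventually (\<lambda>r. \<rho> powr q * (g r / r powr q) - C * \<rho> powr (2 * q / p) \<le> g \<rho>) (at_right 0)"
      proof (rule eventually_at_rightI[of 0 \<rho>])
        fix r assume r: "r \<in> {0<..<\<rho>}"
        have "2 * (q / p) * a = q" using p0 p by simp
        then show "\<rho> powr q * (g r / r powr q) - C * \<rho> powr (2 * q / p) \<le> g \<rho>"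
          using C(2)[of r \<rho>] r \<rho> by (simp add: powr_divide)
      qed (use \<rho> in simp)
    qed simp
    define S where "S r = (F r - 1 - m * r powr q) / (r powr q)\<^sup>2" for r
    have Slim: "(S \<longlongrightarrow> m * (m - 1) / 2) (at_right 0)"
      unfolding S_def F_def by (rule powr_second_difference_quotient[OF q(1)])
    \<comment> \<open>After division by \<open>r powr (2 * q)\<close> only the second Taylor
      coefficient of \<open>F\<close> survives: \<open>p < 1\<close> makes the exponent of the
      growth error positive, and \<open>q < 2\<close> does so for the averaging error. The
      coefficient is negative because \<open>m = p / q < 1\<close>.\<close>
    have "((\<lambda>r. C0 * S r + C * r powr (2 * q / p - 2 * q) + E * (C0 + L) * r powr (4 - 2 * q)) \<longlongrightarrow> C0 * (m * (m - 1) / 2) + C * 0 + E * (C0 + L) * 0) (at_right 0)"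
    proof (intro tendsto_intros Slim tendsto_powr_at_right_0)
      have "2 * q * 1 < 2 * q * (1 / p)" using p1 p0 q by (intro mult_strict_left_mono) auto
      then show "0 < 2 * q / p - 2 * q" by simp
      show "0 < 4 - 2 * q" using q by simp
    qed
    moreover have "eventually (\<lambda>r. 0 \<le> C0 * S r + C * r powr (2 * q / p - 2 * q) + E * (C0 + L) * r powr (4 - 2 * q)) (at_right 0)"
    proof (rule eventually_at_rightI[of 0 d'])
      fix r assume r: "r \<in> {0<..<d'}"
      then have r1: "0 < r" "r \<le> 1" "r \<le> \<delta>" using d' \<delta> by auto
      define x where "x = r powr q"
      have x: "0 < x" "x \<le> 1" using r1 q by (auto simp: x_def intro: powr_le1)
      define Z where "Z = r powr (2 * q / p)"
      have Z: "Z \<ge> 0" by (simp add: Z_def)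
      have Er1: "0 \<le> E * r ^ 4" "E * r ^ 4 \<le> 1/2" using Er[of r] r E by auto
      have "(1 - E * r ^ 4) * (C0 + (L * x - C * Z)) \<le> (1 - E * r ^ 4) * (C0 + g r)"
        using gL[OF r1(1,2)] Er1 by (intro mult_left_mono) (auto simp: x_def Z_def)
      also have "\<dots> \<le> C0 * F r" using lo[OF r1(1,3)] by (simp add: F_def m_def)
      also have "C0 * F r = C0 * (S r * x\<^sup>2 + 1 + m * x)" using x by (simp add: S_def x_def)
      finally have "(1 - E * r ^ 4) * (C0 + (L * x - C * Z)) \<le> C0 * S r * x\<^sup>2 + C0 + L * x"
        by (simp add: L_def algebra_simps)
      moreover have "(1 - E * r ^ 4) * (C0 + (L * x - C * Z)) = C0 + L * x - E * r ^ 4 * (C0 + L * x) - (1 - E * r ^ 4) * (C * Z)"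
        by (simp add: algebra_simps)
      moreover have "E * r ^ 4 * (C0 + L * x) \<le> E * r ^ 4 * (C0 + L)"
        using Er1 L x by (intro mult_left_mono) auto
      moreover have "(1 - E * r ^ 4) * (C * Z) \<le> 1 * (C * Z)" using Er1 C(1) Z by (intro mult_right_mono) auto
      ultimately have "0 \<le> C0 * S r * x\<^sup>2 + C * Z + E * r ^ 4 * (C0 + L)" by linarith
      then have "0 \<le> (C0 * S r * x\<^sup>2 + C * Z + E * r ^ 4 * (C0 + L)) / x\<^sup>2" by simp
      also have "\<dots> = C0 * S r + C * (Z / x\<^sup>2) + E * (C0 + L) * (r ^ 4 / x\<^sup>2)"
        using x by (simp add: add_divide_distrib mult_ac)
      also have "x\<^sup>2 = r powr (2 * q)" using r1 by (simp add: x_def powr_power)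
      also have "Z / r powr (2 * q) = r powr (2 * q / p - 2 * q)" by (simp add: Z_def powr_diff)
      also have "r ^ 4 / r powr (2 * q) = r powr (4 - 2 * q)" using r1 by (simp add: powr_diff)
      finally show "0 \<le> C0 * S r + C * r powr (2 * q / p - 2 * q) + E * (C0 + L) * r powr (4 - 2 * q)" .
    qed (use d' in simp)
    ultimately have "0 \<le> C0 * (m * (m - 1) / 2) + C * 0 + E * (C0 + L) * 0"
      by (intro tendsto_lowerbound) auto
    moreover have "m * (m - 1) < 0" using m lt q by (intro mult_pos_neg) (auto simp: m_def)
    then have "C0 * (m * (m - 1) / 2) < 0" using C0 by (intro mult_pos_neg) auto
    ultimately show False by linarith
  qed
  then show ?thesis using pq by simp
qed

section \<open>Cauchy--Binet expansion of a matrix pencil\<close>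

text \<open>Summing over all functions instead of \<open>n\<close>-element sets of rows counts every minor \<open>fact n\<close> times.\<close>

lemma cauchy_binet_gram:
  fixes X :: "nat \<Rightarrow> nat \<Rightarrow> complex"
  shows "fact n * det (mat n n (\<lambda>(i,l). \<Sum>a<m. cnj (X a i) * X a l))
    = (\<Sum>f\<in>PiE {0..<n} (\<lambda>_. {..<m}). complex_of_real ((cmod (det (mat n n (\<lambda>(i,l). X (f i) l))))\<^sup>2))"
proof -
  let ?P = "{p. p permutes {0..<n}}" and ?Fs = "PiE {0..<n} (\<lambda>_. {..<m})"
  define Y where "Y f = mat n n (\<lambda>(i,l). X (f i) l)" for f :: "nat \<Rightarrow> nat"
  have Yc: "Y f \<in> carrier_mat n n" for f by (simp add: Y_def)
  have detY: "det (Y f) = (\<Sum>p\<in>?P. of_int (sign p) * (\<Prod>i=0..<n. X (f i) (p i)))" for f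
  proof -
    have "det (Y f) = (\<Sum>p\<in>?P. of_int (sign p) * (\<Prod>i=0..<n. Y f $$ (i, p i)))"
      by (simp add: det_def Y_def)
    also have "\<dots> = (\<Sum>p\<in>?P. of_int (sign p) * (\<Prod>i=0..<n. X (f i) (p i)))"
      by (intro sum.cong arg_cong2[of _ _ _ _ "(*)"] prod.cong refl)
        (auto simp: Y_def permutes_in_image dest!: permutes_in_image[where x = "_ :: nat"])
    finally show ?thesis .
  qed
  define h where "h f = (\<Prod>i=0..<n. cnj (X (f i) i)) * det (Y f)" for f :: "nat \<Rightarrow> nat"
  have 1: "det (mat n n (\<lambda>(i,l). \<Sum>a<m. cnj (X a i) * X a l)) = (\<Sum>f\<in>?Fs. h f)"
  proof -
    have "det (mat n n (\<lambda>(i,l). \<Sum>a<m. cnj (X a i) * X a l))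
      = (\<Sum>p\<in>?P. of_int (sign p) * (\<Prod>i=0..<n. \<Sum>a<m. cnj (X a i) * X a (p i)))"
      unfolding det_def by (auto intro!: sum.cong prod.cong simp: permutes_in_image
        dest!: permutes_in_image[where x = "_ :: nat"])
    also have "\<dots> = (\<Sum>p\<in>?P. of_int (sign p) * (\<Sum>f\<in>?Fs. \<Prod>i=0..<n. cnj (X (f i) i) * X (f i) (p i)))"
      by (subst prod_sum_PiE) auto
    also have "\<dots> = (\<Sum>p\<in>?P. \<Sum>f\<in>?Fs. (\<Prod>i=0..<n. cnj (X (f i) i)) * (of_int (sign p) * (\<Prod>i=0..<n. X (f i) (p i))))"
      unfolding sum_distrib_left by (intro sum.cong refl) (simp add: prod.distrib mult_ac)
    also have "\<dots> = (\<Sum>f\<in>?Fs. \<Sum>p\<in>?P. (\<Prod>i=0..<n. cnj (X (f i) i)) * (of_int (sign p) * (\<Prod>i=0..<n. X (f i) (p i))))"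
      by (rule sum.swap)
    also have "\<dots> = (\<Sum>f\<in>?Fs. h f)" by (simp add: h_def detY sum_distrib_left)
    finally show ?thesis .
  qed
  \<comment> \<open>The set of row selections is stable under permuting positions, so the expansion
    may be summed over all permutations \<open>s\<close>; their number is the factor
    \<open>fact n\<close>.\<close>
  have 2: "(\<Sum>f\<in>?Fs. h f) = (\<Sum>f\<in>?Fs. h (f \<circ> s))" if s: "s permutes {0..<n}" for s
  proof (rule sum.reindex_bij_witness[where i = "\<lambda>f. f \<circ> s" and j = "\<lambda>f. f \<circ> inv_into UNIV s"])
    have s': "inv_into UNIV s permutes {0..<n}" using s by (rule permutes_inv)
    have mem: "f \<circ> r \<in> ?Fs" if "f \<in> ?Fs" "r permutes {0..<n}" for f r
    proof
      fix i assume "i \<in> {0..<n}"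
      then have "r i \<in> {0..<n}" using that(2) by (simp add: permutes_in_image)
      then show "(f \<circ> r) i \<in> {..<m}" using that(1) by (auto simp: PiE_def Pi_def)
    next
      fix i assume "i \<notin> {0..<n}"
      then show "(f \<circ> r) i = undefined" using that by (auto simp: permutes_not_in PiE_def extensional_def)
    qed
    fix f assume "f \<in> ?Fs"
    then show "f \<circ> s \<in> ?Fs" "f \<circ> inv_into UNIV s \<in> ?Fs" using mem s s' by auto
    show "f \<circ> s \<circ> inv_into UNIV s = f" "f \<circ> inv_into UNIV s \<circ> s = f" "h (f \<circ> inv_into UNIV s \<circ> s) = h f"
      using permutes_inv_o[OF s] by (auto simp: o_assoc[symmetric])
  qed
  have 3: "h (f \<circ> s) = of_int (sign s) * (\<Prod>i=0..<n. cnj (X (f (s i)) i)) * det (Y f)"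
    if s: "s permutes {0..<n}" for f s
  proof -
    have "Y (f \<circ> s) = mat n n (\<lambda>(i,j). Y f $$ (s i, j))"
    proof (rule eq_matI)
      fix i j assume "i < dim_row (mat n n (\<lambda>(i,j). Y f $$ (s i, j)))" "j < dim_col (mat n n (\<lambda>(i,j). Y f $$ (s i, j)))"
      then have ij: "i < n" "j < n" by auto
      then have "s i < n" using permutes_in_image[OF s, of i] by simp
      then show "Y (f \<circ> s) $$ (i,j) = mat n n (\<lambda>(i,j). Y f $$ (s i, j)) $$ (i,j)"
        using ij by (simp add: Y_def)
    qed (simp_all add: Y_def)
    then have "det (Y (f \<circ> s)) = of_int (sign s) * det (Y f)"
      using det_permute_rows[OF Yc s, of f] by simp
    then show ?thesis by (simp add: h_def mult_ac)
  qed
  \<comment> \<open>The signed products left over from \<open>h (f \<circ> s)\<close> form the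
    Leibniz formula of the transpose, so their sum supplies the conjugate factor of the squared
    modulus.\<close>
  have 4: "(\<Sum>s\<in>?P. of_int (sign s) * (\<Prod>i=0..<n. cnj (X (f (s i)) i))) = cnj (det (Y f))" for f
  proof -
    have "det (Y f) = det (transpose_mat (Y f))" using det_transpose[OF Yc] by simp
    also have "\<dots> = (\<Sum>s\<in>?P. of_int (sign s) * (\<Prod>i=0..<n. X (f (s i)) i))"
    proof -
      have "det (transpose_mat (Y f)) = (\<Sum>s\<in>?P. of_int (sign s) * (\<Prod>i=0..<n. transpose_mat (Y f) $$ (i, s i)))"
        by (simp add: det_def Y_def)
      also have "\<dots> = (\<Sum>s\<in>?P. of_int (sign s) * (\<Prod>i=0..<n. X (f (s i)) i))"
      proof (intro sum.cong refl arg_cong2[of _ _ _ _ "(*)"] prod.cong)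
        fix s i assume "s \<in> ?P" "i \<in> {0..<n}"
        then show "transpose_mat (Y f) $$ (i, s i) = X (f (s i)) i"
          using permutes_in_image[of s "{0..<n}" i] by (simp add: Y_def)
      qed
      finally show ?thesis .
    qed
    finally show ?thesis by simp
  qed
  have "fact n * det (mat n n (\<lambda>(i,l). \<Sum>a<m. cnj (X a i) * X a l)) = (\<Sum>s\<in>?P. \<Sum>f\<in>?Fs. h f)"
    unfolding 1 by (simp add: card_permutations[of "{0..<n}" n])
  also have "\<dots> = (\<Sum>s\<in>?P. \<Sum>f\<in>?Fs. h (f \<circ> s))" by (rule sum.cong[OF refl], rule 2) simp
  also have "\<dots> = (\<Sum>s\<in>?P. \<Sum>f\<in>?Fs. of_int (sign s) * (\<Prod>i=0..<n. cnj (X (f (s i)) i)) * det (Y f))"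
    by (rule sum.cong[OF refl], rule sum.cong[OF refl], rule 3) simp
  also have "\<dots> = (\<Sum>f\<in>?Fs. \<Sum>s\<in>?P. of_int (sign s) * (\<Prod>i=0..<n. cnj (X (f (s i)) i)) * det (Y f))"
    by (rule sum.swap)
  also have "\<dots> = (\<Sum>f\<in>?Fs. complex_of_real ((cmod (det (Y f)))\<^sup>2))"
    unfolding sum_distrib_right[symmetric] 4 by (simp add: complex_norm_square mult.commute del: of_real_power)
  finally show ?thesis by (simp add: Y_def)
qed

lemma det_mat_scale_rows:
  fixes c :: "nat \<Rightarrow> 'a :: comm_ring_1"
  shows "det (mat n n (\<lambda>(i,l). c i * Y i l)) = (\<Prod>i=0..<n. c i) * det (mat n n (\<lambda>(i,l). Y i l))"
proof -
  have "p i < n" if "p permutes {0..<n}" "i < n" for p i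
    using permutes_in_image[OF that(1), of i] that by simp
  then show ?thesis
    by (auto simp: det_def sum_distrib_left prod.distrib mult_ac intro!: sum.cong)
qed

locale diag_pencil =
  fixes n :: nat and d :: "nat \<Rightarrow> real" and B :: "complex mat"
  assumes d: "d k \<ge> 0" and B: "B \<in> carrier_mat n n"
begin

definition D :: "nat set" where "D = {k. k < n \<and> d k > 0}"

definition Fs :: "(nat \<Rightarrow> nat) set" where "Fs = PiE {0..<n} (\<lambda>_. {..<2 * n})"

text \<open>The rows of the \<open>2n \<times> n\<close> matrix with blocks \<open>1\<close> and \<open>M z\<close>: an index \<open>a < n\<close> denotes a unit row and \<open>n + k\<close>
  denotes row \<open>k\<close> of \<open>M z\<close>.\<close>

definition entry :: "nat \<Rightarrow> nat \<Rightarrow> complex poly" where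
  "entry a l = (if a < n then (if l = a then 1 else 0)
     else [: if a - n = l then complex_of_real (d l) else 0, B $$ (a - n, l) :])"

definition P :: "(nat \<Rightarrow> nat) \<Rightarrow> complex poly" where
  "P f = det (mat n n (\<lambda>(i,l). entry (f i) l))"

text \<open>The number of rows taken from \<open>M z\<close>, hence the degree in \<open>t\<close>
  of the term belonging to \<open>f\<close>.\<close>

definition j :: "(nat \<Rightarrow> nat) \<Rightarrow> nat" where "j f = card {i. i < n \<and> f i \<ge> n}"

definition M :: "complex \<Rightarrow> complex mat" where "M z = diag_real n d + z \<cdot>\<^sub>m B"

lemma M_carrier: "M z \<in> carrier_mat n n"
  using B by (simp add: M_def)

lemma P_expand: "P f = (\<Sum>p | p permutes {0..<n}. of_int (sign p) * (\<Prod>i=0..<n. entry (f i) (p i)))"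
proof -
  have "p i < n" if "p permutes {0..<n}" "i < n" for p i
    using permutes_in_image[OF that(1), of i] that by simp
  then show ?thesis unfolding P_def by (auto simp: det_def intro!: sum.cong)
qed

lemma poly_P: "poly (P f) z = det (mat n n (\<lambda>(i,l). poly (entry (f i) l) z))"
proof -
  have "p i < n" if "p permutes {0..<n}" "i < n" for p i
    using permutes_in_image[OF that(1), of i] that by simp
  then show ?thesis unfolding P_expand
    by (auto simp: det_def poly_sum poly_prod intro!: sum.cong)
qed

lemma entry_M: "a < n \<Longrightarrow> l < n \<Longrightarrow> poly (entry (n + a) l) z = M z $$ (a,l)"
  using B by (auto simp: entry_def M_def)

text \<open>Cauchy-Binet for the identity stacked on \<open>sqrt t\<close> times \<open>M z\<close>,
  whose Gram matrix is \<open>1 + t M* M\<close>; each row taken from the lower block contributes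
  \<open>sqrt t\<close> to the minor.\<close>

lemma det_gram_M:
  assumes t: "t \<ge> 0"
  shows "fact n * det (1\<^sub>m n + complex_of_real t \<cdot>\<^sub>m (mat_adjoint (M z) * M z))
    = complex_of_real (\<Sum>f\<in>Fs. t ^ j f * (cmod (poly (P f) z))\<^sup>2)"
proof -
  define X where "X a l = (if a < n then 1 else complex_of_real (sqrt t)) * poly (entry a l) z" for a l
  have "1\<^sub>m n + complex_of_real t \<cdot>\<^sub>m (mat_adjoint (M z) * M z)
    = mat n n (\<lambda>(i,l). \<Sum>a<2*n. cnj (X a i) * X a l)"
  proof (rule eq_matI)
    fix i l assume "i < dim_row (mat n n (\<lambda>(i,l). \<Sum>a<2*n. cnj (X a i) * X a l))"
      "l < dim_col (mat n n (\<lambda>(i,l). \<Sum>a<2*n. cnj (X a i) * X a l))"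
    then have il: "i < n" "l < n" by auto
    have "(\<Sum>a<2*n. cnj (X a i) * X a l) = (\<Sum>a<n. cnj (X a i) * X a l) + (\<Sum>a<n. cnj (X (n + a) i) * X (n + a) l)"
      unfolding mult_2 sum.nat_group[symmetric] lessThan_atLeast0
      by (subst sum.atLeastLessThan_concat[symmetric, of 0 n "n + n"])
        (auto simp: sum.shift_bounds_nat_ivl[of _ 0 n n, simplified] add.commute)
    also have "(\<Sum>a<n. cnj (X a i) * X a l) = (\<Sum>a<n. if a = i then (if i = l then 1 else 0) else 0)"
      by (intro sum.cong) (auto simp: X_def entry_def)
    also have "\<dots> = (if i = l then 1 else 0)" using il by simp
    also have "(\<Sum>a<n. cnj (X (n + a) i) * X (n + a) l) = t * (\<Sum>a<n. cnj (M z $$ (a,i)) * M z $$ (a,l))"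
      unfolding sum_distrib_left
    proof (intro sum.cong refl)
      fix a assume "a \<in> {..<n}"
      then have "cnj (X (n + a) i) * X (n + a) l = (complex_of_real (sqrt t) * complex_of_real (sqrt t)) * (cnj (M z $$ (a,i)) * M z $$ (a,l))"
        using il by (simp add: X_def entry_M)
      also have "complex_of_real (sqrt t) * complex_of_real (sqrt t) = t"
        using t by (simp flip: of_real_mult)
      finally show "cnj (X (n + a) i) * X (n + a) l = t * (cnj (M z $$ (a,i)) * M z $$ (a,l))" .
    qed
    also have "(\<Sum>a<n. cnj (M z $$ (a,i)) * M z $$ (a,l)) = (mat_adjoint (M z) * M z) $$ (i,l)"
    proof -
      have "(mat_adjoint (M z) * M z) $$ (i,l) = (\<Sum>a<n. mat_adjoint (M z) $$ (i,a) * M z $$ (a,l))"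
        by (rule index_mat_mult_sum[OF mat_adjoint_carrier[OF M_carrier] M_carrier il])
      then show ?thesis using M_carrier[of z] il by simp
    qed
    finally show "(1\<^sub>m n + complex_of_real t \<cdot>\<^sub>m (mat_adjoint (M z) * M z)) $$ (i,l)
       = mat n n (\<lambda>(i,l). \<Sum>a<2*n. cnj (X a i) * X a l) $$ (i,l)"
      using il M_carrier[of z] by simp
  qed (use M_carrier[of z] in auto)
  then have "fact n * det (1\<^sub>m n + complex_of_real t \<cdot>\<^sub>m (mat_adjoint (M z) * M z))
     = (\<Sum>f\<in>Fs. complex_of_real ((cmod (det (mat n n (\<lambda>(i,l). X (f i) l))))\<^sup>2))"
    unfolding Fs_def by (simp only: cauchy_binet_gram)
  also have "\<dots> = (\<Sum>f\<in>Fs. complex_of_real (t ^ j f * (cmod (poly (P f) z))\<^sup>2))"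
  proof (intro sum.cong refl arg_cong[of _ _ complex_of_real])
    fix f
    have "det (mat n n (\<lambda>(i,l). X (f i) l)) = (\<Prod>i=0..<n. if f i < n then 1 else complex_of_real (sqrt t)) * poly (P f) z"
      unfolding X_def poly_P by (rule det_mat_scale_rows)
    also have "(\<Prod>i=0..<n. if f i < n then 1 else complex_of_real (sqrt t))
       = (\<Prod>i\<in>{i. i < n \<and> f i \<ge> n}. complex_of_real (sqrt t))"
      by (intro prod.mono_neutral_cong_right) (auto simp: not_less)
    also have "\<dots> = complex_of_real (sqrt t) ^ j f" by (simp add: j_def)
    finally have "(cmod (det (mat n n (\<lambda>(i,l). X (f i) l))))\<^sup>2 = (sqrt t ^ j f)\<^sup>2 * (cmod (poly (P f) z))\<^sup>2"
      using t by (simp add: norm_mult norm_power power_mult_distrib)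
    also have "(sqrt t ^ j f)\<^sup>2 = t ^ j f" using t by (simp flip: power_mult add: mult.commute[of _ 2]) (simp add: power_mult)
    finally show "(cmod (det (mat n n (\<lambda>(i,l). X (f i) l))))\<^sup>2 = t ^ j f * (cmod (poly (P f) z))\<^sup>2" .
  qed
  finally show ?thesis by simp
qed

end

section \<open>Orders of vanishing of the minors\<close>

lemma X_dvd_pCons_0 [simp]: "[:0, 1:] dvd [:0, c:]" for c :: "'a :: comm_ring_1"
  by (rule dvdI[of _ _ "[:c:]"]) simp

context diag_pencil
begin

lemma finite_D [simp]: "finite D" by (simp add: D_def)

lemma finite_Fs [simp]: "finite Fs" by (simp add: Fs_def finite_PiE)

lemma P_dvd:
  assumes "\<And>p. p permutes {0..<n} \<Longrightarrow> Q dvd (\<Prod>i=0..<n. entry (f i) (p i))"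
  shows "Q dvd P f"
  unfolding P_expand using assms by (intro dvd_sum dvd_mult) auto

lemma P_not_inj:
  assumes "\<not> inj_on f {0..<n}"
  shows "P f = 0"
proof -
  obtain i k where ik: "i < n" "k < n" "i \<noteq> k" "f i = f k" using assms by (auto simp: inj_on_def)
  show ?thesis unfolding P_def
    by (rule det_identical_rows[of _ n i k]) (use ik in \<open>auto intro!: eq_vecI\<close>)
qed

lemma monom_dvd_prod:
  fixes g :: "nat \<Rightarrow> complex poly"
  assumes "S \<subseteq> {0..<n}" "\<And>i. i \<in> S \<Longrightarrow> [:0, 1:] dvd g i"
  shows "[:0, 1:] ^ card S dvd (\<Prod>i=0..<n. g i)"
proof -
  have fS: "finite S" using assms(1) finite_subset by blast
  have "(\<Prod>i\<in>S. [:0, 1:]) dvd (\<Prod>i\<in>S. g i)" using assms(2) by (rule prod_dvd_prod)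
  moreover have "(\<Prod>i\<in>S. g i) dvd (\<Prod>i=0..<n. g i)"
    using assms(1) by (intro prod_dvd_prod_subset) auto
  ultimately show ?thesis using fS by (auto intro: dvd_trans)
qed

lemma entry_dvd:
  assumes "a \<ge> n" "l < n" "a - n \<noteq> l \<or> l \<notin> D"
  shows "[:0, 1:] dvd entry a l"
proof -
  have "d l = 0" if "l \<notin> D" using that assms(2) d[of l] by (auto simp: D_def)
  then show ?thesis using assms by (auto simp: entry_def)
qed

lemma entry_zero:
  assumes "a \<ge> n" "l < n" "a - n \<notin> D" "l \<notin> D" "B $$ (a - n, l) = 0"
  shows "entry a l = 0"
proof -
  have "d l = 0" using assms d[of l] by (auto simp: D_def)
  then show ?thesis using assms by (auto simp: entry_def)
qed

text \<open>In a Leibniz term, every selected row of \<open>M\<close> contributes a factor \<open>z\<close> unless it meets the diagonal in \<open>D\<close>.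
  If the entries of \<open>B\<close> with both indices outside \<open>D\<close> vanish, a nonzero term takes each of its factors from a row or
  a column in \<open>D\<close>, which doubles the excess order.\<close>

lemma order_P_ge:
  assumes f: "f \<in> Fs" and P0: "P f \<noteq> 0"
  shows "j f \<le> order 0 (P f) + card D"
    "(\<And>k l. k < n \<Longrightarrow> l < n \<Longrightarrow> k \<notin> D \<Longrightarrow> l \<notin> D \<Longrightarrow> B $$ (k,l) = 0) \<Longrightarrow> 2 * j f \<le> order 0 (P f) + 2 * card D"
proof -
  have inj: "inj_on f {0..<n}" using P0 P_not_inj by blast
  define S where "S = {i. i < n \<and> f i \<ge> n}"
  have fin: "finite S" by (simp add: S_def)
  have jS: "j f = card S" by (simp add: j_def S_def)
  have inj': "inj_on (\<lambda>i. f i - n) S"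
    using inj by (intro inj_onI) (auto simp: S_def inj_on_def)
  \<comment> \<open>The positions where the Leibniz term can pick a nonvanishing constant, namely a
    diagonal entry in \<open>D\<close>; every position in \<open>H p\<close> contributes a factor
    \<open>z\<close>.\<close>
  define G where "G p = {i\<in>S. f i - n = p i \<and> p i \<in> D}" for p
  define H where "H p = S - G p" for p
  have cS: "card S = card (G p) + card (H p)" for p
  proof -
    have "G p \<subseteq> S" by (auto simp: G_def)
    then show ?thesis unfolding H_def using fin by (metis card_Diff_subset card_mono finite_subset le_add_diff_inverse)
  qed
  have dvdH: "[:0, 1:] ^ card (H p) dvd (\<Prod>i=0..<n. entry (f i) (p i))" if p: "p permutes {0..<n}" for p
  proof (rule monom_dvd_prod)
    fix i assume "i \<in> H p"
    moreover then have "p i < n" using permutes_in_image[OF p, of i] by (auto simp: H_def S_def)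
    ultimately show "[:0, 1:] dvd entry (f i) (p i)" by (intro entry_dvd) (auto simp: H_def G_def S_def)
  qed (auto simp: H_def S_def)
  have ord: "N \<le> order 0 (P f)" if "[:0, 1:] ^ N dvd P f" for N
    using that P0 order_divides[of 0 N "P f"] by simp
  show "j f \<le> order 0 (P f) + card D"
  proof -
    have "[:0, 1:] ^ (card S - card D) dvd P f"
    proof (rule P_dvd)
      fix p assume p: "p permutes {0..<n}"
      have "card (G p) \<le> card D"
        by (rule card_inj_on_le[of "\<lambda>i. f i - n"]) (use inj' in \<open>auto simp: G_def inj_on_def\<close>)
      then have "card S - card D \<le> card (H p)" using cS[of p] by simp
      then show "[:0, 1:] ^ (card S - card D) dvd (\<Prod>i=0..<n. entry (f i) (p i))"
        using dvdH[OF p] by (meson dvd_trans le_imp_power_dvd)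
    qed
    from ord[OF this] show ?thesis by (simp add: jS)
  qed
  show "2 * j f \<le> order 0 (P f) + 2 * card D"
    if B0: "\<And>k l. k < n \<Longrightarrow> l < n \<Longrightarrow> k \<notin> D \<Longrightarrow> l \<notin> D \<Longrightarrow> B $$ (k,l) = 0"
  proof -
    have "[:0, 1:] ^ (2 * card S - 2 * card D) dvd P f"
    proof (rule P_dvd)
      fix p assume p: "p permutes {0..<n}"
      have pin: "p i < n" if "i \<in> S" for i using permutes_in_image[OF p, of i] that by (auto simp: S_def)
      show "[:0, 1:] ^ (2 * card S - 2 * card D) dvd (\<Prod>i=0..<n. entry (f i) (p i))"
      proof (cases "\<exists>i\<in>S. entry (f i) (p i) = 0")
        case True
        then have "(\<Prod>i=0..<n. entry (f i) (p i)) = 0" by (intro prod_zero) (auto simp: S_def)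
        then show ?thesis by (simp only: dvd_0_right)
      next
        case False
        define S1 where "S1 = {i\<in>S. f i - n \<in> D}"
        define S2 where "S2 = {i\<in>S. p i \<in> D}"
        have f1: "finite S1" "finite S2" using fin by (auto simp: S1_def S2_def)
        have "f i < 2 * n" if "i \<in> S" for i using f that by (auto simp: Fs_def PiE_def Pi_def S_def)
        then have "f i - n < n" if "i \<in> S" for i using that by (force simp: S_def)
        then have "S \<subseteq> S1 \<union> S2" using False pin entry_zero B0
          by (fastforce simp: S1_def S2_def S_def)
        then have SU: "S = S1 \<union> S2" by (auto simp: S1_def S2_def)
        have "G p \<subseteq> S1 \<inter> S2" by (auto simp: G_def S1_def S2_def)
        then have "card (G p) \<le> card (S1 \<inter> S2)" using f1 by (intro card_mono) auto
        moreover have "card S1 \<le> card D"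
          by (rule card_inj_on_le[of "\<lambda>i. f i - n"]) (use inj' in \<open>auto simp: S1_def inj_on_def\<close>)
        moreover have "card S2 \<le> card D"
          by (rule card_inj_on_le[of p]) (use permutes_inj_on[OF p] in \<open>auto simp: S2_def\<close>)
        moreover have "card S1 + card S2 = card S + card (S1 \<inter> S2)"
          unfolding SU by (rule card_Un_Int) (use f1 in auto)
        \<comment> \<open>Positions in \<open>G p\<close> use both a row and a column of
          \<open>D\<close>, so by inclusion-exclusion \<open>card (H p)\<close> is at least
          \<open>card S - card (S1 \<inter> S2) = 2 * card S - card S1 - card S2\<close>.\<close>
        ultimately have "2 * card S - 2 * card D \<le> card (H p)" using cS[of p] by linarith
        then show ?thesis using dvdH[OF p] by (meson dvd_trans le_imp_power_dvd)
      qed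
    qed
    from ord[OF this] show ?thesis by (simp add: jS)
  qed
qed

text \<open>All unit rows except the one at position \<open>l\<close>, which gives way to row
  \<open>k\<close> of the pencil, so that the minor is a single entry. The value
  \<open>undefined\<close> outside the range is required for membership in
  \<open>PiE\<close>.\<close>

definition single :: "nat \<Rightarrow> nat \<Rightarrow> nat \<Rightarrow> nat" where
  "single k l = (\<lambda>i. if i < n then (if i = l then n + k else i) else undefined)"

text \<open>A unit row at position \<open>i\<close> forces \<open>p i = i\<close> in every nonzero
  Leibniz term, and a permutation fixing everything but \<open>l\<close> is the identity.\<close>

lemma single:
  assumes kl: "k < n" "l < n"
  shows "single k l \<in> Fs" "j (single k l) = 1" "P (single k l) = entry (n + k) l"
proof -
  show "single k l \<in> Fs" using kl by (auto simp: single_def Fs_def)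
  have "{i. i < n \<and> single k l i \<ge> n} = {l}" using kl by (auto simp: single_def)
  then show "j (single k l) = 1" by (simp add: j_def)
  have "P (single k l) = (\<Sum>p | p permutes {0..<n}. if p = id then (\<Prod>i=0..<n. entry (single k l i) (p i)) else 0)"
    unfolding P_expand
  proof (intro sum.cong refl)
    fix p assume "p \<in> {p. p permutes {0..<n}}"
    then have p: "p permutes {0..<n}" by simp
    show "of_int (sign p) * (\<Prod>i=0..<n. entry (single k l i) (p i)) = (if p = id then (\<Prod>i=0..<n. entry (single k l i) (p i)) else 0)"
    proof (cases "\<exists>i<n. i \<noteq> l \<and> p i \<noteq> i")
      case True
      then obtain i where i: "i < n" "i \<noteq> l" "p i \<noteq> i" by auto
      then have "entry (single k l i) (p i) = 0" by (simp add: single_def entry_def)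
      then have "(\<Prod>i=0..<n. entry (single k l i) (p i)) = 0" using i by (intro prod_zero) auto
      moreover have "p \<noteq> id" using i by auto
      ultimately show ?thesis by simp
    next
      case False
      have "p permutes {l}"
      proof (rule permutes_superset[OF p])
        fix x assume "x \<in> {0..<n} - {l}"
        then show "p x = x" using False by auto
      qed
      then have "p = id" by (simp only: permutes_sing)
      then show ?thesis by simp
    qed
  qed
  also have "\<dots> = (\<Prod>i=0..<n. entry (single k l i) i)"
    by (simp add: permutes_id finite_permutations)
  also have "\<dots> = (\<Prod>i=0..<n. if i = l then entry (n + k) l else 1)"
    using kl by (intro prod.cong) (auto simp: single_def entry_def)
  also have "\<dots> = entry (n + k) l" using kl by simp
  finally show "P (single k l) = entry (n + k) l" .
qed

text \<open>Selects the minor with rows \<open>insert k D\<close> and columns \<open>insert l D\<close>.\<close>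

definition bordered :: "nat \<Rightarrow> nat \<Rightarrow> nat \<Rightarrow> nat" where
  "bordered k l = (\<lambda>i. if i < n then (if i \<in> D then n + i else if i = l then n + k else i) else undefined)"

text \<open>The coefficient of \<open>z\<close> in the minor is \<open>B $$ (k,l)\<close> times the
  product of the \<open>d i\<close> over \<open>D\<close>. Only the identity contributes to it: in a
  nonzero term any other permutation moves at least two positions, each supplying a factor
  \<open>z\<close>.\<close>

lemma bordered:
  assumes kl: "k < n" "l < n" "k \<notin> D" "l \<notin> D" and Bkl: "B $$ (k,l) \<noteq> 0"
  shows "bordered k l \<in> Fs" "j (bordered k l) = card D + 1" "P (bordered k l) \<noteq> 0" "order 0 (P (bordered k l)) \<le> 1"
proof -
  let ?f = "bordered k l"
  have Dn: "i < n" if "i \<in> D" for i using that by (simp add: D_def)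
  show "?f \<in> Fs" using kl Dn by (auto simp: bordered_def Fs_def)
  have S: "{i. i < n \<and> ?f i \<ge> n} = insert l D" using kl Dn by (auto simp: bordered_def)
  then show "j ?f = card D + 1" using kl by (simp add: j_def)
  have fi: "?f i = n + i" if "i \<in> D" for i using Dn that by (simp add: bordered_def)
  have fl: "?f l = n + k" using kl by (simp add: bordered_def)
  have fo: "?f i = i" if "i < n" "i \<notin> D" "i \<noteq> l" for i using that by (simp add: bordered_def)
  have ekl: "entry (n + k) x = [:0, B $$ (k, x):]" if "x < n" for x
  proof -
    have "d k = 0" using kl d[of k] by (auto simp: D_def)
    then show ?thesis by (auto simp: entry_def)
  qed
  define T where "T p = (\<Prod>i=0..<n. entry (?f i) (p i))" for p
  have T2: "[:0, 1:] ^ 2 dvd T p" if p: "p permutes {0..<n}" "p \<noteq> id" for p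
  proof (cases "\<exists>i<n. i \<notin> D \<and> i \<noteq> l \<and> p i \<noteq> i")
    case True
    then obtain i where i: "i < n" "i \<notin> D" "i \<noteq> l" "p i \<noteq> i" by auto
    then have "entry (?f i) (p i) = 0" by (simp add: fo entry_def)
    then have "T p = 0" unfolding T_def using i by (intro prod_zero) auto
    then show ?thesis by simp
  next
    case False
    obtain x where x: "p x \<noteq> x" using p(2) by (auto simp: fun_eq_iff)
    have moved: "y \<in> insert l D" if "p y \<noteq> y" for y
      using that False permutes_not_in[OF p(1), of y] by fastforce
    have px: "p (p x) \<noteq> p x" using x permutes_inj[OF p(1)] by (auto dest: injD)
    have X: "[:0, 1:] dvd entry (?f y) (p y)" if y: "p y \<noteq> y" for y
    proof -
      have yn: "y < n" using y permutes_not_in[OF p(1), of y] by fastforce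
      then have pn: "p y < n" using permutes_in_image[OF p(1), of y] by simp
      show ?thesis
      proof (cases "y \<in> D")
        case True
        then show ?thesis using y pn by (intro entry_dvd) (auto simp: fi)
      next
        case False
        then have "y = l" using moved[OF y] by simp
        then show ?thesis using pn kl by (simp add: fl ekl)
      qed
    qed
    have "[:0, 1:] ^ card {x, p x} dvd T p"
      unfolding T_def
    proof (rule monom_dvd_prod)
      show "{x, p x} \<subseteq> {0..<n}" using x px permutes_not_in[OF p(1)] by (auto simp del: atLeastLessThan_iff)
    qed (use X x px in auto)
    moreover have "card {x, p x} = 2" using x by auto
    ultimately show ?thesis by (simp only:)
  qed
  have Tid: "T id = (\<Prod>i\<in>D. entry (n + i) i) * [:0, B $$ (k,l):]"
  proof -
    have "T id = (\<Prod>i\<in>insert l D. entry (?f i) i)"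
      unfolding T_def using kl Dn by (intro prod.mono_neutral_cong_right) (auto simp: fo entry_def)
    also have "\<dots> = entry (?f l) l * (\<Prod>i\<in>D. entry (?f i) i)" using kl by simp
    also have "(\<Prod>i\<in>D. entry (?f i) i) = (\<Prod>i\<in>D. entry (n + i) i)" by (intro prod.cong) (auto simp: fi)
    finally show ?thesis using kl by (simp add: fl ekl mult.commute id_def)
  qed
  have "P ?f = (\<Sum>p | p permutes {0..<n}. of_int (sign p) * T p)" by (simp add: P_expand T_def)
  also have "\<dots> = T id + (\<Sum>p\<in>{p. p permutes {0..<n}} - {id}. of_int (sign p) * T p)"
    by (subst sum.remove[of _ id]) (auto simp: permutes_id finite_permutations)
  finally have PT: "P ?f - T id = (\<Sum>p\<in>{p. p permutes {0..<n}} - {id}. of_int (sign p) * T p)" by simp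
  have "[:0, 1:] ^ 2 dvd P ?f - T id" unfolding PT using T2 by (intro dvd_sum dvd_mult) auto
  then obtain R where R: "P ?f = T id + [:0, 1:] ^ 2 * R" by (auto elim!: dvdE simp: algebra_simps)
  have c1: "coeff (P ?f) 1 = (\<Prod>i\<in>D. complex_of_real (d i)) * B $$ (k,l)"
  proof -
    have "coeff ([:0, 1:] ^ 2 * R) 1 = 0" by (simp add: power2_eq_square coeff_pCons split: nat.split)
    moreover have "coeff (T id) 1 = poly (\<Prod>i\<in>D. entry (n + i) i) 0 * B $$ (k,l)"
      unfolding Tid by (simp add: mult.commute[of _ "[:0, _:]"] poly_0_coeff_0 coeff_pCons)
    moreover have "poly (\<Prod>i\<in>D. entry (n + i) i) 0 = (\<Prod>i\<in>D. complex_of_real (d i))"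
      unfolding poly_prod by (intro prod.cong) (auto simp: entry_def)
    ultimately show ?thesis unfolding R by simp
  qed
  have "(\<Prod>i\<in>D. complex_of_real (d i)) \<noteq> 0" by (auto simp: D_def)
  then have c1n: "coeff (P ?f) 1 \<noteq> 0" using Bkl c1 by simp
  then show P0: "P ?f \<noteq> 0" by auto
  show "order 0 (P ?f) \<le> 1"
  proof (rule ccontr)
    assume "\<not> order 0 (P ?f) \<le> 1"
    then have "[:- 0, 1:] ^ 2 dvd P ?f" using order_divides[of 0 2 "P ?f"] by auto
    then obtain R' where "P ?f = [:0, 1:] ^ 2 * R'" by (auto elim: dvdE)
    then have "coeff (P ?f) 1 = 0" by (simp add: power2_eq_square coeff_pCons split: nat.split)
    then show False using c1n by simp
  qed
qed

text \<open>The identity \<open>det_gram_M\<close> at \<open>t = 0\<close>, where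
  \<open>0 ^ j f\<close> selects the terms without rows of \<open>M z\<close>.\<close>

lemma sum_no_rows: "(\<Sum>f | f \<in> Fs \<and> j f = 0. (cmod (poly (P f) z))\<^sup>2) = fact n"
proof -
  have "complex_of_real (fact n) = fact n * det (1\<^sub>m n + complex_of_real 0 \<cdot>\<^sub>m (mat_adjoint (M z) * M z))"
  proof -
    have "1\<^sub>m n + complex_of_real 0 \<cdot>\<^sub>m (mat_adjoint (M z) * M z) = 1\<^sub>m n"
      using M_carrier[of z] by (intro eq_matI) auto
    then show ?thesis by simp
  qed
  also have "\<dots> = complex_of_real (\<Sum>f\<in>Fs. 0 ^ j f * (cmod (poly (P f) z))\<^sup>2)" by (rule det_gram_M) simp
  also have "(\<Sum>f\<in>Fs. 0 ^ j f * (cmod (poly (P f) z))\<^sup>2) = (\<Sum>f | f \<in> Fs \<and> j f = 0. (cmod (poly (P f) z))\<^sup>2)"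
    by (intro sum.mono_neutral_cong_right) auto
  finally show ?thesis by (simp only: of_real_eq_iff)
qed

section \<open>The pencil as a family of polynomials\<close>

definition I :: "(nat \<Rightarrow> nat) set" where "I = {f\<in>Fs. j f \<ge> 1 \<and> P f \<noteq> 0}"

definition e :: "(nat \<Rightarrow> nat) \<Rightarrow> nat" where "e f = order 0 (P f)"

text \<open>The cofactor of \<open>z ^ e f\<close> in \<open>P f\<close>; the scalar absorbs the
  multiplicity \<open>fact n\<close> of Cauchy-Binet.\<close>

definition W :: "(nat \<Rightarrow> nat) \<Rightarrow> complex poly" where
  "W f = Polynomial.smult (1 / complex_of_real (sqrt (fact n))) (SOME Q. P f = [:0, 1:] ^ e f * Q \<and> \<not> [:0, 1:] dvd Q)"

lemma W:
  assumes "f \<in> I"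
  shows "poly (W f) 0 \<noteq> 0" "(cmod (poly (P f) z))\<^sup>2 = fact n * (cmod z ^ (2 * e f) * (cmod (poly (W f) z))\<^sup>2)"
proof -
  define Q where "Q = (SOME Q. P f = [:0, 1:] ^ e f * Q \<and> \<not> [:0, 1:] dvd Q)"
  have "\<exists>Q. P f = [:0, 1:] ^ e f * Q \<and> \<not> [:0, 1:] dvd Q"
    using order_decomp[of "P f" 0] assms by (auto simp: I_def e_def)
  then have Q: "P f = [:0, 1:] ^ e f * Q" "\<not> [:0, 1:] dvd Q"
    unfolding Q_def by (metis (mono_tags, lifting) someI_ex)+
  have WQ: "W f = Polynomial.smult (1 / complex_of_real (sqrt (fact n))) Q" by (simp add: W_def Q_def)
  have "poly Q 0 \<noteq> 0" using Q(2) poly_eq_0_iff_dvd[of Q 0] by simp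
  then show "poly (W f) 0 \<noteq> 0" by (simp add: WQ)
  show "(cmod (poly (P f) z))\<^sup>2 = fact n * (cmod z ^ (2 * e f) * (cmod (poly (W f) z))\<^sup>2)"
  proof -
    have "cmod z ^ (2 * e f) = (cmod z ^ e f)\<^sup>2" by (metis power_mult mult.commute)
    then show ?thesis
      unfolding WQ Q(1) by (simp add: norm_mult norm_power norm_divide power_mult_distrib power_divide)
  qed
qed

sublocale fam: poly_family I j e W
  by unfold_locales (use W in \<open>auto simp: I_def\<close>)

lemma Phi_svd:
  assumes t: "t \<ge> 0" and U: "unitary n U" and V: "unitary n V" and M: "M z = U * diag_real n s * mat_adjoint V"
  shows "fam.Phi t z = (\<Prod>k<n. 1 + t * (s k)\<^sup>2)"
proof -
  have "complex_of_real (fact n * (\<Prod>k<n. 1 + t * (s k)\<^sup>2)) = complex_of_real (\<Sum>f\<in>Fs. t ^ j f * (cmod (poly (P f) z))\<^sup>2)"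
    using det_gram_M[OF t, of z] det_one_plus_gram[OF U V M, of t] by simp
  then have "fact n * (\<Prod>k<n. 1 + t * (s k)\<^sup>2) = (\<Sum>f\<in>Fs. t ^ j f * (cmod (poly (P f) z))\<^sup>2)"
    by (simp only: of_real_eq_iff)
  also have "\<dots> = (\<Sum>f\<in>{f\<in>Fs. j f = 0} \<union> I. t ^ j f * (cmod (poly (P f) z))\<^sup>2)"
    by (intro sum.mono_neutral_right) (auto simp: I_def)
  also have "\<dots> = (\<Sum>f | f \<in> Fs \<and> j f = 0. t ^ j f * (cmod (poly (P f) z))\<^sup>2) + (\<Sum>f\<in>I. t ^ j f * (cmod (poly (P f) z))\<^sup>2)"
    by (intro sum.union_disjoint) (auto simp: I_def)
  also have "(\<Sum>f | f \<in> Fs \<and> j f = 0. t ^ j f * (cmod (poly (P f) z))\<^sup>2) = fact n"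
    using sum_no_rows[of z] by simp
  also have "(\<Sum>f\<in>I. t ^ j f * (cmod (poly (P f) z))\<^sup>2) = fact n * (\<Sum>f\<in>I. cmod z ^ (2 * e f) * (cmod (poly (W f) z))\<^sup>2 * t ^ j f)"
    unfolding sum_distrib_left using W(2) by (intro sum.cong) (auto simp: mult_ac)
  finally have "fact n * (\<Prod>k<n. 1 + t * (s k)\<^sup>2) = fact n * fam.Phi t z"
    unfolding fam.Phi_def by (simp add: algebra_simps)
  then show ?thesis by simp
qed

text \<open>\<open>Phi\<close> factors over the singular values of \<open>M z\<close>, so its
  logarithm is a sum of functions \<open>ln (1 + s^2 t)\<close>, each integrating to
  \<open>ln_const a\<close> times \<open>s powr (2 * a)\<close>.\<close>

lemma integral_Phi:
  assumes a: "0 < a" "a < 1"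
  shows "(\<integral>t. ln (fam.Phi t z) \<partial>powr_measure a) = ln_const a * schatten_sum (2 * a) (M z)"
proof -
  obtain U V s where U: "unitary n U" and V: "unitary n V" and s: "\<And>i. 0 \<le> s i"
    and svd: "M z = U * diag_real n s * mat_adjoint V" using svd_exists[OF M_carrier] by blast
  have "(\<integral>t. ln (fam.Phi t z) \<partial>powr_measure a) = (\<integral>t. (\<Sum>k<n. ln (1 + (s k)\<^sup>2 * t)) \<partial>powr_measure a)"
  proof (rule integral_powr_measure_cong)
    fix t :: real assume t: "t > 0"
    then have "1 + t * (s k)\<^sup>2 > 0" for k by (simp add: add_pos_nonneg)
    then have nz: "1 + t * (s k)\<^sup>2 \<noteq> 0" for k by (metis less_irrefl)
    show "ln (fam.Phi t z) = (\<Sum>k<n. ln (1 + (s k)\<^sup>2 * t))"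
      unfolding Phi_svd[OF less_imp_le[OF t] U V svd] by (subst ln_prod) (auto simp: nz mult.commute)
  qed (simp_all add: fam.Phi_def)
  also have "\<dots> = (\<Sum>k<n. \<integral>t. ln (1 + (s k)\<^sup>2 * t) \<partial>powr_measure a)"
    by (intro Bochner_Integration.integral_sum integral_ln_scale(1) a) auto
  also have "\<dots> = (\<Sum>k<n. ln_const a * (s k powr (2 * a)))"
  proof (intro sum.cong refl)
    fix k
    have "((s k)\<^sup>2) powr a = s k powr (2 * a)"
      using s[of k] by (cases "s k = 0") (auto simp: powr_powr simp flip: powr_numeral)
    then show "(\<integral>t. ln (1 + (s k)\<^sup>2 * t) \<partial>powr_measure a) = ln_const a * (s k powr (2 * a))"
      using integral_ln_scale(2)[OF a, of "(s k)\<^sup>2"] by simp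
  qed
  also have "\<dots> = ln_const a * schatten_sum (2 * a) (M z)"
    unfolding svd schatten_sum_svd[OF U V s] sum_distrib_left ..
  finally show ?thesis .
qed

end

section \<open>Both exponents below 2\<close>

lemma one_plus_prod_le:
  fixes x :: "'a \<Rightarrow> real"
  assumes "finite A" "A \<noteq> {}" "\<And>k. k \<in> A \<Longrightarrow> 0 \<le> x k"
  shows "1 + (\<Prod>k\<in>A. x k) \<le> (\<Prod>k\<in>A. 1 + x k)"
  using assms
proof (induction A rule: finite_ne_induct)
  case (insert k A)
  have p: "(\<Prod>k\<in>A. x k) \<ge> 0" using insert.prems by (intro prod_nonneg) auto
  have "1 + x k * (\<Prod>k\<in>A. x k) \<le> (1 + x k) * (1 + (\<Prod>k\<in>A. x k))"
    using p insert.prems by (simp add: algebra_simps)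
  also have "\<dots> \<le> (1 + x k) * (\<Prod>k\<in>A. 1 + x k)"
    using insert.IH insert.prems by (intro mult_left_mono) auto
  finally show ?case using insert.hyps by simp
qed simp

context diag_pencil
begin

lemma D_pos: "k \<in> D \<Longrightarrow> d k > 0"
  by (simp add: D_def)

lemma D_sq_pos: "k \<in> D \<Longrightarrow> (d k)\<^sup>2 > 0"
  using D_pos[of k] by simp

lemma M_0: "M 0 = diag_real n d"
  using B by (intro eq_matI) (auto simp: M_def)

lemma diag_real_svd: "diag_real n s = 1\<^sub>m n * diag_real n s * mat_adjoint (1\<^sub>m n)"
proof -
  have "mat_adjoint (1\<^sub>m n :: complex mat) = 1\<^sub>m n" by (rule eq_matI) auto
  then show ?thesis using diag_real_carrier[of n s] by simp
qed

text \<open>The determinant at the unperturbed matrix \<open>M 0\<close>; indices outside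
  \<open>D\<close> contribute factors 1.\<close>

definition U :: "real \<Rightarrow> real" where "U t = (\<Prod>k\<in>D. 1 + t * (d k)\<^sup>2)"

lemma Phi_0: 
  assumes "t \<ge> 0"
  shows "fam.Phi t 0 = U t"
proof -
  have "fam.Phi t 0 = (\<Prod>k<n. 1 + t * (d k)\<^sup>2)"
    by (rule Phi_svd[OF assms unitary_one unitary_one]) (use M_0 diag_real_svd in metis)
  also have "\<dots> = U t"
    unfolding U_def
  proof (rule prod.mono_neutral_right)
    show "\<forall>k\<in>{..<n} - D. 1 + t * (d k)\<^sup>2 = 1"
    proof
      fix k assume "k \<in> {..<n} - D"
      then have "d k = 0" using d[of k] by (auto simp: D_def)
      then show "1 + t * (d k)\<^sup>2 = 1" by simp
    qed
  qed (auto simp: D_def)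
  finally show ?thesis .
qed

lemma U_ge_1: "t \<ge> 0 \<Longrightarrow> U t \<ge> 1"
  unfolding U_def by (intro prod_ge_1) auto

text \<open>Evaluating \<open>Phi\<close> at \<open>z = 0\<close> keeps exactly the terms with
  \<open>e f = 0\<close>, since \<open>0 ^ 0 = 1\<close>.\<close>

lemma U_expand:
  assumes "t \<ge> 0"
  shows "U t = 1 + (\<Sum>f | f \<in> I \<and> e f = 0. fam.b f * t ^ j f)"
proof -
  have "U t = 1 + (\<Sum>f\<in>I. 0 ^ (2 * e f) * (cmod (poly (W f) 0))\<^sup>2 * t ^ j f)"
    using Phi_0[OF assms] by (simp add: fam.Phi_def)
  also have "(\<Sum>f\<in>I. 0 ^ (2 * e f) * (cmod (poly (W f) 0))\<^sup>2 * t ^ j f)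
    = (\<Sum>f | f \<in> I \<and> e f = 0. fam.b f * t ^ j f)"
    using fam.fin by (intro sum.mono_neutral_cong_right) (auto simp: fam.b_def)
  finally show ?thesis .
qed

text \<open>Any \<open>m\<close> of the factors of \<open>U\<close> already contain the monomial
  \<open>t ^ m\<close> with a positive coefficient. Comparing with \<open>U t - 1\<close>, which
  vanishes at 0, later gives a relative error under the logarithm.\<close>

lemma power_le_U:
  assumes "1 \<le> m" "m \<le> card D"
  obtains C where "C \<ge> 0" "\<And>t. t \<ge> 0 \<Longrightarrow> t ^ m \<le> C * (U t - 1)"
proof -
  obtain J where J: "J \<subseteq> D" "card J = m" using obtain_subset_with_card_n[OF assms(2)] by metis
  have fJ: "finite J" using J finite_subset[OF _ finite_D] by blast
  have neJ: "J \<noteq> {}" using J assms by auto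
  define p where "p = (\<Prod>k\<in>J. (d k)\<^sup>2)"
  have p: "p > 0" unfolding p_def using J D_sq_pos by (intro prod_pos) blast
  show thesis
  proof (rule that[of "1 / p"])
    fix t :: real assume t: "t \<ge> 0"
    have "1 + t ^ m * p = 1 + (\<Prod>k\<in>J. t * (d k)\<^sup>2)" using J by (simp add: p_def prod.distrib)
    also have "\<dots> \<le> (\<Prod>k\<in>J. 1 + t * (d k)\<^sup>2)" using fJ neJ t by (intro one_plus_prod_le) auto
    also have "\<dots> \<le> U t" unfolding U_def
      using J t by (intro prod_mono2) auto
    finally show "t ^ m \<le> 1 / p * (U t - 1)" using p by (simp add: field_simps)
  qed (use p in simp)
qed

definition I1 :: "(nat \<Rightarrow> nat) set" where "I1 = {f\<in>I. j f > card D}"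

text \<open>Excess of the degree in \<open>t\<close> over the number of nonzero \<open>d k\<close>;
  truncated subtraction makes it 0 when there is no excess.\<close>

definition ex :: "(nat \<Rightarrow> nat) \<Rightarrow> nat" where "ex f = j f - card D"

definition \<beta> :: "(nat \<Rightarrow> nat) \<Rightarrow> real" where "\<beta> f = fam.b f / (\<Prod>k\<in>D. (d k)\<^sup>2)"

lemma prod_D_pos: "(\<Prod>k\<in>D. (d k)\<^sup>2) > 0"
  by (intro prod_pos) (rule D_sq_pos)

lemma weighted:
  assumes "0 < a" "a < 1"
  shows "weighted_family a D (\<lambda>k. (d k)\<^sup>2) I1 ex \<beta>"
proof
  show "(d k)\<^sup>2 > 0" if "k \<in> D" for k using D_pos[OF that] by simp
  show "\<beta> f > 0" if "f \<in> I1" for f using that fam.b_pos prod_D_pos by (simp add: \<beta>_def I1_def)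
  show "finite I1" using fam.fin by (simp add: I1_def)
  show "1 \<le> ex f" if "f \<in> I1" for f using that by (auto simp: I1_def ex_def)
qed (use assms in simp_all)

abbreviation kap where "kap \<equiv> weighted_family.kap D (\<lambda>k. (d k)\<^sup>2)"
abbreviation v where "v \<equiv> weighted_family.v I1 ex e \<beta>"
abbreviation g where "g a \<equiv> weighted_family.g a D (\<lambda>k. (d k)\<^sup>2) I1 ex e \<beta>"

lemma e_ge_i: "f \<in> I \<Longrightarrow> ex f \<le> e f"
  using order_P_ge(1)[of f] by (auto simp: I_def ex_def e_def)

lemma U_kap_v:
  assumes t: "t > 0"
  shows "U t * (kap t * v t r) = (\<Sum>f\<in>I1. fam.b f * r ^ (2 * e f) * t ^ j f)"
proof -
  \<comment> \<open>\<open>kap\<close> and \<open>v\<close> do not depend on the exponent, so any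
    admissible value such as 1/2 serves for the interpretation.\<close>
  interpret w: weighted_family "1/2" D "\<lambda>k. (d k)\<^sup>2" I1 ex e \<beta> by (rule weighted) auto
  have "1 + t * (d k)\<^sup>2 \<noteq> 0" for k using t by (smt (verit) mult_nonneg_nonneg zero_le_power2)
  then have "U t * kap t = (\<Prod>k\<in>D. t * (d k)\<^sup>2)"
    unfolding U_def w.kap_def prod.distrib[symmetric] by (intro prod.cong) auto
  also have "\<dots> = t ^ card D * (\<Prod>k\<in>D. (d k)\<^sup>2)" by (simp add: prod.distrib)
  finally have "U t * (kap t * v t r) = t ^ card D * (\<Prod>k\<in>D. (d k)\<^sup>2) * v t r" by simp
  also have "\<dots> = (\<Sum>f\<in>I1. fam.b f * r ^ (2 * e f) * t ^ j f)"
    unfolding w.v_def sum_distrib_left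
  proof (intro sum.cong refl)
    fix f assume "f \<in> I1"
    then have "t ^ j f = t ^ card D * t ^ ex f" by (simp add: I1_def ex_def flip: power_add)
    then show "t ^ card D * (\<Prod>k\<in>D. (d k)\<^sup>2) * (\<beta> f * r ^ (2 * e f) * t ^ ex f) = fam.b f * r ^ (2 * e f) * t ^ j f"
      using prod_D_pos unfolding \<beta>_def by (simp add: field_simps del: prod_zero_iff)
  qed
  finally show ?thesis .
qed

text \<open>The terms fall into three classes: order 0 adds up to \<open>U t - 1\<close>, positive
  excess gives the \<open>kap\<close>-weighted part, and the rest has positive order without excess.
  The first two are disjoint because the order is at least the excess.\<close>

lemma Low_split:
  assumes t: "t > 0"
  shows "fam.Low t r = U t * (1 + kap t * v t r) + (\<Sum>f | f \<in> I \<and> e f \<ge> 1 \<and> j f \<le> card D. fam.b f * r ^ (2 * e f) * t ^ j f)"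
proof -
  have "I = {f\<in>I. e f = 0} \<union> (I1 \<union> {f\<in>I. e f \<ge> 1 \<and> j f \<le> card D})"
    by (auto simp: I1_def)
  then have "(\<Sum>f\<in>I. fam.b f * r ^ (2 * e f) * t ^ j f)
    = (\<Sum>f\<in>{f\<in>I. e f = 0} \<union> (I1 \<union> {f\<in>I. e f \<ge> 1 \<and> j f \<le> card D}). fam.b f * r ^ (2 * e f) * t ^ j f)" by simp
  also have "\<dots> = (\<Sum>f | f \<in> I \<and> e f = 0. fam.b f * r ^ (2 * e f) * t ^ j f) +
     ((\<Sum>f\<in>I1. fam.b f * r ^ (2 * e f) * t ^ j f) + (\<Sum>f | f \<in> I \<and> e f \<ge> 1 \<and> j f \<le> card D. fam.b f * r ^ (2 * e f) * t ^ j f))"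
  proof (subst sum.union_disjoint)
    show "{f\<in>I. e f = 0} \<inter> (I1 \<union> {f\<in>I. e f \<ge> 1 \<and> j f \<le> card D}) = {}"
      using e_ge_i by (fastforce simp: I1_def ex_def)
    show "(\<Sum>f | f \<in> I \<and> e f = 0. fam.b f * r ^ (2 * e f) * t ^ j f) + (\<Sum>f\<in>I1 \<union> {f\<in>I. e f \<ge> 1 \<and> j f \<le> card D}. fam.b f * r ^ (2 * e f) * t ^ j f)
      = (\<Sum>f | f \<in> I \<and> e f = 0. fam.b f * r ^ (2 * e f) * t ^ j f) +
     ((\<Sum>f\<in>I1. fam.b f * r ^ (2 * e f) * t ^ j f) + (\<Sum>f | f \<in> I \<and> e f \<ge> 1 \<and> j f \<le> card D. fam.b f * r ^ (2 * e f) * t ^ j f))"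
      using fam.fin by (subst sum.union_disjoint) (auto simp: I1_def)
  qed (use fam.fin in \<open>auto simp: I1_def\<close>)
  also have "(\<Sum>f | f \<in> I \<and> e f = 0. fam.b f * r ^ (2 * e f) * t ^ j f) = U t - 1"
    using U_expand[of t] t by simp
  also have "(\<Sum>f\<in>I1. fam.b f * r ^ (2 * e f) * t ^ j f) = U t * (kap t * v t r)" using U_kap_v[OF t] by simp
  finally show ?thesis by (simp add: fam.Low_def algebra_simps)
qed

text \<open>The terms of positive order without excess carry
  \<open>r ^ (2 * e f) \<le> r\<^sup>2\<close> and a power of \<open>t\<close> dominated by
  \<open>U t - 1\<close>, so they change \<open>Low t r - 1\<close> by at most a factor
  \<open>1 + O(r^2)\<close>.\<close>

lemma Low_bounds:
  obtains C where "C \<ge> 0"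
    "\<And>t r. t > 0 \<Longrightarrow> U t * (1 + kap t * v t r) \<le> fam.Low t r"
    "\<And>t r. t > 0 \<Longrightarrow> 0 \<le> r \<Longrightarrow> r \<le> 1 \<Longrightarrow> fam.Low t r \<le> 1 + (1 + C * r\<^sup>2) * (U t * (1 + kap t * v t r) - 1)"
proof -
  interpret w: weighted_family "1/2" D "\<lambda>k. (d k)\<^sup>2" I1 ex e \<beta> by (rule weighted) auto
  let ?R = "{f \<in> I. e f \<ge> 1 \<and> j f \<le> card D}"
  define Q where "Q f C \<longleftrightarrow> C \<ge> 0 \<and> (\<forall>t\<ge>0. t ^ j f \<le> C * (U t - 1))" for f C
  have "\<forall>f\<in>?R. \<exists>C. Q f C"
  proof
    fix f assume f: "f \<in> ?R"
    show "\<exists>C. Q f C"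
      by (rule power_le_U[of "j f"]) (use f fam.j in \<open>auto simp: Q_def\<close>)
  qed
  then obtain c where "\<forall>f\<in>?R. Q f (c f)" by metis
  then have c: "\<And>f. f \<in> ?R \<Longrightarrow> c f \<ge> 0 \<and> (\<forall>t\<ge>0. t ^ j f \<le> c f * (U t - 1))"
    by (simp add: Q_def)
  define C where "C = (\<Sum>f\<in>?R. fam.b f * c f)"
  show thesis
  proof (rule that[of C])
    show "C \<ge> 0" unfolding C_def using c fam.b_pos by (intro sum_nonneg mult_nonneg_nonneg) (auto simp: less_imp_le)
    fix t r :: real assume t: "t > 0"
    have "(\<Sum>f\<in>?R. fam.b f * r ^ (2 * e f) * t ^ j f) \<ge> 0"
      using fam.b_pos t by (intro sum_nonneg mult_nonneg_nonneg) (auto simp: less_imp_le power_mult)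
    then show "U t * (1 + kap t * v t r) \<le> fam.Low t r" using Low_split[OF t, of r] by simp
    assume r: "0 \<le> r" "r \<le> 1"
    have "(\<Sum>f\<in>?R. fam.b f * r ^ (2 * e f) * t ^ j f) \<le> (\<Sum>f\<in>?R. (fam.b f * c f) * (r\<^sup>2 * (U t - 1)))"
    proof (rule sum_mono)
      fix f assume f: "f \<in> ?R"
      have "r ^ (2 * e f) \<le> r ^ 2" using f r by (intro power_decreasing) auto
      moreover have "t ^ j f \<le> c f * (U t - 1)" using c[OF f] t by simp
      ultimately have "r ^ (2 * e f) * t ^ j f \<le> r\<^sup>2 * (c f * (U t - 1))"
        using t r by (intro mult_mono) auto
      then have "fam.b f * (r ^ (2 * e f) * t ^ j f) \<le> fam.b f * (r\<^sup>2 * (c f * (U t - 1)))"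
        using fam.b_pos f by (intro mult_left_mono) (auto simp: less_imp_le)
      then show "fam.b f * r ^ (2 * e f) * t ^ j f \<le> (fam.b f * c f) * (r\<^sup>2 * (U t - 1))" by (simp add: mult_ac)
    qed
    also have "\<dots> = C * r\<^sup>2 * (U t - 1)" unfolding C_def sum_distrib_right[symmetric] by (simp only: mult.assoc)
    also have "\<dots> \<le> C * r\<^sup>2 * (U t * (1 + kap t * v t r) - 1)"
    proof (intro mult_left_mono)
      have "0 \<le> U t * (kap t * v t r)"
        using U_ge_1[of t] t w.kap_nonneg[OF t] w.v_nonneg[OF t] by (intro mult_nonneg_nonneg) auto
      then show "U t - 1 \<le> U t * (1 + kap t * v t r) - 1" by (simp add: algebra_simps)
      show "0 \<le> C * r\<^sup>2" using \<open>C \<ge> 0\<close> by simp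
    qed
    finally show "fam.Low t r \<le> 1 + (1 + C * r\<^sup>2) * (U t * (1 + kap t * v t r) - 1)"
      using Low_split[OF t, of r] by (simp add: algebra_simps)
  qed
qed

lemma integral_ln_U:
  assumes a: "0 < a" "a < 1"
  shows "integrable (powr_measure a) (\<lambda>t. ln (U t))"
    "(\<integral>t. ln (U t) \<partial>powr_measure a) = ln_const a * schatten_sum (2 * a) (M 0)"
proof -
  have "AE t in powr_measure a. ln (fam.Phi t 0) = ln (U t)"
    using AE_powr_measure[of a] Phi_0 by (auto elim!: eventually_mono)
  moreover have m [measurable]: "U \<in> borel_measurable borel" unfolding U_def by measurable
  ultimately show "integrable (powr_measure a) (\<lambda>t. ln (U t))"
    using fam.integrable_Phi[OF a, of 0] by (subst (asm) integrable_cong_AE) (auto simp: fam.Phi_def)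
  have "(\<integral>t. ln (U t) \<partial>powr_measure a) = (\<integral>t. ln (fam.Phi t 0) \<partial>powr_measure a)"
  proof (rule integral_powr_measure_cong)
    show "(\<lambda>t. ln (fam.Phi t 0)) \<in> borel_measurable borel" unfolding fam.Phi_def by measurable
  qed (simp_all add: Phi_0)
  then show "(\<integral>t. ln (U t) \<partial>powr_measure a) = ln_const a * schatten_sum (2 * a) (M 0)"
    using integral_Phi[OF a, of 0] by simp
qed

text \<open>Taking logarithms splits off \<open>ln (U t)\<close>, whose integral does not involve
  \<open>r\<close>, and leaves the integrand of \<open>g\<close>; the factor
  \<open>1 + O(r^2)\<close> leaves the logarithm by concavity.\<close>

lemma G_bounds:
  assumes a: "0 < a" "a < 1"
  obtains C where "C \<ge> 0"
    "\<And>r. ln_const a * schatten_sum (2 * a) (M 0) + g a r \<le> fam.G a r"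
    "\<And>r. 0 \<le> r \<Longrightarrow> r \<le> 1 \<Longrightarrow> fam.G a r \<le> (1 + C * r\<^sup>2) * (ln_const a * schatten_sum (2 * a) (M 0) + g a r)"
proof -
  interpret w: weighted_family a D "\<lambda>k. (d k)\<^sup>2" I1 ex e \<beta> by (rule weighted[OF a])
  obtain C where C: "C \<ge> 0"
    "\<And>t r. t > 0 \<Longrightarrow> U t * (1 + kap t * v t r) \<le> fam.Low t r"
    "\<And>t r. t > 0 \<Longrightarrow> 0 \<le> r \<Longrightarrow> r \<le> 1 \<Longrightarrow> fam.Low t r \<le> 1 + (1 + C * r\<^sup>2) * (U t * (1 + kap t * v t r) - 1)"
    using Low_bounds by blast
  have int: "integrable (powr_measure a) (\<lambda>t. ln (U t) + ln (1 + kap t * v t r))" for r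
    by (intro Bochner_Integration.integrable_add integral_ln_U a w.integrable_kv)
  have val: "(\<integral>t. ln (U t) + ln (1 + kap t * v t r) \<partial>powr_measure a) = ln_const a * schatten_sum (2 * a) (M 0) + g a r" for r
    using integral_ln_U[OF a] w.integrable_kv[of r] by (simp add: w.g_def)
  have U_pos: "0 < U t" if "t > 0" for t using U_ge_1[of t] that by simp
  have pos: "0 < 1 + kap t * v t r" "1 \<le> U t * (1 + kap t * v t r)" if t: "t > 0" for t r
  proof -
    have "kap t * v t r \<ge> 0" using w.kap_nonneg[OF t] w.v_nonneg[OF t] by simp
    moreover have "U t \<ge> 1" using t U_ge_1[of t] by simp
    ultimately show "0 < 1 + kap t * v t r" "1 \<le> U t * (1 + kap t * v t r)"
      using mult_mono[of 1 "U t" 1 "1 + kap t * v t r"] by auto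
  qed
  have ln: "ln (U t * (1 + kap t * v t r)) = ln (U t) + ln (1 + kap t * v t r)" if t: "t > 0" for t r
    using U_pos[OF t] pos[OF t, of r] by (intro ln_mult_pos)
  show thesis
  proof (rule that[OF C(1)])
    fix r
    have "(\<integral>t. ln (U t) + ln (1 + kap t * v t r) \<partial>powr_measure a) \<le> fam.G a r"
      unfolding fam.G_def
    proof (rule integral_powr_measure_mono[OF int fam.integrable_Low[OF a]])
      fix t :: real assume t: "t > 0"
      show "ln (U t) + ln (1 + kap t * v t r) \<le> ln (fam.Low t r)"
        unfolding ln[OF t, symmetric] using C(2)[OF t, of r] pos[OF t, of r] by (intro ln_mono) auto
    qed
    then show "ln_const a * schatten_sum (2 * a) (M 0) + g a r \<le> fam.G a r" by (simp add: val)
  next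
    fix r :: real assume r: "0 \<le> r" "r \<le> 1"
    have "fam.G a r \<le> (\<integral>t. (1 + C * r\<^sup>2) * (ln (U t) + ln (1 + kap t * v t r)) \<partial>powr_measure a)"
      unfolding fam.G_def
    proof (rule integral_powr_measure_mono[OF fam.integrable_Low[OF a]])
      show "integrable (powr_measure a) (\<lambda>t. (1 + C * r\<^sup>2) * (ln (U t) + ln (1 + kap t * v t r)))"
        using int by simp
      fix t :: real assume t: "t > 0"
      define x where "x = U t * (1 + kap t * v t r) - 1"
      have x: "x \<ge> 0" using pos[OF t, of r] by (simp add: x_def)
      have "ln (fam.Low t r) \<le> ln (1 + (1 + C * r\<^sup>2) * x)"
        using C(3)[OF t r] fam.Low_ge_1[OF t, of r] by (intro ln_mono) (auto simp: x_def)
      also have "\<dots> \<le> (1 + C * r\<^sup>2) * ln (1 + x)" using C(1) x by (intro ln_one_plus_scale_ge) auto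
      also have "1 + x = U t * (1 + kap t * v t r)" by (simp add: x_def)
      finally show "ln (fam.Low t r) \<le> (1 + C * r\<^sup>2) * (ln (U t) + ln (1 + kap t * v t r))" by (simp add: ln[OF t])
    qed
    also have "\<dots> = (1 + C * r\<^sup>2) * (ln_const a * schatten_sum (2 * a) (M 0) + g a r)"
      by (subst Bochner_Integration.integral_mult_right_zero) (simp add: val)
    finally show "fam.G a r \<le> (1 + C * r\<^sup>2) * (ln_const a * schatten_sum (2 * a) (M 0) + g a r)" .
  qed
qed

text \<open>Chains the sandwich of \<open>F\<close> by \<open>G\<close> with that of
  \<open>G\<close> by the constant plus \<open>g\<close>; the two O(r^2) factors merge into
  one.\<close>

theorem exponent_small_small:
  assumes p: "0 < p" "p < 2" and q: "0 < q" "q < 2"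
    and rad: "\<And>z. schatten_sum p (M z) = (1 + cmod z powr q) powr (p / q)"
  shows "q = p"
proof -
  define a where "a = p / 2"
  have a: "0 < a" "a < 1" and pa: "p = 2 * a" using p by (auto simp: a_def)
  interpret w: weighted_family a D "\<lambda>k. (d k)\<^sup>2" I1 ex e \<beta> by (rule weighted[OF a])
  define F where "F r = ln_const a * (1 + r powr q) powr (p / q)" for r
  have "(\<integral>t. ln (fam.Phi t z) \<partial>powr_measure a) = F (cmod z)" for z
    using integral_Phi[OF a, of z] rad[of z] by (simp add: F_def pa)
  from fam.radial_sandwich[OF a this]
  obtain E K \<delta> where EK: "E \<ge> 0" "K \<ge> 0" "0 < \<delta>" "\<delta> \<le> 1"
    "\<And>r. 0 \<le> r \<Longrightarrow> r \<le> \<delta> \<Longrightarrow> (1 - E * r ^ 4) * fam.G a r \<le> F r"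
    "\<And>r. 0 \<le> r \<Longrightarrow> r \<le> \<delta> \<Longrightarrow> F r \<le> (1 + K * r\<^sup>2) * fam.G a r" by blast
  obtain C where C: "C \<ge> 0"
    "\<And>r. ln_const a * schatten_sum (2 * a) (M 0) + g a r \<le> fam.G a r"
    "\<And>r. 0 \<le> r \<Longrightarrow> r \<le> 1 \<Longrightarrow> fam.G a r \<le> (1 + C * r\<^sup>2) * (ln_const a * schatten_sum (2 * a) (M 0) + g a r)"
    using G_bounds[OF a] by blast
  have S0: "schatten_sum (2 * a) (M 0) = 1" using rad[of 0] q by (simp add: pa)
  define \<delta>' where "\<delta>' = min \<delta> (1 / (E + 1))"
  have \<delta>': "0 < \<delta>'" "\<delta>' \<le> 1" "\<delta>' \<le> \<delta>" "\<delta>' \<le> 1 / (E + 1)" using EK by (auto simp: \<delta>'_def)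
  have Kn: "K + C + K * C \<ge> 0" using EK C by simp
  show ?thesis
  proof (rule w.sandwich_exponent[OF pa q ln_const_pos[OF a] EK(1) Kn \<delta>'(1,2)])
    fix r :: real assume r: "0 < r" "r \<le> \<delta>'"
    have r1: "r \<le> 1" using r \<delta>' by simp
    have Er: "E * r ^ 4 \<le> 1"
    proof -
      have "r ^ 4 \<le> r ^ 1" using r r1 by (intro power_decreasing) auto
      then have "E * r ^ 4 \<le> E * (1 / (E + 1))" using r \<delta>' EK by (intro mult_left_mono) auto
      also have "\<dots> \<le> 1" using EK by (simp add: field_simps)
      finally show ?thesis .
    qed
    have "(1 - E * r ^ 4) * (ln_const a + g a r) \<le> (1 - E * r ^ 4) * fam.G a r"
      using C(2)[of r] Er S0 by (intro mult_left_mono) auto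
    also have "\<dots> \<le> F r" using EK(5)[of r] r \<delta>' by simp
    finally show "(1 - E * r ^ 4) * (ln_const a + g a r) \<le> ln_const a * (1 + r powr q) powr (p / q)"
      by (simp add: F_def)
    have "F r \<le> (1 + K * r\<^sup>2) * fam.G a r" using EK(6)[of r] r \<delta>' by simp
    also have "\<dots> \<le> (1 + K * r\<^sup>2) * ((1 + C * r\<^sup>2) * (ln_const a + g a r))"
      using C(3)[of r] r r1 EK S0 by (intro mult_left_mono) auto
    also have "\<dots> \<le> (1 + (K + C + K * C) * r\<^sup>2) * (ln_const a + g a r)"
    proof -
      have "r ^ 4 \<le> r ^ 2" using r r1 by (intro power_decreasing) auto
      then have "K * C * r ^ 4 \<le> K * C * r ^ 2" using EK C by (intro mult_left_mono) auto
      moreover have "(1 + K * r\<^sup>2) * (1 + C * r\<^sup>2) = 1 + (K + C) * r\<^sup>2 + K * C * r ^ 4"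
        by (simp add: algebra_simps power2_eq_square power4_eq_xxxx)
      ultimately have "(1 + K * r\<^sup>2) * (1 + C * r\<^sup>2) \<le> 1 + (K + C + K * C) * r\<^sup>2" by (simp add: algebra_simps)
      moreover have "0 \<le> ln_const a + g a r" using ln_const_pos[OF a] w.g_nonneg[of r] by simp
      ultimately show ?thesis by (simp only: mult.assoc[symmetric] mult_right_mono)
    qed
    finally show "ln_const a * (1 + r powr q) powr (p / q) \<le> (1 + (K + C + K * C) * r\<^sup>2) * (ln_const a + g a r)"
      by (simp add: F_def)
  next
    show "ex f \<le> e f" if "f \<in> I1" for f using that e_ge_i by (simp add: I1_def)
  next
    fix f assume strict: "\<And>f. f \<in> I1 \<Longrightarrow> ex f < e f" and f: "f \<in> I1"
    \<comment> \<open>A nonzero entry with both indices outside \<open>D\<close> would give a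
      bordered minor of excess 1 and order at most 1, contradicting \<open>strict\<close>. So these
      entries vanish and the doubled order bound applies.\<close>
    have B0: "B $$ (k,l) = 0" if kl: "k < n" "l < n" "k \<notin> D" "l \<notin> D" for k l
    proof (rule ccontr)
      assume "B $$ (k,l) \<noteq> 0"
      from bordered[OF kl this] have "bordered k l \<in> I1" "ex (bordered k l) = 1" "e (bordered k l) \<le> 1"
        by (auto simp: I1_def I_def ex_def e_def)
      then show False using strict by fastforce
    qed
    have "2 * j f \<le> order 0 (P f) + 2 * card D"
      by (rule order_P_ge(2)) (use f B0 in \<open>auto simp: I1_def I_def\<close>)
    then show "2 * ex f \<le> e f" by (simp add: ex_def e_def)
  qed
qed

end

section \<open>Pencils with a flat Schatten sum\<close>

text \<open>With the function written as \<open>exp (x w)\<close>, the harmonic function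
  \<open>x\<close> averages to at least -O(|w|^4), while the quadratic Taylor term of
  \<open>exp\<close> is a gain: one of the four rotations of \<open>w\<close> lies within 60 degrees
  of the positive axis, and there \<open>x\<close> is at least of size \<open>|w|\<close>.\<close>

lemma avg4_powr_one_plus_lower:
  fixes p :: real
  assumes p: "p > 0"
  obtains c E \<delta> where "c > 0" "E \<ge> 0" "\<delta> > 0"
    "\<And>w. cmod w \<le> \<delta> \<Longrightarrow> 1 + c * (cmod w)\<^sup>2 - E * cmod w ^ 4 \<le> avg4 (\<lambda>w. cmod (1 + w) powr p) w"
proof -
  have 0: "poly [:1, 1:] (0::complex) \<noteq> 0" by simp
  obtain E r where E: "E \<ge> 0" "r > 0"
    "\<And>z. cmod z \<le> r \<Longrightarrow> poly [:1, 1:] z \<noteq> 0"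
    "\<And>z. cmod z \<le> r \<Longrightarrow> avg4 (\<lambda>z. ln ((cmod (poly [:1, 1:] z))\<^sup>2 / (cmod (poly [:1, 1:] 0))\<^sup>2)) z \<ge> - E * cmod z ^ 4"
    using avg4_ln_poly_lower[OF 0] by blast
  define x where "x z = p * ln (cmod (1 + z))" for z
  have nz: "1 + z \<noteq> 0" if "cmod z \<le> r" for z using E(3)[OF that] by simp
  have ex: "cmod (1 + z) powr p = exp (x z)" if "cmod z \<le> r" for z
    using nz[OF that] by (simp add: x_def powr_def)
  have avx: "avg4 x z \<ge> - (p / 2 * E) * cmod z ^ 4" if z: "cmod z \<le> r" for z
  proof -
    have "avg4 x z = p / 2 * avg4 (\<lambda>z. ln ((cmod (poly [:1, 1:] z))\<^sup>2 / (cmod (poly [:1, 1:] 0))\<^sup>2)) z"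
    proof -
      have L: "ln ((cmod (1 + w))\<^sup>2) = 2 * ln (cmod (1 + w))" if "cmod w = cmod z" for w
        using nz[of w] that z by (simp add: ln_realpow)
      show ?thesis
        using L[of z] L[of "\<i> * z"] L[of "- z"] L[of "- (\<i> * z)"]
        unfolding avg4_def x_def by (simp add: norm_mult distrib_left)
    qed
    also have "\<dots> \<ge> p / 2 * (- E * cmod z ^ 4)" using E(4)[OF z] p by (intro mult_left_mono) auto
    finally show ?thesis by simp
  qed
  have big: "x z \<ge> p * cmod z / 4" if z: "Re z \<ge> cmod z / 2" "cmod z \<le> 1" for z
  proof -
    have "1 + cmod z / 2 \<le> Re (1 + z)" using z by simp
    also have "\<dots> \<le> cmod (1 + z)" by (rule complex_Re_le_cmod)
    finally have 1: "1 + cmod z / 2 \<le> cmod (1 + z)" .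
    have "cmod z / 4 \<le> cmod z / 2 - (cmod z / 2)\<^sup>2"
    proof -
      have "(cmod z / 2)\<^sup>2 = cmod z * (cmod z / 4)" by (simp add: power2_eq_square)
      also have "\<dots> \<le> 1 * (cmod z / 4)" using z by (intro mult_right_mono) auto
      finally show ?thesis by simp
    qed
    also have "\<dots> \<le> ln (1 + cmod z / 2)" using z by (intro ln_one_plus_pos_lower_bound) auto
    also have "\<dots> \<le> ln (cmod (1 + z))" by (rule ln_mono[OF 1]) (simp add: add_pos_nonneg)
    finally have "cmod z / 4 \<le> ln (cmod (1 + z))" .
    then have "p * (cmod z / 4) \<le> x z" unfolding x_def using p by (intro mult_left_mono) auto
    then show ?thesis by simp
  qed
  have quad: "exp (x z) \<ge> 1 + x z + p\<^sup>2 * (cmod z)\<^sup>2 / 32" if z: "Re z \<ge> cmod z / 2" "cmod z \<le> 1" for z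
  proof -
    have x0: "0 \<le> p * cmod z / 4" using p by simp
    have "1 + x z + (x z)\<^sup>2 / 2 \<le> exp (x z)"
      using big[OF z] x0 by (intro exp_lower_Taylor_quadratic) auto
    moreover have "(p * cmod z / 4)\<^sup>2 \<le> (x z)\<^sup>2" using big[OF z] x0 by (intro power_mono) auto
    ultimately show ?thesis by (simp add: power_mult_distrib power_divide)
  qed
  \<comment> \<open>The bound \<open>x \<ge> p |w| / 4\<close> at one of the points gains
    \<open>p^2 |w|^2 / 32\<close> there, and averaging over four points leaves the constant
    \<open>p^2 / 128\<close>.\<close>
  show thesis
  proof (rule that[of "p\<^sup>2 / 128" "p / 2 * E" "min r 1"])
    fix w :: complex assume "cmod w \<le> min r 1"
    then have w: "cmod w \<le> r" "cmod w \<le> 1" by auto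
    have lin: "exp (x z) \<ge> 1 + x z" for z by simp
    have "cmod w \<le> \<bar>Re w\<bar> + \<bar>Im w\<bar>" by (rule cmod_le)
    then have "Re w \<ge> cmod w / 2 \<or> Re (\<i> * w) \<ge> cmod w / 2 \<or> Re (- w) \<ge> cmod w / 2 \<or> Re (- (\<i> * w)) \<ge> cmod w / 2"
      by auto
    moreover have "cmod (\<i> * w) = cmod w" "cmod (- w) = cmod w" "cmod (- (\<i> * w)) = cmod w" by (auto simp: norm_mult)
    ultimately have "exp (x w) + exp (x (\<i> * w)) + exp (x (- w)) + exp (x (- (\<i> * w)))
      \<ge> 4 + (x w + x (\<i> * w) + x (- w) + x (- (\<i> * w))) + p\<^sup>2 * (cmod w)\<^sup>2 / 32"
      using quad[of w] quad[of "\<i> * w"] quad[of "- w"] quad[of "- (\<i> * w)"]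
        lin[of w] lin[of "\<i> * w"] lin[of "- w"] lin[of "- (\<i> * w)"] w(2)
      by (elim disjE) (simp_all del: exp_ge_add_one_self)
    moreover have "1 + S / 4 + Z / 128 \<le> T / 4" if "4 + S + Z / 32 \<le> T" for S Z T :: real
      using that by simp
    ultimately have "avg4 (\<lambda>w. exp (x w)) w \<ge> 1 + avg4 x w + p\<^sup>2 * (cmod w)\<^sup>2 / 128"
      unfolding avg4_def by blast
    moreover have "avg4 (\<lambda>w. exp (x w)) w = avg4 (\<lambda>w. cmod (1 + w) powr p) w"
      using w(1) ex[of w] ex[of "\<i> * w"] ex[of "- w"] ex[of "- (\<i> * w)"] by (simp add: avg4_def norm_mult)
    ultimately show "1 + p\<^sup>2 / 128 * (cmod w)\<^sup>2 - p / 2 * E * cmod w ^ 4 \<le> avg4 (\<lambda>w. cmod (1 + w) powr p) w"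
      using avx[OF w(1)] by simp
  qed (use p E in auto)
qed

text \<open>The phases of the \<open>c k\<close> go into the left unitary factor, with phase 1 at
  zero entries; the moduli form the diagonal of a singular value decomposition.\<close>

lemma schatten_sum_diag:
  "schatten_sum p (mat n n (\<lambda>(i,j). if i = j then c i else 0)) = (\<Sum>k<n. cmod (c k) powr p)"
proof -
  define u where "u k = (if c k = 0 then 1 else c k / cmod (c k))" for k
  have u1: "cnj (u k) * u k = 1" for k
  proof -
    have "cnj (u k) * u k = complex_of_real ((cmod (u k))\<^sup>2)"
      by (simp only: complex_norm_square mult.commute)
    moreover have "cmod (u k) = 1" by (simp add: u_def norm_divide)
    ultimately show ?thesis by simp
  qed
  have uc: "u k * cmod (c k) = c k" for k by (simp add: u_def)
  define X where "X = mat n n (\<lambda>(i,j). if i = j then u i else 0)"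
  have Xc: "X \<in> carrier_mat n n" by (simp add: X_def)
  have X: "unitary n X"
  proof (rule unitaryI[OF Xc])
    fix i j assume ij: "i < n" "j < n"
    have "(\<Sum>k<n. cnj (X $$ (k,i)) * X $$ (k,j)) = (\<Sum>k<n. if k = i then (if i = j then 1 else 0) else 0)"
      by (intro sum.cong) (use ij u1 in \<open>auto simp: X_def\<close>)
    then show "(\<Sum>k<n. cnj (X $$ (k,i)) * X $$ (k,j)) = (if i = j then 1 else 0)" using ij by simp
  qed
  have "mat n n (\<lambda>(i,j). if i = j then c i else 0) = X * diag_real n (\<lambda>k. cmod (c k)) * mat_adjoint (1\<^sub>m n)"
  proof (rule eq_matI)
    fix i j assume "i < dim_row (X * diag_real n (\<lambda>k. cmod (c k)) * mat_adjoint (1\<^sub>m n))"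
      "j < dim_col (X * diag_real n (\<lambda>k. cmod (c k)) * mat_adjoint (1\<^sub>m n))"
    then have ij: "i < n" "j < n" using Xc by auto
    have "(X * diag_real n (\<lambda>k. cmod (c k)) * mat_adjoint (1\<^sub>m n)) $$ (i,j)
      = (\<Sum>k<n. X $$ (i,k) * cmod (c k) * cnj (1\<^sub>m n $$ (j,k)))"
      by (rule index_svd[OF Xc one_carrier_mat ij])
    also have "\<dots> = (\<Sum>k<n. if k = i then (if i = j then c i else 0) else 0)"
      by (intro sum.cong) (use ij uc in \<open>auto simp: X_def\<close>)
    finally show "mat n n (\<lambda>(i,j). if i = j then c i else 0) $$ (i,j)
      = (X * diag_real n (\<lambda>k. cmod (c k)) * mat_adjoint (1\<^sub>m n)) $$ (i,j)" using ij by simp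
  qed (use Xc in auto)
  then show ?thesis using schatten_sum_svd[OF X unitary_one, of "\<lambda>k. cmod (c k)" p] by simp
qed

context diag_pencil
begin

text \<open>The flatness assumption holds for \<open>q > 2\<close>.\<close>

lemma flat_offdiag_zero:
  assumes p: "0 < p" "p < 2" and rad: "\<And>z. schatten_sum p (M z) = F (cmod z)" and F0: "F 0 = 1"
    and flat: "((\<lambda>r. (F r - 1) / r\<^sup>2) \<longlongrightarrow> 0) (at_right 0)"
    and kl: "k < n" "l < n" "k \<noteq> l \<or> k \<notin> D"
  shows "B $$ (k,l) = 0"
proof (rule ccontr)
  assume Bkl: "B $$ (k,l) \<noteq> 0"
  define a where "a = p / 2"
  have a: "0 < a" "a < 1" and pa: "p = 2 * a" using p by (auto simp: a_def)
  \<comment> \<open>The minor consisting of this entry. Away from the diagonal entries in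
    \<open>D\<close> the pencil has no constant part, so the minor has order 1 and adds
    \<open>b * r\<^sup>2 * t\<close> to \<open>Low\<close>.\<close>
  define f where "f = single k l"
  have "d l = 0" if "k = l" using that kl d[of l] by (auto simp: D_def)
  then have Pf: "P f = [:0, B $$ (k,l):]" using single(3)[OF kl(1,2)] by (simp add: f_def entry_def)
  have fI: "f \<in> I" using single[OF kl(1,2)] Pf Bkl by (auto simp: I_def f_def)
  have jf: "j f = 1" using single[OF kl(1,2)] by (simp add: f_def)
  have "e f \<le> degree (P f)" unfolding e_def by (rule order_degree) (use Pf Bkl in auto)
  moreover have "e f \<noteq> 0" unfolding e_def using order_root[of "P f" 0] Pf Bkl by auto
  ultimately have ef: "e f = 1" using Pf Bkl by auto
  define b where "b = fam.b f"
  have b: "b > 0" unfolding b_def by (rule fam.b_pos[OF fI])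
  have low: "U t + b * r\<^sup>2 * t \<le> fam.Low t r" if t: "t > 0" and r: "r \<ge> 0" for t r
  proof -
    have "U t + b * r\<^sup>2 * t = 1 + (\<Sum>x\<in>insert f {x\<in>I. e x = 0}. fam.b x * r ^ (2 * e x) * t ^ j x)"
    proof -
      have "(\<Sum>x\<in>insert f {x\<in>I. e x = 0}. fam.b x * r ^ (2 * e x) * t ^ j x)
        = b * r\<^sup>2 * t + (\<Sum>x | x \<in> I \<and> e x = 0. fam.b x * r ^ (2 * e x) * t ^ j x)"
        using fam.fin ef jf by (subst sum.insert) (auto simp: b_def power2_eq_square)
      also have "(\<Sum>x | x \<in> I \<and> e x = 0. fam.b x * r ^ (2 * e x) * t ^ j x) = (\<Sum>x | x \<in> I \<and> e x = 0. fam.b x * t ^ j x)"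
        by (intro sum.cong) auto
      finally show ?thesis using U_expand[of t] t by simp
    qed
    also have "\<dots> \<le> fam.Low t r" unfolding fam.Low_def
      using fam.fin fam.b_pos fI t r by (intro add_left_mono sum_mono2) (auto simp: less_imp_le)
    finally show ?thesis .
  qed
  have [measurable]: "U \<in> borel_measurable borel" unfolding U_def by measurable
  \<comment> \<open>Scaled by \<open>r\<^sup>2\<close>, a lower bound for the gain of
    \<open>ln (Low t r)\<close> over \<open>ln (U t)\<close>. Its integral \<open>c\<close> is
    positive, so \<open>F\<close> would grow at least quadratically, against
    \<open>flat\<close>.\<close>
  define h where "h t = ln (1 + b * t / U t)" for t
  have hb: "0 < h t \<and> h t \<le> 1 * ln (1 + b * t)" if t: "t > 0" for t
  proof -
    have U1: "U t \<ge> 1" using U_ge_1 t by simp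
    then have x: "0 < b * t / U t" using b t by simp
    moreover have "b * t / U t \<le> b * t / 1" using U1 b t by (intro divide_left_mono) auto
    ultimately show ?thesis by (auto simp: h_def)
  qed
  have hm [measurable]: "h \<in> borel_measurable borel" unfolding h_def by measurable
  have hint: "integrable (powr_measure a) h"
    by (rule integrable_powr_measure_bound[OF a b hm, where K = 1]) (use hb in \<open>auto simp: less_imp_le\<close>)
  define c where "c = integral\<^sup>L (powr_measure a) h"
  have c: "c > 0" unfolding c_def by (rule integral_powr_measure_pos[OF hint hm]) (use hb in \<open>auto simp: less_imp_le\<close>)
  define C0 where "C0 = ln_const a"
  have C0: "C0 > 0" using ln_const_pos[OF a] by (simp add: C0_def)
  have S0: "schatten_sum (2 * a) (M 0) = 1" using rad[of 0] F0 by (simp add: pa)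
  have G: "C0 + c * r\<^sup>2 \<le> fam.G a r" if r: "0 \<le> r" "r \<le> 1" for r
  proof -
    have int: "integrable (powr_measure a) (\<lambda>t. ln (U t) + r\<^sup>2 * h t)"
      using integral_ln_U(1)[OF a] hint by simp
    have "C0 + c * r\<^sup>2 = (\<integral>t. ln (U t) + r\<^sup>2 * h t \<partial>powr_measure a)"
      using integral_ln_U[OF a] hint S0 by (simp add: C0_def c_def)
    also have "\<dots> \<le> fam.G a r"
      unfolding fam.G_def
    proof (rule integral_powr_measure_mono[OF int fam.integrable_Low[OF a]])
      fix t :: real assume t: "t > 0"
      have U1: "U t \<ge> 1" using U_ge_1 t by simp
      have x: "0 < b * t / U t" using b t U1 by simp
      have r2: "r\<^sup>2 \<le> 1" using r by (simp add: power_le_one)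
      have "r\<^sup>2 * h t \<le> ln (1 + r\<^sup>2 * (b * t / U t))"
        unfolding h_def using x r2 by (intro ln_one_plus_scale) auto
      then have "ln (U t) + r\<^sup>2 * h t \<le> ln (U t) + ln (1 + r\<^sup>2 * (b * t / U t))" by simp
      also have "\<dots> = ln (U t * (1 + r\<^sup>2 * (b * t / U t)))"
        using U1 mult_nonneg_nonneg[OF zero_le_power2 less_imp_le[OF x], of r] by (intro ln_mult_pos[symmetric]) linarith+
      also have "U t * (1 + r\<^sup>2 * (b * t / U t)) = U t + b * r\<^sup>2 * t" using U1 by (simp add: field_simps)
      also have "ln \<dots> \<le> ln (fam.Low t r)"
        using low[OF t r(1)] U1 b t by (intro ln_mono) (auto intro!: add_pos_nonneg)
      finally show "ln (U t) + r\<^sup>2 * h t \<le> ln (fam.Low t r)" .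
    qed
    finally show ?thesis .
  qed
  define F' where "F' r = C0 * F r" for r
  have "(\<integral>t. ln (fam.Phi t z) \<partial>powr_measure a) = F' (cmod z)" for z
    using integral_Phi[OF a, of z] rad[of z] by (simp add: pa C0_def F'_def)
  from fam.radial_sandwich[OF a this]
  obtain E K \<delta> where E': "E \<ge> 0" "K \<ge> 0" "0 < \<delta>" "\<delta> \<le> 1"
    "\<And>r. 0 \<le> r \<Longrightarrow> r \<le> \<delta> \<Longrightarrow> (1 - E * r ^ 4) * fam.G a r \<le> F' r"
    "\<And>r. 0 \<le> r \<Longrightarrow> r \<le> \<delta> \<Longrightarrow> F' r \<le> (1 + K * r\<^sup>2) * fam.G a r" by blast
  note E = E'(1,3,4) E'(5)[unfolded F'_def]
  define \<delta>' where "\<delta>' = min \<delta> (1 / (E + 1))"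
  have \<delta>': "0 < \<delta>'" "\<delta>' \<le> \<delta>" "\<delta>' \<le> 1 / (E + 1)" using E by (auto simp: \<delta>'_def)
  have "((\<lambda>r. C0 * ((F r - 1) / r\<^sup>2) + E * r\<^sup>2 * (C0 + c)) \<longlongrightarrow> C0 * 0 + E * 0\<^sup>2 * (C0 + c)) (at_right 0)"
    by (intro tendsto_intros flat)
  moreover have "eventually (\<lambda>r. c \<le> C0 * ((F r - 1) / r\<^sup>2) + E * r\<^sup>2 * (C0 + c)) (at_right 0)"
  proof (rule eventually_at_rightI[of 0 \<delta>'])
    fix r assume "r \<in> {0<..<\<delta>'}"
    then have r: "0 < r" "r \<le> \<delta>" "r \<le> 1 / (E + 1)" "r \<le> 1" using \<delta>' E by auto
    have Er: "E * r ^ 4 \<le> 1"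
    proof -
      have "r ^ 4 \<le> r ^ 1" using r by (intro power_decreasing) auto
      then have "E * r ^ 4 \<le> E * (1 / (E + 1))" using r E by (intro mult_left_mono) auto
      also have "\<dots> \<le> 1" using E by (simp add: field_simps)
      finally show ?thesis .
    qed
    have r21: "r\<^sup>2 \<le> 1" using r by (simp add: power_le_one)
    have "(1 - E * r ^ 4) * (C0 + c * r\<^sup>2) \<le> (1 - E * r ^ 4) * fam.G a r"
      using G[of r] r Er by (intro mult_left_mono) auto
    also have "\<dots> \<le> C0 * F r" using E(4)[of r] r by simp
    finally have "c * r\<^sup>2 \<le> C0 * (F r - 1) + E * r ^ 4 * (C0 + c * r\<^sup>2)" by (simp add: algebra_simps)
    also have "E * r ^ 4 * (C0 + c * r\<^sup>2) \<le> E * r ^ 4 * (C0 + c)"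
      using E c r21 by (intro mult_left_mono add_left_mono) (auto simp: mult_left_le)
    finally have "c * r\<^sup>2 / r\<^sup>2 \<le> (C0 * (F r - 1) + E * r ^ 4 * (C0 + c)) / r\<^sup>2"
      by (intro divide_right_mono) auto
    then show "c \<le> C0 * ((F r - 1) / r\<^sup>2) + E * r\<^sup>2 * (C0 + c)"
      using r by (simp add: add_divide_distrib power4_eq_xxxx power2_eq_square mult_ac)
  qed (use \<delta>' in simp)
  ultimately have "c \<le> C0 * 0 + E * 0\<^sup>2 * (C0 + c)" by (intro tendsto_lowerbound) auto
  then show False using c by simp
qed

text \<open>Only diagonal entries in \<open>D\<close> are left, so the Schatten sum is a combination
  of the \<open>|1 + z w k|^p\<close> with weights \<open>d k powr p\<close> adding up to 1. The
  averaged quadratic lower bound contradicts flatness unless \<open>w k\<close> vanishes wherever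
  the weight does not.\<close>

lemma flat_zero:
  assumes p: "0 < p" "p < 2" and rad: "\<And>z. schatten_sum p (M z) = F (cmod z)" and F0: "F 0 = 1"
    and flat: "((\<lambda>r. (F r - 1) / r\<^sup>2) \<longlongrightarrow> 0) (at_right 0)"
  shows "B = 0\<^sub>m n n"
proof -
  have off: "B $$ (k,l) = 0" if "k < n" "l < n" "k \<noteq> l \<or> k \<notin> D" for k l
    by (rule flat_offdiag_zero[OF p rad F0 flat that])
  define w where "w k = B $$ (k,k) / d k" for k
  have Mz: "M z = mat n n (\<lambda>(i,j). if i = j then d i * (1 + z * w i) else 0)" for z
  proof (rule eq_matI)
    fix i j assume "i < dim_row (mat n n (\<lambda>(i,j). if i = j then d i * (1 + z * w i) else 0))"
      "j < dim_col (mat n n (\<lambda>(i,j). if i = j then d i * (1 + z * w i) else 0))"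
    then have ij: "i < n" "j < n" by auto
    show "M z $$ (i,j) = mat n n (\<lambda>(i,j). if i = j then d i * (1 + z * w i) else 0) $$ (i,j)"
    proof (cases "i = j \<and> i \<in> D")
      case True
      then show ?thesis using ij B by (auto simp: M_def w_def D_def field_simps)
    next
      case False
      then have "B $$ (i,j) = 0" using off[OF ij] by auto
      moreover have "i = j \<Longrightarrow> d i = 0" using False ij d[of i] by (auto simp: D_def)
      ultimately show ?thesis using ij B by (auto simp: M_def)
    qed
  qed (use M_carrier[of z] in auto)
  have val: "F (cmod z) = (\<Sum>k<n. d k powr p * cmod (1 + z * w k) powr p)" for z
    unfolding rad[symmetric] Mz schatten_sum_diag using d by (simp add: norm_mult powr_mult)
  obtain c E \<delta> where cE: "c > 0" "E \<ge> 0" "\<delta> > 0"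
    "\<And>w. cmod w \<le> \<delta> \<Longrightarrow> 1 + c * (cmod w)\<^sup>2 - E * cmod w ^ 4 \<le> avg4 (\<lambda>w. cmod (1 + w) powr p) w"
    using avg4_powr_one_plus_lower[OF p(1)] by blast
  define c1 where "c1 = (\<Sum>k<n. d k powr p * (c * (cmod (w k))\<^sup>2))"
  define E1 where "E1 = (\<Sum>k<n. d k powr p * (E * cmod (w k) ^ 4))"
  define N where "N = (\<Sum>k<n. cmod (w k))"
  have N: "N \<ge> 0" by (simp add: N_def sum_nonneg)
  have Nk: "cmod (w k) \<le> N" if "k < n" for k unfolding N_def using that by (intro member_le_sum) auto
  have d0: "(\<Sum>k<n. d k powr p) = 1" using val[of 0] F0 by simp
  have key: "1 + c1 * r\<^sup>2 - E1 * r ^ 4 \<le> F r" if r: "0 < r" "r \<le> \<delta> / (N + 1)" for r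
  proof -
    have "F r = avg4 (\<lambda>z. F (cmod z)) (of_real r)" using r by (subst avg4_const[where c = "F r"]) auto
    also have "\<dots> = (\<Sum>k<n. d k powr p * avg4 (\<lambda>z. cmod (1 + z * w k) powr p) (of_real r))"
      unfolding val by (rule avg4_sum)
    also have "\<dots> \<ge> (\<Sum>k<n. d k powr p * (1 + c * (cmod (w k))\<^sup>2 * r\<^sup>2 - E * cmod (w k) ^ 4 * r ^ 4))"
    proof (intro sum_mono mult_left_mono)
      fix k assume k: "k \<in> {..<n}"
      have "cmod (of_real r * w k) \<le> r * N" using Nk[of k] k r by (simp add: norm_mult mult_left_mono)
      also have "\<dots> \<le> \<delta> / (N + 1) * (N + 1)" using r N by (intro mult_mono) auto
      finally have "cmod (of_real r * w k) \<le> \<delta>" using N by simp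
      from cE(4)[OF this] have "1 + c * (cmod (of_real r * w k))\<^sup>2 - E * cmod (of_real r * w k) ^ 4
         \<le> avg4 (\<lambda>z. cmod (1 + z * w k) powr p) (of_real r)" by (simp add: avg4_def mult.assoc)
      then show "1 + c * (cmod (w k))\<^sup>2 * r\<^sup>2 - E * cmod (w k) ^ 4 * r ^ 4 \<le> avg4 (\<lambda>z. cmod (1 + z * w k) powr p) (of_real r)"
        using r by (simp add: norm_mult power_mult_distrib mult_ac)
    qed simp
    also have "(\<Sum>k<n. d k powr p * (1 + c * (cmod (w k))\<^sup>2 * r\<^sup>2 - E * cmod (w k) ^ 4 * r ^ 4)) = 1 + c1 * r\<^sup>2 - E1 * r ^ 4"
    proof -
      have "(\<Sum>k<n. d k powr p * (1 + c * (cmod (w k))\<^sup>2 * r\<^sup>2 - E * cmod (w k) ^ 4 * r ^ 4))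
        = (\<Sum>k<n. d k powr p + (d k powr p * (c * (cmod (w k))\<^sup>2)) * r\<^sup>2 - (d k powr p * (E * cmod (w k) ^ 4)) * r ^ 4)"
        by (intro sum.cong) (auto simp: algebra_simps)
      then show ?thesis
        by (simp only: sum.distrib sum_subtractf sum_distrib_right[symmetric] c1_def E1_def d0)
    qed
    finally show ?thesis .
  qed
  have "((\<lambda>r. (F r - 1) / r\<^sup>2 + E1 * r\<^sup>2) \<longlongrightarrow> 0 + E1 * 0\<^sup>2) (at_right 0)" by (intro tendsto_intros flat)
  moreover have "eventually (\<lambda>r. c1 \<le> (F r - 1) / r\<^sup>2 + E1 * r\<^sup>2) (at_right 0)"
  proof (rule eventually_at_rightI[of 0 "\<delta> / (N + 1)"])
    fix r assume r: "r \<in> {0<..<\<delta> / (N + 1)}"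
    have "c1 * r\<^sup>2 \<le> F r - 1 + E1 * r ^ 4" using key[of r] r by simp
    then have "c1 * r\<^sup>2 / r\<^sup>2 \<le> (F r - 1 + E1 * r ^ 4) / r\<^sup>2" by (intro divide_right_mono) auto
    then show "c1 \<le> (F r - 1) / r\<^sup>2 + E1 * r\<^sup>2"
      using r unfolding add_divide_distrib by (simp add: power4_eq_xxxx power2_eq_square)
  qed (use cE N in simp)
  ultimately have "c1 \<le> 0 + E1 * 0\<^sup>2" by (intro tendsto_lowerbound) auto
  then have c1: "c1 \<le> 0" by simp
  have nn: "0 \<le> d k powr p * (c * (cmod (w k))\<^sup>2)" for k using cE by simp
  have c10: "c1 = 0" using c1 nn unfolding c1_def by (intro antisym sum_nonneg) auto
  have wz: "d k powr p * (c * (cmod (w k))\<^sup>2) = 0" if "k < n" for k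
    using c10 nn that unfolding c1_def by (subst (asm) sum_nonneg_eq_0_iff) auto
  show ?thesis
  proof (rule eq_matI)
    fix k l assume "k < dim_row (0\<^sub>m n n)" "l < dim_col (0\<^sub>m n n)"
    then have kl: "k < n" "l < n" by auto
    show "B $$ (k,l) = 0\<^sub>m n n $$ (k,l)"
    proof (cases "k = l \<and> k \<in> D")
      case True
      then have "d k \<noteq> 0" by (auto simp: D_def)
      then have "w k = 0" using wz[OF kl(1)] cE by auto
      then show ?thesis using True kl \<open>d k \<noteq> 0\<close> by (simp add: w_def)
    next
      case False
      then show ?thesis using off[OF kl] kl by auto
    qed
  qed (use B in auto)
qed

end

section \<open>Exponents at least 2\<close>

lemma powr_tangent:
  fixes m y s :: real
  assumes s: "s \<ge> 1" and m: "m > 0" and y: "y \<ge> 0"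
  shows "m powr s + s * m powr (s - 1) * (y - m) \<le> y powr s"
proof (cases "y = 0")
  \<comment> \<open>The convexity argument works on the open half line only; at its end point the
    claim reduces to \<open>s \<ge> 1\<close>.\<close>
  case True
  have "m powr (s - 1) * m = m powr s" using m by (simp add: powr_diff)
  then have "s * m powr (s - 1) * (y - m) = - (m powr s * s)" using True by (simp add: mult.assoc mult.left_commute)
  moreover have "m powr s * 1 \<le> m powr s * s" using s by (intro mult_left_mono) auto
  moreover have "0 \<le> y powr s" by simp
  ultimately show ?thesis by linarith
next
  case False
  have "s * m powr (s - 1) * (y - m) \<le> y powr s - m powr s"
  proof (rule convex_on_imp_above_tangent)
    show "convex_on {0<..} (\<lambda>x::real. x powr s)" by (rule powr_convex) (use s in auto)
    show "((\<lambda>x. x powr s) has_real_derivative s * m powr (s - 1)) (at m within {0<..})"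
      using m by (auto intro!: derivative_eq_intros)
  qed (use m y False in \<open>auto simp: interior_open\<close>)
  then show ?thesis by simp
qed

lemma powr_jensen:
  fixes w y :: "'a \<Rightarrow> real"
  assumes s: "s \<ge> 1" and fin: "finite A" and w: "\<And>i. i \<in> A \<Longrightarrow> w i \<ge> 0" "(\<Sum>i\<in>A. w i) = 1"
    and y: "\<And>i. i \<in> A \<Longrightarrow> y i \<ge> 0"
  shows "(\<Sum>i\<in>A. w i * y i) powr s \<le> (\<Sum>i\<in>A. w i * y i powr s)"
proof (cases "(\<Sum>i\<in>A. w i * y i) = 0")
  case True
  then show ?thesis using w by (simp add: sum_nonneg)
next
  case False
  define m where "m = (\<Sum>i\<in>A. w i * y i)"
  have "m \<ge> 0" unfolding m_def using w y by (intro sum_nonneg) auto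
  then have m: "m > 0" using False by (simp add: m_def)
  have "m powr s = (\<Sum>i\<in>A. w i * (m powr s + s * m powr (s - 1) * (y i - m)))"
  proof -
    have "(\<Sum>i\<in>A. w i * (m powr s + s * m powr (s - 1) * (y i - m)))
      = (\<Sum>i\<in>A. w i) * m powr s + s * m powr (s - 1) * ((\<Sum>i\<in>A. w i * y i) - (\<Sum>i\<in>A. w i) * m)"
      by (simp add: sum_distrib_left sum_distrib_right sum.distrib sum_subtractf algebra_simps)
    then show ?thesis using w(2) by (simp add: m_def)
  qed
  also have "\<dots> \<le> (\<Sum>i\<in>A. w i * y i powr s)"
    using powr_tangent[OF s m] w y by (intro sum_mono mult_left_mono) auto
  finally show ?thesis by (simp add: m_def)
qed

text \<open>The first bound combines the tangent inequality with the Lipschitz bound for the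
  derivative on the interval up to \<open>L\<close>. The second is the same bound for the even
  extension at \<open>- y\<close>; it follows because
  \<open>p * d powr (p - 1) \<le> 2 * K * d\<close>.\<close>

lemma powr_quadratic_upper:
  fixes p L d y :: real
  assumes p: "p \<ge> 2" and d: "0 \<le> d" "d \<le> L" and y: "0 \<le> y" "y \<le> L" and L: "L > 0"
  defines "K \<equiv> p * (p - 1) * L powr (p - 2)"
  shows "y powr p \<le> d powr p + p * d powr (p - 1) * (y - d) + K * (y - d)\<^sup>2"
    "y powr p \<le> d powr p + p * d powr (p - 1) * (- y - d) + K * (- y - d)\<^sup>2"
proof -
  have lip: "b powr (p - 1) - a powr (p - 1) \<le> (p - 1) * L powr (p - 2) * (b - a)" if ab: "0 \<le> a" "a \<le> b" "b \<le> L" for a b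
  proof (cases "b = 0")
    case False
    then have b: "b > 0" using ab by simp
    have "b powr (p - 1) - a powr (p - 1) \<le> (p - 1) * b powr (p - 2) * (b - a)"
      using powr_tangent[of "p - 1" b a] p b ab by (simp add: algebra_simps)
    also have "\<dots> \<le> (p - 1) * L powr (p - 2) * (b - a)"
      using p ab by (intro mult_right_mono mult_left_mono powr_mono2) auto
    finally show ?thesis .
  qed (use ab in simp)
  show 1: "y powr p \<le> d powr p + p * d powr (p - 1) * (y - d) + K * (y - d)\<^sup>2"
  proof (cases "y = 0 \<and> d = 0")
    case False
    have a: "y powr p \<le> d powr p + p * y powr (p - 1) * (y - d)"
    proof (cases "y = 0")
      case False
      then show ?thesis using powr_tangent[of p y d] p y d by (simp add: algebra_simps)
    qed simp
    have "(y powr (p - 1) - d powr (p - 1)) * (y - d) \<le> (p - 1) * L powr (p - 2) * (y - d)\<^sup>2"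
    proof (cases "d \<le> y")
      case True
      then have "(y powr (p - 1) - d powr (p - 1)) * (y - d) \<le> (p - 1) * L powr (p - 2) * (y - d) * (y - d)"
        using lip[of d y] d y by (intro mult_right_mono) auto
      then show ?thesis by (simp add: power2_eq_square mult_ac)
    next
      case False
      then have "(d powr (p - 1) - y powr (p - 1)) * (d - y) \<le> (p - 1) * L powr (p - 2) * (d - y) * (d - y)"
        using lip[of y d] d y by (intro mult_right_mono) auto
      then show ?thesis by (simp add: power2_eq_square algebra_simps)
    qed
    then have "p * ((y powr (p - 1) - d powr (p - 1)) * (y - d)) \<le> p * ((p - 1) * L powr (p - 2) * (y - d)\<^sup>2)"
      using p by (intro mult_left_mono) auto
    then show ?thesis using a by (simp add: K_def algebra_simps)
  qed simp
  have "p * d powr (p - 1) * y \<le> 2 * K * (d * y)"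
  proof (cases "d = 0")
    case False
    then have dp: "d > 0" using d by simp
    have "p * 1 \<le> p * (2 * (p - 1))" using p by (intro mult_left_mono) auto
    then have pp: "p \<le> 2 * (p * (p - 1))" by (simp add: algebra_simps)
    have "d powr (p - 1) = d powr (p - 2 + 1)" by simp
    also have "\<dots> = d powr (p - 2) * d" using dp unfolding powr_add by simp
    finally have "d powr (p - 1) = d powr (p - 2) * d" .
    moreover have "d powr (p - 2) \<le> L powr (p - 2)" using p d by (intro powr_mono2) auto
    ultimately have "d powr (p - 1) \<le> L powr (p - 2) * d" using d by (simp add: mult_right_mono)
    then have "p * d powr (p - 1) \<le> 2 * (p * (p - 1)) * (L powr (p - 2) * d)"
      using pp p by (intro mult_mono) auto
    then have "p * d powr (p - 1) * y \<le> 2 * (p * (p - 1)) * (L powr (p - 2) * d) * y"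
      using y by (intro mult_right_mono) auto
    then show ?thesis unfolding K_def by (simp only: mult_ac)
  qed simp
  then show "y powr p \<le> d powr p + p * d powr (p - 1) * (- y - d) + K * (- y - d)\<^sup>2"
    using 1 by (simp add: power2_eq_square algebra_simps)
qed

text \<open>Both sides are the diagonal entry \<open>(i,i)\<close> of the Gram matrix. As the rows
  of \<open>V\<close> are unit vectors, a squared column norm is a weighted mean of the squared
  singular values.\<close>

lemma col_norm_svd:
  assumes U: "unitary n U" and V: "unitary n V" and A: "A = U * diag_real n s * mat_adjoint V" and i: "i < n"
  shows "(\<Sum>k<n. (cmod (A $$ (k,i)))\<^sup>2) = (\<Sum>k<n. (cmod (V $$ (i,k)))\<^sup>2 * (s k)\<^sup>2)"
proof -
  have Vc: "V \<in> carrier_mat n n" and Uc: "U \<in> carrier_mat n n" using U V by auto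
  have Ac: "A \<in> carrier_mat n n" unfolding A using Uc Vc by simp
  have "(mat_adjoint A * A) $$ (i,i) = (\<Sum>k<n. mat_adjoint A $$ (i,k) * A $$ (k,i))"
    by (rule index_mat_mult_sum[OF mat_adjoint_carrier[OF Ac] Ac i i])
  also have "\<dots> = complex_of_real (\<Sum>k<n. (cmod (A $$ (k,i)))\<^sup>2)"
    using Ac i by (simp add: complex_norm_square mult.commute del: of_real_power)
  finally have 1: "(mat_adjoint A * A) $$ (i,i) = complex_of_real (\<Sum>k<n. (cmod (A $$ (k,i)))\<^sup>2)" .
  have "(mat_adjoint A * A) $$ (i,i) = (\<Sum>k<n. V $$ (i,k) * complex_of_real ((s k)\<^sup>2) * cnj (V $$ (i,k)))"
    unfolding gram_svd[OF U V A] by (rule index_svd[OF Vc Vc i i])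
  also have "\<dots> = complex_of_real (\<Sum>k<n. (cmod (V $$ (i,k)))\<^sup>2 * (s k)\<^sup>2)"
    unfolding of_real_sum
    by (intro sum.cong) (auto simp: complex_norm_square mult_ac simp del: of_real_power)
  finally show ?thesis unfolding 1 by (simp only: of_real_eq_iff)
qed

lemma frobenius_svd:
  assumes U: "unitary n U" and V: "unitary n V" and A: "A = U * diag_real n s * mat_adjoint V"
  shows "(\<Sum>i<n. \<Sum>k<n. (cmod (A $$ (k,i)))\<^sup>2) = (\<Sum>k<n. (s k)\<^sup>2)"
proof -
  have "(\<Sum>i<n. \<Sum>k<n. (cmod (A $$ (k,i)))\<^sup>2) = (\<Sum>i<n. \<Sum>k<n. (cmod (V $$ (i,k)))\<^sup>2 * (s k)\<^sup>2)"
    by (rule sum.cong[OF refl], rule col_norm_svd[OF U V A]) simp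
  also have "\<dots> = (\<Sum>k<n. (\<Sum>i<n. (cmod (V $$ (i,k)))\<^sup>2) * (s k)\<^sup>2)"
    unfolding sum_distrib_right by (rule sum.swap)
  also have "\<dots> = (\<Sum>k<n. (s k)\<^sup>2)" using unitary_col_sq[OF V] by (intro sum.cong) auto
  finally show ?thesis .
qed

text \<open>Jensen for the convex power \<open>p / 2 \<ge> 1\<close> in each column, then summation;
  the weights \<open>|V $$ (i,k)|^2\<close> form a doubly stochastic matrix, so every singular value
  is counted once.\<close>

lemma schatten_sum_ge_cols:
  assumes A: "A \<in> carrier_mat n n" and p: "p \<ge> 2"
  shows "(\<Sum>i<n. (\<Sum>k<n. (cmod (A $$ (k,i)))\<^sup>2) powr (p / 2)) \<le> schatten_sum p A"
proof -
  obtain U V s where U: "unitary n U" and V: "unitary n V" and s: "\<And>i. 0 \<le> s i"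
    and svd: "A = U * diag_real n s * mat_adjoint V" using svd_exists[OF A] by blast
  have "(\<Sum>i<n. (\<Sum>k<n. (cmod (A $$ (k,i)))\<^sup>2) powr (p / 2))
    \<le> (\<Sum>i<n. \<Sum>k<n. (cmod (V $$ (i,k)))\<^sup>2 * ((s k)\<^sup>2) powr (p / 2))"
  proof (rule sum_mono)
    fix i assume "i \<in> {..<n}"
    then have i: "i < n" by simp
    show "(\<Sum>k<n. (cmod (A $$ (k,i)))\<^sup>2) powr (p / 2) \<le> (\<Sum>k<n. (cmod (V $$ (i,k)))\<^sup>2 * ((s k)\<^sup>2) powr (p / 2))"
      unfolding col_norm_svd[OF U V svd i]
      by (rule powr_jensen) (use p unitary_row_sq[OF V i] in auto)
  qed
  also have "\<dots> = (\<Sum>k<n. (\<Sum>i<n. (cmod (V $$ (i,k)))\<^sup>2) * ((s k)\<^sup>2) powr (p / 2))"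
    unfolding sum_distrib_right by (rule sum.swap)
  also have "\<dots> = (\<Sum>k<n. s k powr p)"
  proof (intro sum.cong refl)
    fix k assume k: "k \<in> {..<n}"
    have "((s k)\<^sup>2) powr (p / 2) = s k powr p"
      using s[of k] by (cases "s k = 0") (auto simp: powr_powr simp flip: powr_numeral)
    then show "(\<Sum>i<n. (cmod (V $$ (i,k)))\<^sup>2) * ((s k)\<^sup>2) powr (p / 2) = s k powr p"
      using unitary_col_sq[OF V] k by simp
  qed
  also have "\<dots> = schatten_sum p A" unfolding svd by (rule schatten_sum_svd[OF U V s, symmetric])
  finally show ?thesis .
qed

lemma schatten_sum_adjoint:
  assumes A: "A \<in> carrier_mat n n"
  shows "schatten_sum p (mat_adjoint A) = schatten_sum p A"
proof -
  obtain U V s where U: "unitary n U" and V: "unitary n V" and s: "\<And>i. 0 \<le> s i"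
    and svd: "A = U * diag_real n s * mat_adjoint V" using svd_exists[OF A] by blast
  have Vc: "V \<in> carrier_mat n n" and Uc: "U \<in> carrier_mat n n" using U V by auto
  have "mat_adjoint A = V * diag_real n s * mat_adjoint U"
  proof (rule eq_matI)
    fix i j assume "i < dim_row (V * diag_real n s * mat_adjoint U)" "j < dim_col (V * diag_real n s * mat_adjoint U)"
    then have ij: "i < n" "j < n" using Uc Vc by auto
    have "mat_adjoint A $$ (i,j) = cnj (A $$ (j,i))" using A ij by simp
    also have "\<dots> = (\<Sum>k<n. V $$ (i,k) * s k * cnj (U $$ (j,k)))"
      unfolding svd index_svd[OF Uc Vc ij(2,1)] by (simp add: mult_ac)
    also have "\<dots> = (V * diag_real n s * mat_adjoint U) $$ (i,j)"
      by (rule index_svd[OF Vc Uc ij, symmetric])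
    finally show "mat_adjoint A $$ (i,j) = (V * diag_real n s * mat_adjoint U) $$ (i,j)" .
  qed (use A Uc Vc in auto)
  then have "schatten_sum p (mat_adjoint A) = (\<Sum>k<n. s k powr p)" using schatten_sum_svd[OF V U s] by simp
  then show ?thesis using schatten_sum_svd[OF U V s, of p] svd by simp
qed

text \<open>The weights \<open>|U \<plusminus> V|^2 / 4\<close> on the points \<open>\<plusminus> s k\<close> are those of the Hermitian dilation of \<open>A\<close>, whose eigenvalues
  are the singular values with both signs; hence the second inequality in \<open>powr_quadratic_upper\<close>.\<close>

lemma schatten_sum_upper:
  assumes A: "A \<in> carrier_mat n n" and p: "p \<ge> 2" and L: "L > 0" and d: "\<And>i. i < n \<Longrightarrow> 0 \<le> d i \<and> d i \<le> L"
    and b: "schatten_sum p A \<le> L powr p"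
  shows "schatten_sum p A \<le> (\<Sum>i<n. d i powr p + p * d i powr (p - 1) * (Re (A $$ (i,i)) - d i)) +
    p * (p - 1) * L powr (p - 2) * ((\<Sum>i<n. \<Sum>k<n. (cmod (A $$ (k,i)))\<^sup>2) - 2 * (\<Sum>i<n. d i * Re (A $$ (i,i))) + (\<Sum>i<n. (d i)\<^sup>2))"
proof -
  obtain U V s where U: "unitary n U" and V: "unitary n V" and s: "\<And>i. 0 \<le> s i"
    and svd: "A = U * diag_real n s * mat_adjoint V" using svd_exists[OF A] by blast
  have Vc: "V \<in> carrier_mat n n" and Uc: "U \<in> carrier_mat n n" using U V by auto
  define K where "K = p * (p - 1) * L powr (p - 2)"
  have sum_s: "schatten_sum p A = (\<Sum>k<n. s k powr p)" using schatten_sum_svd[OF U V s, of p] svd by simp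
  have sL: "s k \<le> L" if "k < n" for k
  proof -
    have "s k powr p \<le> (\<Sum>k<n. s k powr p)" using that by (intro member_le_sum) auto
    then have "s k powr p \<le> L powr p" using b sum_s by simp
    then show ?thesis using p L s[of k] by (metis not_less powr_less_mono2 less_le_trans zero_less_numeral less_eq_real_def)
  qed
  define w where "w i k = ((cmod (U $$ (i,k)))\<^sup>2 + (cmod (V $$ (i,k)))\<^sup>2) / 2" for i k
  define x where "x i k = Re (U $$ (i,k) * cnj (V $$ (i,k)))" for i k
  \<comment> \<open>The weights \<open>(w i k \<plusminus> x i k) / 2\<close> on the points
    \<open>\<plusminus> s k\<close> are nonnegative by these identities, and their first moment in
    row \<open>i\<close> is \<open>Re (A $$ (i,i))\<close>.\<close>
  have wp: "w i k + x i k = (cmod (U $$ (i,k) + V $$ (i,k)))\<^sup>2 / 2" for i k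
    unfolding w_def x_def cmod_power2 by (simp add: power2_eq_square algebra_simps add_divide_distrib)
  have wm: "w i k - x i k = (cmod (U $$ (i,k) - V $$ (i,k)))\<^sup>2 / 2" for i k
    unfolding w_def x_def cmod_power2 by (simp add: power2_eq_square algebra_simps add_divide_distrib)
  have row: "(\<Sum>k<n. w i k) = 1" if "i < n" for i
    using unitary_row_sq[OF U that] unitary_row_sq[OF V that] unfolding w_def sum_divide_distrib[symmetric] sum.distrib by simp
  have col: "(\<Sum>i<n. w i k) = 1" if "k < n" for k
    using unitary_col_sq[OF U that] unitary_col_sq[OF V that] unfolding w_def sum_divide_distrib[symmetric] sum.distrib by simp
  have xs: "(\<Sum>k<n. x i k * s k) = Re (A $$ (i,i))" if "i < n" for i
    unfolding svd index_svd[OF Uc Vc that that] Re_sum x_def by (intro sum.cong) (auto simp: algebra_simps)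
  have el: "w i k * s k powr p \<le> w i k * (d i powr p - p * d i powr (p - 1) * d i + K * (d i)\<^sup>2 + K * (s k)\<^sup>2) + (p * d i powr (p - 1) - 2 * K * d i) * (x i k * s k)"
    if ik: "i < n" "k < n" for i k
  proof -
    have q: "s k powr p \<le> d i powr p + p * d i powr (p - 1) * (s k - d i) + K * (s k - d i)\<^sup>2"
      "s k powr p \<le> d i powr p + p * d i powr (p - 1) * (- s k - d i) + K * (- s k - d i)\<^sup>2"
      unfolding K_def using powr_quadratic_upper[OF p _ _ s[of k] sL[OF ik(2)] L] d[OF ik(1)] by auto
    have "(w i k + x i k) / 2 * s k powr p \<le> (w i k + x i k) / 2 * (d i powr p + p * d i powr (p - 1) * (s k - d i) + K * (s k - d i)\<^sup>2)"
      unfolding wp by (intro mult_left_mono q) auto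
    moreover have "(w i k - x i k) / 2 * s k powr p \<le> (w i k - x i k) / 2 * (d i powr p + p * d i powr (p - 1) * (- s k - d i) + K * (- s k - d i)\<^sup>2)"
      unfolding wm by (intro mult_left_mono q) auto
    moreover have "w i k * s k powr p = (w i k + x i k) / 2 * s k powr p + (w i k - x i k) / 2 * s k powr p"
      by (simp add: field_simps)
    moreover have "(w i k + x i k) / 2 * (d i powr p + p * d i powr (p - 1) * (s k - d i) + K * (s k - d i)\<^sup>2)
      + (w i k - x i k) / 2 * (d i powr p + p * d i powr (p - 1) * (- s k - d i) + K * (- s k - d i)\<^sup>2)
      = w i k * (d i powr p - p * d i powr (p - 1) * d i + K * (d i)\<^sup>2 + K * (s k)\<^sup>2) + (p * d i powr (p - 1) - 2 * K * d i) * (x i k * s k)"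
      by (simp add: field_simps power2_eq_square)
    ultimately show ?thesis by linarith
  qed
  have "schatten_sum p A = (\<Sum>k<n. (\<Sum>i<n. w i k) * s k powr p)" unfolding sum_s using col by (intro sum.cong) auto
  also have "\<dots> = (\<Sum>i<n. \<Sum>k<n. w i k * s k powr p)" unfolding sum_distrib_right by (rule sum.swap)
  also have "\<dots> \<le> (\<Sum>i<n. \<Sum>k<n. w i k * (d i powr p - p * d i powr (p - 1) * d i + K * (d i)\<^sup>2 + K * (s k)\<^sup>2) + (p * d i powr (p - 1) - 2 * K * d i) * (x i k * s k))"
    using el by (intro sum_mono) auto
  also have "\<dots> = (\<Sum>i<n. (d i powr p - p * d i powr (p - 1) * d i + K * (d i)\<^sup>2) + K * (\<Sum>k<n. w i k * (s k)\<^sup>2) + (p * d i powr (p - 1) - 2 * K * d i) * Re (A $$ (i,i)))"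
  proof (intro sum.cong refl)
    fix i assume "i \<in> {..<n}"
    then have i: "i < n" by simp
    have "(\<Sum>k<n. w i k * (d i powr p - p * d i powr (p - 1) * d i + K * (d i)\<^sup>2 + K * (s k)\<^sup>2) + (p * d i powr (p - 1) - 2 * K * d i) * (x i k * s k))
      = (\<Sum>k<n. w i k) * (d i powr p - p * d i powr (p - 1) * d i + K * (d i)\<^sup>2) + K * (\<Sum>k<n. w i k * (s k)\<^sup>2) + (p * d i powr (p - 1) - 2 * K * d i) * (\<Sum>k<n. x i k * s k)"
      unfolding sum_distrib_left sum_distrib_right sum.distrib[symmetric] by (intro sum.cong) (auto simp: algebra_simps)
    then show "(\<Sum>k<n. w i k * (d i powr p - p * d i powr (p - 1) * d i + K * (d i)\<^sup>2 + K * (s k)\<^sup>2) + (p * d i powr (p - 1) - 2 * K * d i) * (x i k * s k))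
      = (d i powr p - p * d i powr (p - 1) * d i + K * (d i)\<^sup>2) + K * (\<Sum>k<n. w i k * (s k)\<^sup>2) + (p * d i powr (p - 1) - 2 * K * d i) * Re (A $$ (i,i))"
      using row[OF i] xs[OF i] by simp
  qed
  also have "\<dots> = (\<Sum>i<n. d i powr p + p * d i powr (p - 1) * (Re (A $$ (i,i)) - d i)) + K * ((\<Sum>i<n. \<Sum>k<n. w i k * (s k)\<^sup>2) - 2 * (\<Sum>i<n. d i * Re (A $$ (i,i))) + (\<Sum>i<n. (d i)\<^sup>2))"
    by (simp only: sum_distrib_left sum.distrib[symmetric] sum_subtractf[symmetric] distrib_left right_diff_distrib)
      (intro sum.cong, auto simp: algebra_simps)
  \<comment> \<open>Since the columns of \<open>w\<close> also sum to 1, the total second moment is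
    the squared Frobenius norm, which is explicit in the entries.\<close>
  also have "(\<Sum>i<n. \<Sum>k<n. w i k * (s k)\<^sup>2) = (\<Sum>k<n. (\<Sum>i<n. w i k) * (s k)\<^sup>2)"
    unfolding sum_distrib_right by (rule sum.swap)
  also have "\<dots> = (\<Sum>k<n. (s k)\<^sup>2)" using col by (intro sum.cong) auto
  also have "\<dots> = (\<Sum>i<n. \<Sum>k<n. (cmod (A $$ (k,i)))\<^sup>2)" by (rule frobenius_svd[OF U V svd, symmetric])
  finally show ?thesis by (simp add: K_def)
qed

text \<open>The matrix identity \<open>(z - X) (z - Y) = z (z - X - Y)\<close>, valid because
  \<open>X * Y = 0\<close>, followed by determinants.\<close>

lemma char_poly_orthogonal_sum:
  assumes Y: "Y \<in> carrier_mat n n" and xY: "\<And>i j. i < n \<Longrightarrow> j < n \<Longrightarrow> complex_of_real (x i) * Y $$ (i,j) = 0"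
  shows "char_poly (diag_real n x) * char_poly Y = [:0, 1:] ^ n * char_poly (diag_real n x + Y)"
proof -
  let ?X = "diag_real n x"
  have c: "char_poly_matrix ?X \<in> carrier_mat n n" "char_poly_matrix Y \<in> carrier_mat n n" "?X + Y \<in> carrier_mat n n"
    using Y by auto
  have e: "char_poly_matrix Z $$ (i,j) = (if i = j then [:0, 1:] else 0) + [:- (Z $$ (i,j)):]"
    if "Z \<in> carrier_mat n n" "i < n" "j < n" for Z i j
    using that by (auto simp: char_poly_matrix_def)
  have "char_poly_matrix ?X * char_poly_matrix Y = [:0, 1:] \<cdot>\<^sub>m char_poly_matrix (?X + Y)"
  proof (rule eq_matI)
    fix i j assume "i < dim_row ([:0, 1:] \<cdot>\<^sub>m char_poly_matrix (?X + Y))" "j < dim_col ([:0, 1:] \<cdot>\<^sub>m char_poly_matrix (?X + Y))"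
    then have ij: "i < n" "j < n" using Y by (auto simp: char_poly_matrix_def)
    have "(char_poly_matrix ?X * char_poly_matrix Y) $$ (i,j) = (\<Sum>k<n. char_poly_matrix ?X $$ (i,k) * char_poly_matrix Y $$ (k,j))"
      by (rule index_mat_mult_sum[OF c(1,2) ij])
    also have "\<dots> = (\<Sum>k<n. if k = i then [:- complex_of_real (x i), 1:] * char_poly_matrix Y $$ (i,j) else 0)"
      by (intro sum.cong) (use ij in \<open>auto simp: e[OF diag_real_carrier]\<close>)
    also have "\<dots> = [:- complex_of_real (x i), 1:] * char_poly_matrix Y $$ (i,j)" using ij by simp
    also have "\<dots> = [:0, 1:] * char_poly_matrix (?X + Y) $$ (i,j)"
      using ij xY[OF ij] Y by (auto simp: e[OF Y] e[OF c(3)])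
    also have "\<dots> = ([:0, 1:] \<cdot>\<^sub>m char_poly_matrix (?X + Y)) $$ (i,j)"
      using ij char_poly_matrix_closed[OF c(3)] by (subst index_smult_mat) auto
    finally show "(char_poly_matrix ?X * char_poly_matrix Y) $$ (i,j) = ([:0, 1:] \<cdot>\<^sub>m char_poly_matrix (?X + Y)) $$ (i,j)" .
  qed (use c in \<open>auto simp: char_poly_matrix_def\<close>)
  then have "det (char_poly_matrix ?X * char_poly_matrix Y) = det ([:0, 1:] \<cdot>\<^sub>m char_poly_matrix (?X + Y))" by simp
  then show ?thesis
    unfolding char_poly_def det_mult[OF c(1,2)] det_smult using char_poly_matrix_closed[OF c(3)] by (simp add: carrier_matD)
qed

text \<open>The Gram matrix of the sum is the sum of the Gram matrices, whose product is zero; so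
  their nonzero eigenvalues are united with multiplicity. The \<open>n\<close> surplus zero roots
  are invisible as \<open>0 powr p = 0\<close>.\<close>

lemma schatten_sum_orthogonal:
  assumes B: "B \<in> carrier_mat n n"
    and row: "\<And>i k. i < n \<Longrightarrow> k < n \<Longrightarrow> d i \<noteq> 0 \<Longrightarrow> B $$ (i,k) = 0"
    and col: "\<And>i k. i < n \<Longrightarrow> k < n \<Longrightarrow> d i \<noteq> 0 \<Longrightarrow> B $$ (k,i) = 0"
  shows "schatten_sum p (diag_real n d + B) = schatten_sum p (diag_real n d) + schatten_sum p B"
proof -
  let ?A = "diag_real n d"
  let ?X = "diag_real n (\<lambda>i. d i * d i)"
  define Y where "Y = mat_adjoint B * B"
  have Yc: "Y \<in> carrier_mat n n" unfolding Y_def by (rule mult_carrier_mat[OF mat_adjoint_carrier[OF B] B])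
  have ABc: "?A + B \<in> carrier_mat n n" using B by simp
  have XA: "mat_adjoint ?A * ?A = ?X" by (simp add: diag_real_mult)
  have Yi: "Y $$ (i,j) = (\<Sum>k<n. cnj (B $$ (k,i)) * B $$ (k,j))" if "i < n" "j < n" for i j
  proof -
    have "Y $$ (i,j) = (\<Sum>k<n. mat_adjoint B $$ (i,k) * B $$ (k,j))"
      unfolding Y_def by (rule index_mat_mult_sum[OF mat_adjoint_carrier[OF B] B that])
    then show ?thesis using B that by simp
  qed
  have "mat_adjoint (?A + B) * (?A + B) = ?X + Y"
  proof (rule eq_matI)
    fix i j assume "i < dim_row (?X + Y)" "j < dim_col (?X + Y)"
    then have ij: "i < n" "j < n" using Yc by auto
    have "(mat_adjoint (?A + B) * (?A + B)) $$ (i,j) = (\<Sum>k<n. mat_adjoint (?A + B) $$ (i,k) * (?A + B) $$ (k,j))"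
      by (rule index_mat_mult_sum[OF mat_adjoint_carrier[OF ABc] ABc ij])
    also have "\<dots> = (\<Sum>k<n. cnj (B $$ (k,i)) * B $$ (k,j) + (if k = i then (if i = j then complex_of_real (d i * d i) else 0) else 0))"
    proof (intro sum.cong refl)
      fix k assume "k \<in> {..<n}"
      then have k: "k < n" by simp
      have "complex_of_real (d k) * B $$ (k,j) = 0" "cnj (B $$ (k,i)) * complex_of_real (d k) = 0"
        using row[OF k ij(2)] row[OF k ij(1)] by auto
      then show "mat_adjoint (?A + B) $$ (i,k) * (?A + B) $$ (k,j)
        = cnj (B $$ (k,i)) * B $$ (k,j) + (if k = i then (if i = j then complex_of_real (d i * d i) else 0) else 0)"
        using ij k B by (auto simp: algebra_simps)
    qed
    also have "\<dots> = (\<Sum>k<n. cnj (B $$ (k,i)) * B $$ (k,j)) + (if i = j then complex_of_real (d i * d i) else 0)"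
      using ij by (simp add: sum.distrib)
    finally show "(mat_adjoint (?A + B) * (?A + B)) $$ (i,j) = (?X + Y) $$ (i,j)"
      using ij Yi[OF ij] Yc by (simp add: add.commute)
  qed (use B Yc in auto)
  moreover have "char_poly ?X * char_poly Y = [:0, 1:] ^ n * char_poly (?X + Y)"
  proof (rule char_poly_orthogonal_sum[OF Yc])
    fix i j assume ij: "i < n" "j < n"
    show "complex_of_real (d i * d i) * Y $$ (i,j) = 0"
      using col[OF ij(1)] by (cases "d i = 0") (auto simp: Yi[OF ij])
  qed
  ultimately have cp: "char_poly ?X * char_poly Y = [:0, 1:] ^ n * char_poly (mat_adjoint (?A + B) * (?A + B))" by simp
  have nz: "char_poly Z \<noteq> 0" if "Z \<in> carrier_mat n n" for Z :: "complex mat"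
    using degree_monic_char_poly[OF that] by auto
  have nzAB: "char_poly (mat_adjoint (?A + B) * (?A + B)) \<noteq> 0"
    by (rule nz[OF mult_carrier_mat[OF mat_adjoint_carrier[OF ABc] ABc]])
  have "proots (char_poly ?X) + proots (char_poly Y) = proots ([:0, 1:] ^ n) + proots (char_poly (mat_adjoint (?A + B) * (?A + B)))"
    using arg_cong[OF cp, of proots] nz[OF diag_real_carrier] nz[OF Yc] nzAB by (simp add: proots_mult)
  then have "(\<Sum>x\<in>#proots (char_poly ?X) + proots (char_poly Y). sqrt (Re x) powr p)
    = (\<Sum>x\<in>#proots ([:0, 1:] ^ n) + proots (char_poly (mat_adjoint (?A + B) * (?A + B))). sqrt (Re x) powr p)" by simp
  moreover have "(\<Sum>x\<in>#proots ([:0, 1:: complex:] ^ n). sqrt (Re x) powr p) = 0"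
  proof -
    have "x = 0" if "x \<in># proots ([:0, 1:: complex:] ^ n)" for x using that by simp
    then have "image_mset (\<lambda>x. sqrt (Re x) powr p) (proots ([:0, 1:: complex:] ^ n)) = image_mset (\<lambda>_. 0) (proots ([:0, 1:: complex:] ^ n))"
      by (intro image_mset_cong) (metis powr_0 real_sqrt_zero zero_complex.sel(1))
    then show ?thesis by simp
  qed
  ultimately show ?thesis
    unfolding schatten_sum_def singular_values_def XA Y_def by (simp add: multiset.map_comp o_def)
qed
lemma powr_midpoint:
  fixes x y s :: real
  assumes "s \<ge> 1" "x \<ge> 0" "y \<ge> 0"
  shows "2 * ((x + y) / 2) powr s \<le> x powr s + y powr s"
proof -
  have "(\<Sum>b\<in>{True, False}. 1 / 2 * (if b then x else y)) powr s \<le> (\<Sum>b\<in>{True, False}. 1 / 2 * (if b then x else y) powr s)"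
    by (rule powr_jensen) (use assms in auto)
  then show ?thesis by (simp add: add_divide_distrib)
qed

context diag_pencil
begin

lemma col_norm_M:
  assumes i: "i < n"
  shows "(\<Sum>k<n. (cmod (M z $$ (k,i)))\<^sup>2) = (d i)\<^sup>2 + 2 * d i * Re (z * B $$ (i,i)) + (cmod z)\<^sup>2 * (\<Sum>k<n. (cmod (B $$ (k,i)))\<^sup>2)"
proof -
  have "(\<Sum>k<n. (cmod (M z $$ (k,i)))\<^sup>2)
    = (\<Sum>k<n. (if k = i then (d i)\<^sup>2 + 2 * d i * Re (z * B $$ (i,i)) else 0) + (cmod z)\<^sup>2 * (cmod (B $$ (k,i)))\<^sup>2)"
  proof (intro sum.cong refl)
    fix k assume "k \<in> {..<n}"
    then have k: "k < n" by simp
    have "(cmod (complex_of_real (d i) + w))\<^sup>2 = (d i)\<^sup>2 + 2 * d i * Re w + (cmod w)\<^sup>2" for w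
      unfolding cmod_power2 by (simp add: power2_eq_square algebra_simps)
    from this[of "z * B $$ (i,i)"]
    show "(cmod (M z $$ (k,i)))\<^sup>2 = (if k = i then (d i)\<^sup>2 + 2 * d i * Re (z * B $$ (i,i)) else 0) + (cmod z)\<^sup>2 * (cmod (B $$ (k,i)))\<^sup>2"
      using i k B by (auto simp: M_def norm_mult power_mult_distrib)
  qed
  then show ?thesis using i by (simp add: sum.distrib sum_distrib_left)
qed

text \<open>Averaging over \<open>r\<close> and \<open>- r\<close> removes the linear term of the
  squared column norms; convexity then bounds \<open>F r\<close> below by 1 plus \<open>r^2\<close>
  times the sum of the \<open>q i\<close>, each a positive multiple of the squared norm of column
  \<open>i\<close> of \<open>B\<close>. Flatness forces that sum to be 0.\<close>

lemma flat_col_zero: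
  assumes p: "p \<ge> 2" and rad: "\<And>z. schatten_sum p (M z) = F (cmod z)" and F0: "F 0 = 1"
    and flat: "((\<lambda>r. (F r - 1) / r\<^sup>2) \<longlongrightarrow> 0) (at_right 0)"
    and i: "i \<in> D" and k: "k < n"
  shows "B $$ (k,i) = 0"
proof -
  define s where "s = p / 2"
  have s: "s \<ge> 1" using p by (simp add: s_def)
  define c where "c i = (\<Sum>k<n. (cmod (B $$ (k,i)))\<^sup>2)" for i
  have c0: "c i \<ge> 0" for i by (simp add: c_def sum_nonneg)
  have d0: "(\<Sum>i<n. d i powr p) = 1"
    using rad[of 0] F0 schatten_sum_diag[of p n "\<lambda>i. complex_of_real (d i)"] d by (simp add: M_0 diag_real_def)
  define q where "q i = s * ((d i)\<^sup>2) powr (s - 1) * c i" for i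
  have qnn: "q i \<ge> 0" for i using s c0 by (simp add: q_def)
  have low: "d i powr p + (if i \<in> D then q i * r\<^sup>2 else 0) \<le> ((d i)\<^sup>2 + r\<^sup>2 * c i) powr s" if i: "i < n" for i r
  proof (cases "i \<in> D")
    case True
    then have di: "d i > 0" by (rule D_pos)
    have "d i powr p = ((d i)\<^sup>2) powr s" using di by (simp add: s_def powr_powr flip: powr_numeral)
    moreover have "((d i)\<^sup>2) powr s + s * ((d i)\<^sup>2) powr (s - 1) * ((d i)\<^sup>2 + r\<^sup>2 * c i - (d i)\<^sup>2) \<le> ((d i)\<^sup>2 + r\<^sup>2 * c i) powr s"
      using di c0 by (intro powr_tangent s) auto
    ultimately show ?thesis using True by (simp add: q_def mult_ac)
  next
    case False
    then have "d i = 0" using i d[of i] by (auto simp: D_def)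
    then show ?thesis using False by simp
  qed
  have key: "1 + (\<Sum>i\<in>D. q i) * r\<^sup>2 \<le> F r" if r: "r > 0" for r
  proof -
    define X where "X z i = (\<Sum>k<n. (cmod (M z $$ (k,i)))\<^sup>2)" for z i
    have X0: "X z i \<ge> 0" for z i by (simp add: X_def sum_nonneg)
    have mid: "(X (of_real r) i + X (- of_real r) i) / 2 = (d i)\<^sup>2 + r\<^sup>2 * c i" if "i < n" for i
      unfolding X_def col_norm_M[OF that] using r by (simp add: c_def)
    have F2: "(\<Sum>i<n. X z i powr s) \<le> F (cmod z)" for z
      unfolding X_def s_def rad[symmetric] by (rule schatten_sum_ge_cols[OF M_carrier p])
    have "(\<Sum>i<n. 2 * (d i powr p + (if i \<in> D then q i * r\<^sup>2 else 0))) \<le> (\<Sum>i<n. X (of_real r) i powr s + X (- of_real r) i powr s)"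
    proof (rule sum_mono)
      fix i assume "i \<in> {..<n}"
      then have i: "i < n" by simp
      have "2 * (d i powr p + (if i \<in> D then q i * r\<^sup>2 else 0)) \<le> 2 * ((X (of_real r) i + X (- of_real r) i) / 2) powr s"
        unfolding mid[OF i] using low[OF i, of r] by simp
      also have "\<dots> \<le> X (of_real r) i powr s + X (- of_real r) i powr s" by (rule powr_midpoint[OF s X0 X0])
      finally show "2 * (d i powr p + (if i \<in> D then q i * r\<^sup>2 else 0)) \<le> X (of_real r) i powr s + X (- of_real r) i powr s" .
    qed
    also have "\<dots> \<le> 2 * F r" using F2[of "of_real r"] F2[of "- of_real r"] r by (simp add: sum.distrib)
    also have "(\<Sum>i<n. 2 * (d i powr p + (if i \<in> D then q i * r\<^sup>2 else 0))) = 2 * (1 + (\<Sum>i\<in>D. q i) * r\<^sup>2)"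
    proof -
      have "(\<Sum>i<n. if i \<in> D then q i * r\<^sup>2 else 0) = (\<Sum>i\<in>D. q i * r\<^sup>2)"
        by (intro sum.mono_neutral_cong_right) (auto simp: D_def)
      then show ?thesis by (simp add: sum_distrib_left[symmetric] sum.distrib d0 sum_distrib_right)
    qed
    finally show ?thesis by simp
  qed
  have "eventually (\<lambda>r. (\<Sum>i\<in>D. q i) \<le> (F r - 1) / r\<^sup>2) (at_right 0)"
  proof (rule eventually_at_rightI[of 0 1])
    fix r :: real assume r: "r \<in> {0<..<1}"
    then show "(\<Sum>i\<in>D. q i) \<le> (F r - 1) / r\<^sup>2" using key[of r] by (subst pos_le_divide_eq) auto
  qed simp
  then have "(\<Sum>i\<in>D. q i) \<le> 0" by (intro tendsto_lowerbound[OF flat]) auto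
  then have "(\<Sum>i\<in>D. q i) = 0" using qnn by (intro antisym sum_nonneg) auto
  then have "q i = 0" using i qnn by (subst (asm) sum_nonneg_eq_0_iff) auto
  moreover have "s * ((d i)\<^sup>2) powr (s - 1) \<noteq> 0" using s D_pos[OF i] by simp
  ultimately have "c i = 0" unfolding q_def by simp
  then have "(cmod (B $$ (k,i)))\<^sup>2 = 0" unfolding c_def using k by (subst (asm) sum_nonneg_eq_0_iff) auto
  then show ?thesis by simp
qed

text \<open>Columns of \<open>B\<close> in \<open>D\<close> vanish by \<open>flat_col_zero\<close>,
  rows by the same lemma for the adjoint pencil, which has the same radial function since adjunction
  only conjugates \<open>z\<close>. At \<open>z = 1\<close> the two Schatten sums then add.\<close>

lemma flat_large_p:
  assumes p: "p \<ge> 2" and rad: "\<And>z. schatten_sum p (M z) = F (cmod z)" and F0: "F 0 = 1"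
    and flat: "((\<lambda>r. (F r - 1) / r\<^sup>2) \<longlongrightarrow> 0) (at_right 0)" and B1: "schatten_sum p B = 1"
  shows "F 1 = 2"
proof -
  have Bc: "mat_adjoint B \<in> carrier_mat n n" using B by simp
  interpret adj: diag_pencil n d "mat_adjoint B" by unfold_locales (use d Bc in auto)
  have DD: "adj.D = D" by (simp add: adj.D_def D_def)
  have adjM: "adj.M z = mat_adjoint (M (cnj z))" for z
    using B by (intro eq_matI) (auto simp: adj.M_def M_def)
  have adj_rad: "schatten_sum p (adj.M z) = F (cmod z)" for z
    unfolding adjM schatten_sum_adjoint[OF M_carrier] rad by simp
  have col: "B $$ (k,i) = 0" if "i \<in> D" "k < n" for i k by (rule flat_col_zero[OF p rad F0 flat that])
  have row: "B $$ (i,k) = 0" if "i \<in> D" "k < n" for i k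
  proof -
    have "mat_adjoint B $$ (k,i) = 0"
      using adj.flat_col_zero[OF p adj_rad F0 flat _ that(2), of i] that DD by simp
    moreover have "i < n" using that by (simp add: D_def)
    ultimately show ?thesis using that B by simp
  qed
  have "i \<in> D" if "i < n" "d i \<noteq> 0" for i using that d[of i] by (auto simp: D_def)
  then have "schatten_sum p (diag_real n d + B) = schatten_sum p (diag_real n d) + schatten_sum p B"
    using row col by (intro schatten_sum_orthogonal[OF B]) auto
  moreover have "M 1 = diag_real n d + B" using B by (auto simp: M_def intro!: eq_matI)
  moreover have "schatten_sum p (diag_real n d) = 1" using rad[of 0] F0 by (simp add: M_0)
  ultimately show ?thesis using rad[of 1] B1 by simp
qed

text \<open>At \<open>z = r\<close> and \<open>z = - r\<close> the linear terms of the quadratic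
  upper bound cancel, so \<open>(1 + r powr q) powr (p / q) - 1\<close> is O(r^2), although it
  behaves like \<open>(p / q) r^q\<close>.\<close>

lemma large_p_small_q:
  assumes p: "p \<ge> 2" and q: "0 < q" "q < 2"
    and rad: "\<And>z. schatten_sum p (M z) = (1 + cmod z powr q) powr (p / q)"
  shows False
proof -
  \<comment> \<open>\<open>L powr p\<close> is the Schatten sum on the unit circle, so
    \<open>L\<close> bounds all singular values of \<open>M z\<close> in the unit disc.\<close>
  define L where "L = 2 powr (1 / q)"
  have L1: "L \<ge> 1" unfolding L_def using q by (intro ge_one_powr_ge_zero) auto
  have Lp: "L powr p = 2 powr (p / q)" by (simp add: L_def powr_powr)
  have d0: "(\<Sum>i<n. d i powr p) = 1"
    using rad[of 0] q schatten_sum_diag[of p n "\<lambda>i. complex_of_real (d i)"] d by (simp add: M_0 diag_real_def)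
  have dL: "d i \<le> L" if "i < n" for i
  proof -
    have "d i powr p \<le> (\<Sum>i<n. d i powr p)" using that by (intro member_le_sum) auto
    then have "d i powr p \<le> 1 powr p" using d0 by simp
    then have "d i \<le> 1" using p d[of i] by (metis not_less powr_less_mono2 less_le_trans zero_less_numeral zero_le_one)
    then show ?thesis using L1 by simp
  qed
  define K where "K = p * (p - 1) * L powr (p - 2)"
  define b where "b = (\<Sum>i<n. \<Sum>k<n. (cmod (B $$ (k,i)))\<^sup>2)"
  have up: "schatten_sum p (M z) \<le> 1 + (\<Sum>i<n. p * d i powr (p - 1) * Re (z * B $$ (i,i))) + K * (b * (cmod z)\<^sup>2)"
    if z: "cmod z \<le> 1" for z
  proof -
    have bd: "schatten_sum p (M z) \<le> L powr p"
      unfolding rad Lp using z p q by (intro powr_mono2) (auto intro: powr_le1)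
    have Mii: "Re (M z $$ (i,i)) = d i + Re (z * B $$ (i,i))" if "i < n" for i
      using that B by (simp add: M_def)
    have frob: "(\<Sum>i<n. \<Sum>k<n. (cmod (M z $$ (k,i)))\<^sup>2) = (\<Sum>i<n. (d i)\<^sup>2 + 2 * d i * Re (z * B $$ (i,i))) + (cmod z)\<^sup>2 * b"
      unfolding b_def sum_distrib_left sum.distrib[symmetric] using col_norm_M
      by (intro sum.cong refl) (simp add: sum_distrib_left)
    have "schatten_sum p (M z) \<le> (\<Sum>i<n. d i powr p + p * d i powr (p - 1) * (Re (M z $$ (i,i)) - d i)) +
      K * ((\<Sum>i<n. \<Sum>k<n. (cmod (M z $$ (k,i)))\<^sup>2) - 2 * (\<Sum>i<n. d i * Re (M z $$ (i,i))) + (\<Sum>i<n. (d i)\<^sup>2))"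
      unfolding K_def by (rule schatten_sum_upper[OF M_carrier p _ _ bd]) (use L1 d dL in auto)
    also have "(\<Sum>i<n. d i powr p + p * d i powr (p - 1) * (Re (M z $$ (i,i)) - d i)) = 1 + (\<Sum>i<n. p * d i powr (p - 1) * Re (z * B $$ (i,i)))"
      using Mii by (simp add: sum.distrib d0)
    also have "(\<Sum>i<n. d i * Re (M z $$ (i,i))) = (\<Sum>i<n. (d i)\<^sup>2 + d i * Re (z * B $$ (i,i)))"
      by (intro sum.cong refl, subst Mii) (auto simp: power2_eq_square distrib_left)
    also have "(\<Sum>i<n. \<Sum>k<n. (cmod (M z $$ (k,i)))\<^sup>2) - 2 * (\<Sum>i<n. (d i)\<^sup>2 + d i * Re (z * B $$ (i,i))) + (\<Sum>i<n. (d i)\<^sup>2) = b * (cmod z)\<^sup>2"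
      unfolding frob by (simp add: sum.distrib sum_distrib_left mult_ac)
    finally show ?thesis .
  qed
  have "(1 + r powr q) powr (p / q) - 1 \<le> K * b * r powr 2" if r: "0 < r" "r \<le> 1" for r
  proof -
    have "schatten_sum p (M (of_real r)) + schatten_sum p (M (- of_real r)) \<le> 2 * (1 + K * (b * r\<^sup>2))"
      using up[of "of_real r"] up[of "- of_real r"] r by (simp add: sum_negf)
    then show ?thesis using r unfolding rad by simp
  qed
  then have "2 \<le> q"
    using p q by (intro tendsto_quotient_upper_exponent[OF powr_difference_quotient[OF q(1), of "p / q"]]) auto
  then show False using q by simp
qed

end

lemma schatten_sum_nonneg: "schatten_sum p A \<ge> 0"
proof -
  have "(\<Sum>s\<in>#S. s powr p) \<ge> 0" for S by (induction S) auto
  then show ?thesis by (simp add: schatten_sum_def)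
qed

lemma schatten_norm_powr:
  assumes "p > 0"
  shows "schatten_norm (ereal p) A powr p = schatten_sum p A"
  using assms schatten_sum_nonneg[of p A] by (simp add: schatten_norm_def schatten_sum_def powr_powr)

definition pair_vec :: "complex \<Rightarrow> complex \<Rightarrow> complex Matrix.vec" where
  "pair_vec a b = vec 2 (\<lambda>i. if i = 0 then a else b)"

lemma index_pair_vec [simp]: "pair_vec a b $ 0 = a" "pair_vec a b $ Suc 0 = b" "pair_vec a b \<in> carrier_vec 2"
  by (simp_all add: pair_vec_def)

theorem exponent_of_isometric_pair:
  assumes A: "A \<in> carrier_mat n n" and Bc: "B \<in> carrier_mat n n" and p: "0 < p" and q: "0 < q"
    and iso: "\<And>a b. schatten_norm (ereal p) (a \<cdot>\<^sub>m A + b \<cdot>\<^sub>m B) = ell_norm q (pair_vec a b)"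
  shows "q = ereal p \<or> q = 2"
proof (rule ccontr)
  assume neg: "\<not> (q = ereal p \<or> q = 2)"
  obtain U V d where U: "unitary n U" and V: "unitary n V" and d: "\<And>i. 0 \<le> d i"
    and svd: "A = U * diag_real n d * mat_adjoint V" using svd_exists[OF A] by blast
  have Uc: "U \<in> carrier_mat n n" and Vc: "V \<in> carrier_mat n n" using U V by auto
  \<comment> \<open>Transforming both matrices by the unitaries of the decomposition makes
    \<open>A\<close> diagonal and keeps all Schatten sums of the pencil.\<close>
  define B' where "B' = mat_adjoint U * B * V"
  have B'c: "B' \<in> carrier_mat n n" unfolding B'_def using Uc Vc Bc by (intro mult3_carrier) auto
  have BB': "B = U * B' * mat_adjoint V" by (rule unitary_conj_mult[OF U V Bc B'_def])
  interpret diag_pencil n d B' by unfold_locales (use d B'c in auto)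
  define N where "N r = ell_norm q (pair_vec 1 (complex_of_real r))" for r
  define F where "F r = N r powr p" for r
  have Nz: "ell_norm q (pair_vec 1 z) = N (cmod z)" for z
    by (auto simp: N_def ell_norm_def)
  have rad: "schatten_sum p (M z) = F (cmod z)" for z
  proof -
    have "1 \<cdot>\<^sub>m A + z \<cdot>\<^sub>m B = U * M z * mat_adjoint V"
    proof -
      have Va: "mat_adjoint V \<in> carrier_mat n n" using Vc by simp
      have UB: "U * B' \<in> carrier_mat n n" using Uc B'c by (rule mult_carrier_mat)
      have UD: "U * diag_real n d \<in> carrier_mat n n" by (rule mult_carrier_mat[OF Uc]) simp
      have "U * M z = U * diag_real n d + z \<cdot>\<^sub>m (U * B')"
        unfolding M_def using B'c by (simp add: mult_add_distrib_mat[OF Uc diag_real_carrier] mult_smult_distrib[OF Uc B'c])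
      then have "U * M z * mat_adjoint V = U * diag_real n d * mat_adjoint V + z \<cdot>\<^sub>m (U * B' * mat_adjoint V)"
        using UB by (simp add: add_mult_distrib_mat[OF UD _ Va] mult_smult_assoc_mat[OF UB Va])
      moreover have "1 \<cdot>\<^sub>m A = A" by (rule eq_matI) auto
      ultimately show ?thesis using svd BB' by simp
    qed
    then have "schatten_sum p (M z) = schatten_sum p (1 \<cdot>\<^sub>m A + z \<cdot>\<^sub>m B)"
      using schatten_sum_unitary[OF U V M_carrier] by simp
    then show ?thesis unfolding F_def Nz[symmetric] iso[symmetric] schatten_norm_powr[OF p] .
  qed
  have B1: "schatten_sum p B' = 1"
  proof -
    have "0 \<cdot>\<^sub>m A + 1 \<cdot>\<^sub>m B = B" using A Bc by (intro eq_matI) auto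
    then have "schatten_sum p B = ell_norm q (pair_vec 0 1) powr p"
      using iso[of 0 1] schatten_norm_powr[OF p, of B] by simp
    also have "ell_norm q (pair_vec 0 1) = 1" by (simp add: ell_norm_def)
    finally show ?thesis using schatten_sum_unitary[OF U V B'c, of p] BB' by simp
  qed
  have F0: "F 0 = 1" by (simp add: F_def N_def ell_norm_def)
  \<comment> \<open>Flatness excludes \<open>p < 2\<close>, where \<open>B'\<close> would be zero,
    and forces \<open>F 1 = 2\<close> otherwise; this serves both finite \<open>q > 2\<close> and
    \<open>q = \<infinity>\<close>.\<close>
  have flat_contra: "p \<ge> 2 \<and> F 1 = 2" if flat: "((\<lambda>r. (F r - 1) / r\<^sup>2) \<longlongrightarrow> 0) (at_right 0)"
  proof (cases "p < 2")
    case True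
    have "B' = 0\<^sub>m n n" by (rule flat_zero[OF p True rad F0 flat])
    also have "0\<^sub>m n n = mat n n (\<lambda>(i,j). if i = j then 0 else (0::complex))" by (rule eq_matI) auto
    finally have "schatten_sum p B' = 0" by (simp only: schatten_sum_diag) simp
    then show ?thesis using B1 by simp
  next
    case False
    then show ?thesis using flat_large_p[OF _ rad F0 flat B1] by simp
  qed
  show False
  proof (cases q)
    case (real q')
    then have q': "q' > 0" "q' \<noteq> p" "q' \<noteq> 2" using q neg by auto
    have F: "F r = (1 + \<bar>r\<bar> powr q') powr (p / q')" for r
      using real by (simp add: F_def N_def ell_norm_def powr_powr)
    then have rad': "schatten_sum p (M z) = (1 + cmod z powr q') powr (p / q')" for z using rad[of z] by simp
    show False
    proof (cases "q' < 2")
      case True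
      show False
      proof (cases "p < 2")
        case p2: True
        then show False using exponent_small_small[OF p p2 q'(1) True rad'] q' by simp
      next
        case False
        then show False using large_p_small_q[OF _ q'(1) True rad'] by simp
      qed
    next
      case False
      then have q2: "q' - 2 > 0" using q' by simp
      have "((\<lambda>r. ((1 + r powr q') powr (p / q') - 1) / r powr q' * r powr (q' - 2)) \<longlongrightarrow> p / q' * 0) (at_right 0)"
        by (intro tendsto_mult powr_difference_quotient q' tendsto_powr_at_right_0 q2)
      then have "((\<lambda>r. (F r - 1) / r\<^sup>2) \<longlongrightarrow> p / q' * 0) (at_right 0)"
        by (rule Lim_transform_eventually) (auto intro!: eventually_at_rightI[of 0 1] simp: F powr_diff)
      then have "F 1 = 2" using flat_contra by simp
      then have "2 powr (p / q') = 2 powr 1" by (simp add: F)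
      then have "p / q' = 1" using powr_inj[of 2 "p / q'" 1] by simp
      then show False using q' by simp
    qed
  next
    case PInf
    have F: "F r = 1" if "0 \<le> r" "r \<le> 1" for r using that PInf by (simp add: F_def N_def ell_norm_def)
    have "((\<lambda>r. (F r - 1) / r\<^sup>2) \<longlongrightarrow> 0) (at_right 0)"
      by (rule tendsto_eventually) (auto intro!: eventually_at_rightI[of 0 1] simp: F)
    then show False using flat_contra F[of 1] by simp
  next
    case MInf
    then show False using q by simp
  qed
qed

section \<open>Isometric embeddings\<close>

lemma linear_vec_mat_iff:
  "linear_map class_ring (module_vec TYPE(complex) k) (module_mat TYPE(complex) n n) T \<longleftrightarrow>
     (\<forall>x\<in>carrier_vec k. T x \<in> carrier_mat n n) \<and>
     (\<forall>x\<in>carrier_vec k. \<forall>y\<in>carrier_vec k. T (x + y) = T x + T y) \<and>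
     (\<forall>c. \<forall>x\<in>carrier_vec k. T (c \<cdot>\<^sub>v x) = c \<cdot>\<^sub>m T x)"
  (is "?L \<longleftrightarrow> ?R")
proof
  assume ?L
  then interpret linear_map class_ring "module_vec TYPE(complex) k" "module_mat TYPE(complex) n n" T .
  show ?R using f_hom unfolding module_hom_def by (auto simp: module_vec_simps module_mat_simps class_ring_simps)
next
  assume R: ?R
  show ?L
    by (intro linear_map.intro mod_hom.intro mod_hom_axioms.intro vec_vs matrix_vs
        vectorspace.axioms(1)[OF vec_vs] vectorspace.axioms(1)[OF matrix_vs])
      (use R in \<open>auto simp: module_hom_def module_vec_simps module_mat_simps class_ring_simps\<close>)
qed

lemma linear_mat_mat_dest:
  assumes "linear_map class_ring (module_mat TYPE(complex) m m) (module_mat TYPE(complex) n n) T"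
  shows "x \<in> carrier_mat m m \<Longrightarrow> T x \<in> carrier_mat n n"
    "x \<in> carrier_mat m m \<Longrightarrow> y \<in> carrier_mat m m \<Longrightarrow> T (x + y) = T x + T y"
    "x \<in> carrier_mat m m \<Longrightarrow> T (c \<cdot>\<^sub>m x) = c \<cdot>\<^sub>m T x"
proof -
  interpret linear_map class_ring "module_mat TYPE(complex) m m" "module_mat TYPE(complex) n n" T by (rule assms)
  show "x \<in> carrier_mat m m \<Longrightarrow> T x \<in> carrier_mat n n"
    "x \<in> carrier_mat m m \<Longrightarrow> y \<in> carrier_mat m m \<Longrightarrow> T (x + y) = T x + T y"
    "x \<in> carrier_mat m m \<Longrightarrow> T (c \<cdot>\<^sub>m x) = c \<cdot>\<^sub>m T x"
    using f_hom unfolding module_hom_def by (auto simp: module_mat_simps class_ring_simps)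
qed

text \<open>The diagonal copy is isometric for equal exponents on both sides, infinity included; it
  gives the embedding for \<open>q = p\<close> and transfers the obstruction to matrix
  spaces.\<close>

definition diag2 :: "nat \<Rightarrow> complex Matrix.vec \<Rightarrow> complex mat" where
  "diag2 n v = mat n n (\<lambda>(i,j). if i = j then (if i < 2 then v $ i else 0) else 0)"

text \<open>A matrix with a single nonzero row has rank at most one, so its only possible nonzero
  singular value is the Euclidean norm of that row, whatever \<open>p\<close> is.\<close>

definition row2 :: "nat \<Rightarrow> complex Matrix.vec \<Rightarrow> complex mat" where
  "row2 n v = mat n n (\<lambda>(i,j). if i = 0 \<and> j < 2 then v $ j else 0)"

lemma sum_first_two:
  fixes g :: "nat \<Rightarrow> 'a :: comm_monoid_add"
  assumes "n \<ge> 2" "\<And>k. k \<ge> 2 \<Longrightarrow> g k = 0"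
  shows "(\<Sum>k<n. g k) = g 0 + g 1"
proof -
  have "(\<Sum>k<n. g k) = (\<Sum>k<2. g k)"
    using assms by (intro sum.mono_neutral_right) auto
  then show ?thesis by (simp add: numeral_2_eq_2)
qed

lemma schatten_sum_diag2:
  assumes "n \<ge> 2" "p > 0"
  shows "schatten_sum p (diag2 n v) = cmod (v $ 0) powr p + cmod (v $ 1) powr p"
proof -
  have "schatten_sum p (diag2 n v) = (\<Sum>k<n. cmod (if k < 2 then v $ k else 0) powr p)"
    unfolding diag2_def by (rule schatten_sum_diag)
  also have "\<dots> = cmod (v $ 0) powr p + cmod (v $ 1) powr p"
    using assms by (subst sum_first_two) auto
  finally show ?thesis .
qed

lemma schatten_norm_diag2:
  assumes "n \<ge> 2" "p > 0"
  shows "schatten_norm (ereal p) (diag2 n v) = ell_norm (ereal p) v"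
  using schatten_sum_diag2[OF assms, of v]
  by (simp add: schatten_norm_def ell_norm_def schatten_sum_def)

lemma schatten_sum_row2:
  assumes n: "n \<ge> 2" and p: "p > 0"
  shows "schatten_sum p (row2 n v) = sqrt ((cmod (v $ 0))\<^sup>2 + (cmod (v $ 1))\<^sup>2) powr p"
proof -
  define r where "r = sqrt ((cmod (v $ 0))\<^sup>2 + (cmod (v $ 1))\<^sup>2)"
  have r0: "r \<ge> 0" by (simp add: r_def)
  have r2: "r\<^sup>2 = (cmod (v $ 0))\<^sup>2 + (cmod (v $ 1))\<^sup>2" by (simp add: r_def)
  \<comment> \<open>The right singular vector: the normalised conjugate of the row, or an arbitrary
    unit vector if the row is zero.\<close>
  define x where "x = (if r = 0 then unit_vec n 0 else vec n (\<lambda>j. if j < 2 then cnj (v $ j) / r else 0))"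
  have xc: "x \<in> carrier_vec n" by (simp add: x_def)
  have "(\<Sum>j<n. (cmod (x $ j))\<^sup>2) = 1"
  proof (cases "r = 0")
    case True
    then have "(\<Sum>j<n. (cmod (x $ j))\<^sup>2) = (\<Sum>j<n. if j = 0 then 1 else 0)"
      by (intro sum.cong) (auto simp: x_def)
    then show ?thesis using n by simp
  next
    case False
    have "(\<Sum>j<n. (cmod (x $ j))\<^sup>2) = (\<Sum>j<n. if j < 2 then (cmod (v $ j))\<^sup>2 / r\<^sup>2 else 0)"
      using False by (intro sum.cong) (auto simp: x_def norm_divide power_divide)
    also have "\<dots> = (cmod (v $ 0))\<^sup>2 / r\<^sup>2 + (cmod (v $ 1))\<^sup>2 / r\<^sup>2" using n by (subst sum_first_two) auto
    also have "\<dots> = 1" unfolding add_divide_distrib[symmetric] r2[symmetric] using False by simp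
    finally show ?thesis .
  qed
  then obtain V where V: "unitary n V" and V0: "\<And>j. j < n \<Longrightarrow> V $$ (j,0) = x $ j"
    using unitary_with_first_col[OF xc] by blast
  have Vc: "V \<in> carrier_mat n n" using V by simp
  define s where "s k = (if k = 0 then r else 0)" for k :: nat
  have vx: "complex_of_real r * cnj (x $ j) = (if j < 2 then v $ j else 0)" if "j < n" for j
  proof (cases "r = 0")
    case True
    then have "(cmod (v $ 0))\<^sup>2 + (cmod (v $ 1))\<^sup>2 = 0" using r2 by simp
    then have "v $ 0 = 0" "v $ 1 = 0" by (simp_all add: add_nonneg_eq_0_iff)
    then have "v $ j = 0" if "j < 2" using that by (cases j) (auto simp: less_Suc_eq numeral_2_eq_2)
    then show ?thesis using True by simp
  next
    case False
    then show ?thesis using that by (simp add: x_def)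
  qed
  have "row2 n v = 1\<^sub>m n * diag_real n s * mat_adjoint V"
  proof (rule eq_matI)
    fix i j assume "i < dim_row (1\<^sub>m n * diag_real n s * mat_adjoint V)" "j < dim_col (1\<^sub>m n * diag_real n s * mat_adjoint V)"
    then have ij: "i < n" "j < n" using Vc by auto
    have "(1\<^sub>m n * diag_real n s * mat_adjoint V) $$ (i,j) = (\<Sum>k<n. 1\<^sub>m n $$ (i,k) * complex_of_real (s k) * cnj (V $$ (j,k)))"
      by (rule index_svd[OF one_carrier_mat Vc ij])
    also have "\<dots> = (\<Sum>k<n. if k = i then complex_of_real (s i) * cnj (V $$ (j,i)) else 0)"
      by (intro sum.cong) (use ij in auto)
    also have "\<dots> = complex_of_real (s i) * cnj (V $$ (j,i))" using ij by simp
    finally show "row2 n v $$ (i,j) = (1\<^sub>m n * diag_real n s * mat_adjoint V) $$ (i,j)"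
      using ij V0[OF ij(2)] vx[OF ij(2)] by (auto simp: row2_def s_def)
  qed (use Vc in \<open>auto simp: row2_def\<close>)
  then have "schatten_sum p (row2 n v) = (\<Sum>k<n. s k powr p)"
    using schatten_sum_svd[OF unitary_one V, of s p] r0 by (simp add: s_def)
  also have "\<dots> = r powr p" using n p by (subst sum_first_two) (auto simp: s_def)
  finally show ?thesis by (simp add: r_def)
qed

lemma schatten_norm_row2:
  assumes "n \<ge> 2" "p > 0"
  shows "schatten_norm (ereal p) (row2 n v) = ell_norm 2 v"
proof -
  have "schatten_norm (ereal p) (row2 n v) = sqrt ((cmod (v $ 0))\<^sup>2 + (cmod (v $ 1))\<^sup>2)"
    using schatten_sum_row2[OF assms, of v] assms by (simp add: schatten_norm_def schatten_sum_def powr_powr)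
  also have "\<dots> = ell_norm 2 v" by (simp add: ell_norm_def powr_half_sqrt)
  finally show ?thesis .
qed

text \<open>Covers \<open>q = \<infinity>\<close>, where the Schatten norm is defined without
  singular values. The supremum is attained at the unit vector of the larger entry.\<close>

lemma operator_norm_diag2:
  assumes m: "m \<ge> 2"
  shows "operator_norm (diag2 m v) = max (cmod (v $ 0)) (cmod (v $ 1))"
proof -
  define c where "c k = (if k < 2 then v $ k else 0)" for k
  define K where "K = max (cmod (v $ 0)) (cmod (v $ 1))"
  have K0: "K \<ge> 0" by (simp add: K_def le_max_iff_disj)
  have cK: "cmod (c k) \<le> K" for k
    using K0 by (cases k) (auto simp: c_def K_def less_Suc_eq numeral_2_eq_2)
  have app: "(diag2 m v *\<^sub>v x) $ k = c k * x $ k" if "x \<in> carrier_vec m" "k < m" for x k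
  proof -
    have "(diag2 m v *\<^sub>v x) $ k = (\<Sum>j<m. diag2 m v $$ (k,j) * x $ j)"
      using that by (simp add: scalar_prod_def atLeast0LessThan diag2_def)
    also have "\<dots> = (\<Sum>j<m. if j = k then c k * x $ k else 0)"
      using that by (intro sum.cong) (auto simp: diag2_def c_def)
    finally have "(diag2 m v *\<^sub>v x) $ k = (\<Sum>j<m. if j = k then c k * x $ k else 0)" .
    then show ?thesis using that by simp
  qed
  have eu: "euclidean_norm (diag2 m v *\<^sub>v x) = sqrt (\<Sum>k<m. (cmod (c k))\<^sup>2 * (cmod (x $ k))\<^sup>2)" if "x \<in> carrier_vec m" for x
  proof -
    have "dim_vec (diag2 m v *\<^sub>v x) = m" by (simp add: diag2_def)
    then show ?thesis unfolding euclidean_norm_def using app[OF that]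
      by (auto simp: norm_mult power_mult_distrib intro!: arg_cong[of _ _ sqrt] sum.cong)
  qed
  let ?S = "(\<lambda>x. euclidean_norm (diag2 m v *\<^sub>v x)) ` {x \<in> carrier_vec (dim_col (diag2 m v)). euclidean_norm x \<le> 1}"
  have dc: "dim_col (diag2 m v) = m" by (simp add: diag2_def)
  have "Sup ?S = K"
  proof (rule cSup_eq_maximum)
    obtain i where i: "i < 2" "cmod (v $ i) = K"
      unfolding K_def by (metis max_def zero_less_numeral one_less_numeral_iff semiring_norm(76))
    have im: "i < m" using i m by simp
    have n1: "euclidean_norm (unit_vec m i :: complex Matrix.vec) = 1"
    proof -
      have "(\<Sum>k<m. (cmod (unit_vec m i $ k :: complex))\<^sup>2) = (\<Sum>k<m. if k = i then 1 else 0)"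
        using im by (intro sum.cong) auto
      then show ?thesis using im by (simp add: euclidean_norm_def)
    qed
    have "(\<Sum>k<m. (cmod (c k))\<^sup>2 * (cmod (unit_vec m i $ k :: complex))\<^sup>2) = (\<Sum>k<m. if k = i then K\<^sup>2 else 0)"
      using im i by (intro sum.cong) (auto simp: c_def)
    then have "euclidean_norm (diag2 m v *\<^sub>v unit_vec m i) = K" using im K0 by (simp add: eu)
    then show "K \<in> ?S" using n1 dc by (intro image_eqI[where x = "unit_vec m i"]) auto
  next
    fix y assume "y \<in> ?S"
    then obtain x where x: "x \<in> carrier_vec m" "euclidean_norm x \<le> 1" "y = euclidean_norm (diag2 m v *\<^sub>v x)"
      using dc by auto
    have "(\<Sum>k<m. (cmod (c k))\<^sup>2 * (cmod (x $ k))\<^sup>2) \<le> (\<Sum>k<m. K\<^sup>2 * (cmod (x $ k))\<^sup>2)"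
      using cK by (intro sum_mono mult_right_mono power_mono) auto
    then have "y \<le> sqrt (K\<^sup>2 * (\<Sum>k<m. (cmod (x $ k))\<^sup>2))"
      unfolding x(3) eu[OF x(1)] sum_distrib_left[symmetric] by simp
    also have "\<dots> = K * euclidean_norm x" using x(1) K0 by (simp add: real_sqrt_mult euclidean_norm_def)
    also have "\<dots> \<le> K * 1" using x(2) K0 by (intro mult_left_mono) auto
    finally show "y \<le> K" by simp
  qed
  then show ?thesis by (simp add: operator_norm_def K_def)
qed

lemma schatten_norm_diag2_ereal:
  assumes "m \<ge> 2" "q > 0"
  shows "schatten_norm q (diag2 m v) = ell_norm q v"
proof (cases q)
  case (real r)
  then show ?thesis using assms schatten_norm_diag2[of m r v] by simp
next
  case PInf
  then show ?thesis using operator_norm_diag2[OF assms(1)] by (simp add: schatten_norm_def ell_norm_def)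
qed (use assms in simp)

lemma diag2_linear:
  "linear_map class_ring (module_vec TYPE(complex) 2) (module_mat TYPE(complex) n n) (diag2 n)"
  unfolding linear_vec_mat_iff by (auto simp: diag2_def intro!: eq_matI)

lemma row2_linear:
  "linear_map class_ring (module_vec TYPE(complex) 2) (module_mat TYPE(complex) n n) (row2 n)"
  unfolding linear_vec_mat_iff by (auto simp: row2_def intro!: eq_matI)

lemma pair_vec_combination: "pair_vec a b = a \<cdot>\<^sub>v pair_vec 1 0 + b \<cdot>\<^sub>v pair_vec 0 1"
  by (intro eq_vecI) (auto simp: pair_vec_def)

lemma exponent_of_isometric_embedding:
  fixes p :: real and q :: ereal
  assumes "0 < p" "0 < q"
    and T: "isometric_embedding (module_vec TYPE(complex) 2) (ell_norm q)
      (module_mat TYPE(complex) n n) (schatten_norm (ereal p)) T"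
  shows "q = ereal p \<or> q = 2"
proof (rule exponent_of_isometric_pair[OF _ _ assms(1,2)])
  have lin: "\<And>x. x \<in> carrier_vec 2 \<Longrightarrow> T x \<in> carrier_mat n n"
    "\<And>x y. x \<in> carrier_vec 2 \<Longrightarrow> y \<in> carrier_vec 2 \<Longrightarrow> T (x + y) = T x + T y"
    "\<And>c x. x \<in> carrier_vec 2 \<Longrightarrow> T (c \<cdot>\<^sub>v x) = c \<cdot>\<^sub>m T x"
    and iso: "\<And>x. x \<in> carrier_vec 2 \<Longrightarrow> schatten_norm (ereal p) (T x) = ell_norm q x"
    using T unfolding isometric_embedding_def linear_vec_mat_iff by (auto simp: module_vec_simps)
  show "T (pair_vec 1 0) \<in> carrier_mat n n" "T (pair_vec 0 1) \<in> carrier_mat n n" by (simp_all add: lin)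
  fix a b
  have "T (pair_vec a b) = a \<cdot>\<^sub>m T (pair_vec 1 0) + b \<cdot>\<^sub>m T (pair_vec 0 1)"
    unfolding pair_vec_combination[of a b] by (simp add: lin)
  then show "schatten_norm (ereal p) (a \<cdot>\<^sub>m T (pair_vec 1 0) + b \<cdot>\<^sub>m T (pair_vec 0 1)) = ell_norm q (pair_vec a b)"
    using iso[of "pair_vec a b"] by simp
qed

text \<open>Restricting to the diagonal copy reduces embeddings of a matrix space to embeddings of
  the two-dimensional space.\<close>

lemma isometric_embedding_compose_diag2:
  assumes "m \<ge> 2" "q > 0"
    and T: "isometric_embedding (module_mat TYPE(complex) m m) (schatten_norm q)
      (module_mat TYPE(complex) n n) (schatten_norm p) T"
  shows "isometric_embedding (module_vec TYPE(complex) 2) (ell_norm q)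
      (module_mat TYPE(complex) n n) (schatten_norm p) (T \<circ> diag2 m)"
proof -
  have lm: "linear_map class_ring (module_mat TYPE(complex) m m) (module_mat TYPE(complex) n n) T"
    and iso: "\<And>x. x \<in> carrier_mat m m \<Longrightarrow> schatten_norm p (T x) = schatten_norm q x"
    using T unfolding isometric_embedding_def by (auto simp: module_mat_simps)
  have D: "\<And>x. x \<in> carrier_vec 2 \<Longrightarrow> diag2 m x \<in> carrier_mat m m"
    "\<And>x y. x \<in> carrier_vec 2 \<Longrightarrow> y \<in> carrier_vec 2 \<Longrightarrow> diag2 m (x + y) = diag2 m x + diag2 m y"
    "\<And>c x. x \<in> carrier_vec 2 \<Longrightarrow> diag2 m (c \<cdot>\<^sub>v x) = c \<cdot>\<^sub>m diag2 m x"
    using diag2_linear[of m] unfolding linear_vec_mat_iff by auto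
  have "schatten_norm p ((T \<circ> diag2 m) x) = ell_norm q x" if "x \<in> carrier_vec 2" for x
    using iso[OF D(1)[OF that]] schatten_norm_diag2_ereal[OF assms(1,2), of x] by simp
  then show ?thesis
    unfolding isometric_embedding_def linear_vec_mat_iff
    by (simp add: module_vec_simps D linear_mat_mat_dest[OF lm])
qed

theorem theorem1p2:
  fixes n :: nat and p :: real and q :: ereal
  assumes "n \<ge> 2" and "0 < p" and "0 < q"
  shows "((\<exists>T. isometric_embedding
               (module_vec TYPE(complex) 2) (ell_norm q)
               (module_mat TYPE(complex) n n) (schatten_norm (ereal p)) T)
            \<longleftrightarrow> q = ereal p \<or> q = 2)
         \<and> (\<forall>m::nat. m \<ge> 2 \<and> ereal p \<noteq> q \<and> q \<noteq> 2 \<longrightarrow>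
              \<not> (\<exists>T. isometric_embedding
                      (module_mat TYPE(complex) m m) (schatten_norm q)
                      (module_mat TYPE(complex) n n) (schatten_norm (ereal p)) T))"
proof (intro conjI iffI allI impI)
  assume "\<exists>T. isometric_embedding (module_vec TYPE(complex) 2) (ell_norm q)
    (module_mat TYPE(complex) n n) (schatten_norm (ereal p)) T"
  then show "q = ereal p \<or> q = 2" using exponent_of_isometric_embedding[OF assms(2,3)] by blast
next
  assume "q = ereal p \<or> q = 2"
  then show "\<exists>T. isometric_embedding (module_vec TYPE(complex) 2) (ell_norm q)
    (module_mat TYPE(complex) n n) (schatten_norm (ereal p)) T"
  proof
    assume "q = ereal p"
    then have "isometric_embedding (module_vec TYPE(complex) 2) (ell_norm q)
      (module_mat TYPE(complex) n n) (schatten_norm (ereal p)) (diag2 n)"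
      using diag2_linear schatten_norm_diag2[OF assms(1,2)] by (simp add: isometric_embedding_def)
    then show ?thesis by blast
  next
    assume "q = 2"
    then have "isometric_embedding (module_vec TYPE(complex) 2) (ell_norm q)
      (module_mat TYPE(complex) n n) (schatten_norm (ereal p)) (row2 n)"
      using row2_linear schatten_norm_row2[OF assms(1,2)] by (simp add: isometric_embedding_def)
    then show ?thesis by blast
  qed
next
  fix m :: nat assume m: "m \<ge> 2 \<and> ereal p \<noteq> q \<and> q \<noteq> 2"
  show "\<not> (\<exists>T. isometric_embedding (module_mat TYPE(complex) m m) (schatten_norm q)
    (module_mat TYPE(complex) n n) (schatten_norm (ereal p)) T)"
  proof
    assume "\<exists>T. isometric_embedding (module_mat TYPE(complex) m m) (schatten_norm q)
      (module_mat TYPE(complex) n n) (schatten_norm (ereal p)) T"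
    then obtain T where "isometric_embedding (module_mat TYPE(complex) m m) (schatten_norm q)
      (module_mat TYPE(complex) n n) (schatten_norm (ereal p)) T" by blast
    then have "isometric_embedding (module_vec TYPE(complex) 2) (ell_norm q)
      (module_mat TYPE(complex) n n) (schatten_norm (ereal p)) (T \<circ> diag2 m)"
      using m assms(3) by (intro isometric_embedding_compose_diag2) auto
    from exponent_of_isometric_embedding[OF assms(2,3) this] show False using m by auto
  qed
qed

end
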